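(* Let $M$ be a closed manifold. Let $L\colon TM\to\mathbb{R}$ be a Tonelli Lagrangian, let $V\in C^2(M)$ be such that $\max_M V=0$, and let $L_V:=L+V$, i.e. $L_V(x,v)=L(x,v)+V(x)$. Then: (i) $\beta_{L_V}(h)\le\beta_L(h)$ for every $h\in H_1(M;\mathbb{R})$. (ii) Let $h\in H_1(M;\mathbb{R})\setminus\{0\}$. Then $\beta_{L_V}(h)=\beta_L(h)$ if and only if $\mathfrak M_L^h\subseteq\mathfrak M_{L_V}^h$ and $V\equiv0$ on $\widetilde{\mathcal M}_L^h\subseteq\widetilde{\mathcal M}_{L_V}^h$ (that is, $\widetilde{\mathcal M}_L^h\subseteq\widetilde{\mathcal M}_{L_V}^h$ and $V(x)=0$ for every $(x,v)\in\widetilde{\mathcal M}_L^h$). (iii) Let $M=\mathbb{T}^n$ and $L(x,v)=\ell(v)$ (using the identification $T\mathbb{T}^n\cong\mathbb{T}^n\times\mathbb{R}^n$), i.e., it is a completely integrable system. Let $h\in H_1(M;\mathbb{R})\setminus\{0\}$. Then, considering $\ell_V:=\ell+V$, we have $\beta_{\ell_V}(h)=\beta_\ell(h)$ if and only if $V\equiv0$ on $M$.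
   Context: Let $M$ be a closed (compact, without boundary) manifold, with a fixed auxiliary Riemannian norm $\|\cdot\|_x$ on each $T_xM$. A Lagrangian $L\colon TM\to\mathbb{R}$ is Tonelli if: $L\in C^2(TM)$; $L$ is strictly convex in the fibers, i.e. $\frac{\partial^2L}{\partial v^2}(x,v)$ is positive definite for all $(x,v)\in TM$; and $L$ is superlinear in each fiber, i.e. $\lim_{\|v\|\to+\infty}\frac{L(x,v)}{\|v\|}=+\infty$ uniformly in $x\in M$. If $L$ is Tonelli and $V\in C^2(M)$ then $L+V$ (with $V$ viewed as a function on $TM$ via the projection) is Tonelli. $\mathcal M(TM)$ denotes the set of Borel probability measures $\mu$ on $TM$ that are closed, i.e. $\int_{TM} df_x(v)\,d\mu(x,v)=0$ for every $f\in C^1(M)$, and have finite first momentum, i.e. $\int_{TM}\|v\|_x\,d\mu<\infty$. The rotation vector (Schwartzman asymptotic cycle) of $\mu\in\mathcal M(TM)$ is the class $\rho(\mu)\in H_1(M;\mathbb{R})$ determined by $\langle[\eta],\rho(\mu)\rangle=\int_{TM}\eta_x(v)\,d\mu(x,v)$ for every closed smooth 1-form $\eta$ on $M$, where $\langle\cdot,\cdot\rangle$ is the pairing between $H^1(M;\mathbb{R})$ and $H_1(M;\mathbb{R})$. The map $\rho\colon\mathcal M(TM)\to H_1(M;\mathbb{R})$ is surjective. Mather's $\beta$-function of a Tonelli Lagrangian $L$ is $\beta_L(h):=\min_{\mu\in\rho^{-1}(h)}\int_{TM}L(x,v)\,d\mu$, $h\in H_1(M;\mathbb{R})$ (the minimum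 is attained). $\mathfrak M_L^h$ denotes the set of Mather measures of rotation vector $h$, i.e. the measures $\mu\in\rho^{-1}(h)$ realizing this minimum. The Mather set $\widetilde{\mathcal M}_L^h\subset TM$ of homology $h$ is the closure of the union of the supports of all measures in $\mathfrak M_L^h$. In (iii), $\beta_\ell$ and $\beta_{\ell_V}$ denote the $\beta$-functions of the Lagrangians $(x,v)\mapsto\ell(v)$ and $(x,v)\mapsto\ell(v)+V(x)$. *)

theory Defs
  imports
    "HOL-Analysis.Analysis"
    "HOL-Probability.Probability"
    "HOL-Homology.Homology"
begin

section \<open>Differentiability of class $C^k$ on open sets\<close>

text \<open>Only used for open sets of finite-dimensional spaces, where it is the usual notion: all
  directional derivatives up to order \<open>k\<close> exist and are continuous, and all but those of
  the last order are differentiable.\<close>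

primrec Ck_on :: "nat \<Rightarrow> 'e::real_normed_vector set \<Rightarrow> ('e \<Rightarrow> 'f::real_normed_vector) \<Rightarrow> bool" where
  "Ck_on 0 S f \<longleftrightarrow> continuous_on S f"
| "Ck_on (Suc k) S f \<longleftrightarrow>
     (\<forall>x\<in>S. f differentiable (at x)) \<and> (\<forall>v. Ck_on k S (\<lambda>x. frechet_derivative f (at x) v))"

definition smooth_on :: "'e::real_normed_vector set \<Rightarrow> ('e \<Rightarrow> 'f::real_normed_vector) \<Rightarrow> bool" where
  "smooth_on S f \<longleftrightarrow> (\<forall>k. Ck_on k S f)"


section \<open>Smooth manifolds\<close>

text \<open>A chart is its domain together with its coordinate map; the values of the coordinate map
  outside the domain are irrelevant.  The atlas need not be maximal.\<close>

type_synonym ('a, 'e) chart = "'a set \<times> ('a \<Rightarrow> 'e)"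

record ('a, 'e) manifold =
  mtop :: "'a topology"
  atlas :: "('a, 'e) chart set"

definition chart_inv :: "('a, 'e) chart \<Rightarrow> 'e \<Rightarrow> 'a" where
  "chart_inv c = inv_into (fst c) (snd c)"

definition transition :: "('a, 'e) chart \<Rightarrow> ('a, 'e) chart \<Rightarrow> 'e \<Rightarrow> 'e" where
  "transition c d = snd d \<circ> chart_inv c"

definition charts_at :: "('a, 'e) manifold \<Rightarrow> 'a \<Rightarrow> ('a, 'e) chart set" where
  "charts_at M x = {c \<in> atlas M. x \<in> fst c}"

definition smooth_atlas :: "('a, 'e::euclidean_space) manifold \<Rightarrow> bool" where
  "smooth_atlas M \<longleftrightarrow>
     \<Union> (fst ` atlas M) = topspace (mtop M) \<and>
     (\<forall>c\<in>atlas M. openin (mtop M) (fst c) \<and> open (snd c ` fst c) \<and>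
        homeomorphic_map (subtopology (mtop M) (fst c)) (top_of_set (snd c ` fst c)) (snd c)) \<and>
     (\<forall>c\<in>atlas M. \<forall>d\<in>atlas M. smooth_on (snd c ` (fst c \<inter> fst d)) (transition c d))"

definition closed_manifold :: "('a, 'e::euclidean_space) manifold \<Rightarrow> bool" where
  "closed_manifold M \<longleftrightarrow>
     Hausdorff_space (mtop M) \<and> second_countable (mtop M) \<and> compact_space (mtop M) \<and>
     smooth_atlas M"

definition Ck_fun :: "nat \<Rightarrow> ('a, 'e::real_normed_vector) manifold \<Rightarrow> ('a \<Rightarrow> real) \<Rightarrow> bool" where
  "Ck_fun k M f \<longleftrightarrow> (\<forall>c\<in>atlas M. Ck_on k (snd c ` fst c) (f \<circ> chart_inv c))"


section \<open>The tangent bundle\<close>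

text \<open>A tangent vector at \<open>x\<close> is the family of its coordinate vectors in all the charts around
  \<open>x\<close>, related by the derivatives of the transition maps; the entries at all other charts
  are set to \<open>0\<close>.\<close>

type_synonym ('a, 'e) tvector = "('a, 'e) chart \<Rightarrow> 'e"

definition tangent_space ::
  "('a, 'e::real_normed_vector) manifold \<Rightarrow> 'a \<Rightarrow> ('a, 'e) tvector set" where
  "tangent_space M x =
     {v. (\<forall>c. c \<notin> charts_at M x \<longrightarrow> v c = 0) \<and>
         (\<forall>c\<in>charts_at M x. \<forall>d\<in>charts_at M x.
            v d = frechet_derivative (transition c d) (at (snd c x)) (v c))}"

text \<open>The tangent vector at \<open>x\<close> whose coordinates in the chart \<open>c\<close> are \<open>w\<close>; its
  inverse is the map taking \<open>v\<close> to \<open>v c\<close>.\<close>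

definition tvec ::
  "('a, 'e::real_normed_vector) manifold \<Rightarrow> ('a, 'e) chart \<Rightarrow> 'a \<Rightarrow> 'e \<Rightarrow> ('a, 'e) tvector" where
  "tvec M c x w =
     (\<lambda>d. if d \<in> charts_at M x then frechet_derivative (transition c d) (at (snd c x)) w else 0)"

definition TM :: "('a, 'e::real_normed_vector) manifold \<Rightarrow> ('a \<times> ('a, 'e) tvector) set" where
  "TM M = Sigma (topspace (mtop M)) (tangent_space M)"

definition tchart ::
  "('a, 'e::real_normed_vector) manifold \<Rightarrow> ('a, 'e) chart
     \<Rightarrow> ('a \<times> ('a, 'e) tvector, 'e \<times> 'e) chart" where
  "tchart M c = ({p \<in> TM M. fst p \<in> fst c}, (\<lambda>(x, v). (snd c x, v c)))"

definition TM_topology ::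
  "('a, 'e::real_normed_vector) manifold \<Rightarrow> ('a \<times> ('a, 'e) tvector) topology" where
  "TM_topology M = topology_generated_by
     {{p \<in> fst (tchart M c). snd (tchart M c) p \<in> W} | c W. c \<in> atlas M \<and> open W}"

definition tangent_bundle ::
  "('a, 'e::real_normed_vector) manifold \<Rightarrow> ('a \<times> ('a, 'e) tvector, 'e \<times> 'e) manifold" where
  "tangent_bundle M = \<lparr> mtop = TM_topology M, atlas = tchart M ` atlas M \<rparr>"

text \<open>The differential of a function, evaluated in any chart around the base point.\<close>

definition mdiff ::
  "('a, 'e::real_normed_vector) manifold \<Rightarrow> ('a \<Rightarrow> real) \<Rightarrow> 'a \<times> ('a, 'e) tvector \<Rightarrow> real" where
  "mdiff M f = (\<lambda>(x, v). let c = (SOME c. c \<in> charts_at M x)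
                        in frechet_derivative (f \<circ> chart_inv c) (at (snd c x)) (v c))"


section \<open>Riemannian metrics and Tonelli Lagrangians\<close>

definition riemannian_metric ::
  "('a, 'e::real_normed_vector) manifold
     \<Rightarrow> ('a \<Rightarrow> ('a, 'e) tvector \<Rightarrow> ('a, 'e) tvector \<Rightarrow> real) \<Rightarrow> bool" where
  "riemannian_metric M g \<longleftrightarrow>
     (\<forall>c\<in>atlas M.
        (\<forall>x\<in>fst c. bilinear (\<lambda>u w. g x (tvec M c x u) (tvec M c x w)) \<and>
           (\<forall>u w. g x (tvec M c x u) (tvec M c x w) = g x (tvec M c x w) (tvec M c x u)) \<and>
           (\<forall>u. u \<noteq> 0 \<longrightarrow> g x (tvec M c x u) (tvec M c x u) > 0)) \<and>
        (\<forall>u w. smooth_on (snd c ` fst c)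
           (\<lambda>y. g (chart_inv c y) (tvec M c (chart_inv c y) u) (tvec M c (chart_inv c y) w))))"

definition tnorm ::
  "('a \<Rightarrow> ('a, 'e) tvector \<Rightarrow> ('a, 'e) tvector \<Rightarrow> real) \<Rightarrow> 'a \<times> ('a, 'e) tvector \<Rightarrow> real" where
  "tnorm g = (\<lambda>(x, v). sqrt (g x v v))"

text \<open>The bilinear form on the fibre over \<open>x\<close> given by the second fibre derivative of \<open>L\<close> at
  \<open>(x, v)\<close>, where \<open>w\<close>, \<open>a\<close>, \<open>b\<close> are coordinates in the chart \<open>c\<close>
  and \<open>v\<close> is the vector with coordinates \<open>w\<close>.\<close>

definition fibre_hessian ::
  "('a, 'e::real_normed_vector) manifold \<Rightarrow> ('a \<times> ('a, 'e) tvector \<Rightarrow> real)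
     \<Rightarrow> ('a, 'e) chart \<Rightarrow> 'a \<Rightarrow> 'e \<Rightarrow> 'e \<Rightarrow> 'e \<Rightarrow> real" where
  "fibre_hessian M L c x w a b =
     frechet_derivative
       (\<lambda>z. frechet_derivative (\<lambda>y. L (x, tvec M c x y)) (at z) b) (at w) a"

definition tonelli ::
  "('a, 'e::real_normed_vector) manifold
     \<Rightarrow> ('a \<Rightarrow> ('a, 'e) tvector \<Rightarrow> ('a, 'e) tvector \<Rightarrow> real)
     \<Rightarrow> ('a \<times> ('a, 'e) tvector \<Rightarrow> real) \<Rightarrow> bool" where
  "tonelli M g L \<longleftrightarrow>
     Ck_fun 2 (tangent_bundle M) L \<and>
     (\<forall>c\<in>atlas M. \<forall>x\<in>fst c. \<forall>w a. a \<noteq> 0 \<longrightarrow> fibre_hessian M L c x w a a > 0) \<and>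
     (\<forall>K. \<exists>R>0. \<forall>p\<in>TM M. tnorm g p \<ge> R \<longrightarrow> L p / tnorm g p \<ge> K)"


section \<open>Closed one-forms\<close>

text \<open>One-forms are functions on the tangent bundle that are linear on the fibres.\<close>

definition form_coord ::
  "('a, 'e::real_normed_vector) manifold \<Rightarrow> ('a \<times> ('a, 'e) tvector \<Rightarrow> real)
     \<Rightarrow> ('a, 'e) chart \<Rightarrow> 'e \<Rightarrow> 'e \<Rightarrow> real" where
  "form_coord M \<eta> c y w = \<eta> (chart_inv c y, tvec M c (chart_inv c y) w)"

definition smooth_form ::
  "('a, 'e::real_normed_vector) manifold \<Rightarrow> ('a \<times> ('a, 'e) tvector \<Rightarrow> real) \<Rightarrow> bool" where
  "smooth_form M \<eta> \<longleftrightarrow>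
     (\<forall>c\<in>atlas M. (\<forall>y\<in>snd c ` fst c. linear (form_coord M \<eta> c y)) \<and>
        (\<forall>w. smooth_on (snd c ` fst c) (\<lambda>y. form_coord M \<eta> c y w)))"

definition closed_form ::
  "('a, 'e::real_normed_vector) manifold \<Rightarrow> ('a \<times> ('a, 'e) tvector \<Rightarrow> real) \<Rightarrow> bool" where
  "closed_form M \<eta> \<longleftrightarrow> smooth_form M \<eta> \<and>
     (\<forall>c\<in>atlas M. \<forall>y\<in>snd c ` fst c. \<forall>u w.
        frechet_derivative (\<lambda>z. form_coord M \<eta> c z w) (at y) u =
        frechet_derivative (\<lambda>z. form_coord M \<eta> c z u) (at y) w)"

definition local_primitive ::
  "('a, 'e::real_normed_vector) manifold \<Rightarrow> ('a \<times> ('a, 'e) tvector \<Rightarrow> real)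
     \<Rightarrow> 'a set \<Rightarrow> ('a \<Rightarrow> real) \<Rightarrow> bool" where
  "local_primitive M \<eta> U f \<longleftrightarrow> openin (mtop M) U \<and>
     (\<forall>x\<in>U. \<forall>c\<in>charts_at M x.
        ((f \<circ> chart_inv c) has_derivative form_coord M \<eta> c (snd c x)) (at (snd c x)))"

text \<open>Singular simplices are merely continuous, so a closed form \<open>\<eta>\<close> is integrated along a path
  \<open>\<gamma>\<close> by means of a primitive \<open>F\<close> of \<open>\<eta>\<close> along \<open>\<gamma>\<close>, unique up to a constant: near every time,
  \<open>F\<close> agrees up to a constant with \<open>f \<circ> \<gamma>\<close> for a primitive \<open>f\<close> of
  \<open>\<eta>\<close> near the corresponding point.  For smooth \<open>\<gamma>\<close> this is the usual line integral.\<close>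

definition primitive_along ::
  "('a, 'e::real_normed_vector) manifold \<Rightarrow> ('a \<times> ('a, 'e) tvector \<Rightarrow> real)
     \<Rightarrow> (real \<Rightarrow> 'a) \<Rightarrow> (real \<Rightarrow> real) \<Rightarrow> bool" where
  "primitive_along M \<eta> \<gamma> F \<longleftrightarrow>
     (\<forall>t\<in>{0..1}. \<exists>U f. local_primitive M \<eta> U f \<and>
        (\<exists>\<epsilon>>0. \<forall>s\<in>{0..1}. \<bar>s - t\<bar> < \<epsilon> \<longrightarrow> \<gamma> s \<in> U \<and> F s - F t = f (\<gamma> s) - f (\<gamma> t)))"

definition path_integral ::
  "('a, 'e::real_normed_vector) manifold \<Rightarrow> ('a \<times> ('a, 'e) tvector \<Rightarrow> real)
     \<Rightarrow> (real \<Rightarrow> 'a) \<Rightarrow> real" where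
  "path_integral M \<eta> \<gamma> = (THE I. \<exists>F. primitive_along M \<eta> \<gamma> F \<and> I = F 1 - F 0)"


section \<open>First homology with real coefficients\<close>

text \<open>Singular homology as in the homology library, with real instead of integer coefficients.\<close>

type_synonym 'a real_chain = "((nat \<Rightarrow> real) \<Rightarrow> 'a) \<Rightarrow>\<^sub>0 real"

definition real_singular_chains :: "nat \<Rightarrow> 'a topology \<Rightarrow> 'a real_chain set" where
  "real_singular_chains p X = {c. Poly_Mapping.keys c \<subseteq> singular_simplex_set p X}"

definition real_boundary :: "nat \<Rightarrow> 'a real_chain \<Rightarrow> 'a real_chain" where
  "real_boundary p c = (if p = 0 then 0 else
     (\<Sum>\<sigma>\<in>Poly_Mapping.keys c. \<Sum>k\<le>p.
        Poly_Mapping.single (singular_face p k \<sigma>) ((-1) ^ k * Poly_Mapping.lookup c \<sigma>)))"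

definition real_cycles :: "nat \<Rightarrow> 'a topology \<Rightarrow> 'a real_chain set" where
  "real_cycles p X = {c \<in> real_singular_chains p X. real_boundary p c = 0}"

definition real_homologous :: "nat \<Rightarrow> 'a topology \<Rightarrow> ('a real_chain \<times> 'a real_chain) set" where
  "real_homologous p X = {(c, d). c \<in> real_cycles p X \<and> d \<in> real_cycles p X \<and>
     c - d \<in> real_boundary (Suc p) ` real_singular_chains (Suc p) X}"

definition H1 :: "('a, 'e) manifold \<Rightarrow> 'a real_chain set set" where
  "H1 M = real_cycles 1 (mtop M) // real_homologous 1 (mtop M)"

definition H1_zero :: "('a, 'e) manifold \<Rightarrow> 'a real_chain set" where
  "H1_zero M = real_homologous 1 (mtop M) `` {0}"

definition simplex_path :: "((nat \<Rightarrow> real) \<Rightarrow> 'a) \<Rightarrow> real \<Rightarrow> 'a" where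
  "simplex_path \<sigma> t = \<sigma> (\<lambda>i. if i = 0 then 1 - t else if i = 1 then t else 0)"

definition chain_integral ::
  "('a, 'e::real_normed_vector) manifold \<Rightarrow> ('a \<times> ('a, 'e) tvector \<Rightarrow> real)
     \<Rightarrow> 'a real_chain \<Rightarrow> real" where
  "chain_integral M \<eta> c =
     (\<Sum>\<sigma>\<in>Poly_Mapping.keys c.
        Poly_Mapping.lookup c \<sigma> * path_integral M \<eta> (simplex_path \<sigma>))"

text \<open>The pairing of the de Rham class of the closed form \<open>\<eta>\<close> with the homology class \<open>h\<close>; it
  does not depend on the representatives.\<close>

definition pairing ::
  "('a, 'e::real_normed_vector) manifold \<Rightarrow> ('a \<times> ('a, 'e) tvector \<Rightarrow> real)
     \<Rightarrow> 'a real_chain set \<Rightarrow> real" where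
  "pairing M \<eta> h = chain_integral M \<eta> (SOME c. c \<in> h)"


section \<open>Closed measures, rotation vectors and Mather's beta-function\<close>

definition borel_probability :: "'b topology \<Rightarrow> 'b measure \<Rightarrow> bool" where
  "borel_probability X \<mu> \<longleftrightarrow>
     prob_space \<mu> \<and> space \<mu> = topspace X \<and> sets \<mu> = sigma_sets (topspace X) {W. openin X W}"

definition msupport :: "'b topology \<Rightarrow> 'b measure \<Rightarrow> 'b set" where
  "msupport X \<mu> = {z \<in> topspace X. \<forall>W. openin X W \<and> z \<in> W \<longrightarrow> emeasure \<mu> W > 0}"

definition closed_measures ::
  "('a, 'e::real_normed_vector) manifold
     \<Rightarrow> ('a \<Rightarrow> ('a, 'e) tvector \<Rightarrow> ('a, 'e) tvector \<Rightarrow> real)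
     \<Rightarrow> ('a \<times> ('a, 'e) tvector) measure set" where
  "closed_measures M g =
     {\<mu>. borel_probability (TM_topology M) \<mu> \<and> integrable \<mu> (tnorm g) \<and>
         (\<forall>f. Ck_fun 1 M f \<longrightarrow> (\<integral>p. mdiff M f p \<partial>\<mu>) = 0)}"

text \<open>The fibre of the rotation map over the homology class \<open>h\<close>.\<close>

definition rotation_fibre ::
  "('a, 'e::real_normed_vector) manifold
     \<Rightarrow> ('a \<Rightarrow> ('a, 'e) tvector \<Rightarrow> ('a, 'e) tvector \<Rightarrow> real)
     \<Rightarrow> 'a real_chain set \<Rightarrow> ('a \<times> ('a, 'e) tvector) measure set" where
  "rotation_fibre M g h =
     {\<mu> \<in> closed_measures M g. \<forall>\<eta>. closed_form M \<eta> \<longrightarrow> pairing M \<eta> h = (\<integral>p. \<eta> p \<partial>\<mu>)}"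

text \<open>A Tonelli Lagrangian is bounded below, so its action on a probability measure is a real number
  or \<open>+\<infinity>\<close>.  The Bochner integral would be \<open>0\<close> in the latter case; such measures
  do not contribute to the minimum and are therefore left out.\<close>

definition finite_action ::
  "('a, 'e::real_normed_vector) manifold
     \<Rightarrow> ('a \<Rightarrow> ('a, 'e) tvector \<Rightarrow> ('a, 'e) tvector \<Rightarrow> real)
     \<Rightarrow> ('a \<times> ('a, 'e) tvector \<Rightarrow> real) \<Rightarrow> 'a real_chain set
     \<Rightarrow> ('a \<times> ('a, 'e) tvector) measure set" where
  "finite_action M g L h = {\<mu> \<in> rotation_fibre M g h. integrable \<mu> L}"

definition mather_beta ::
  "('a, 'e::real_normed_vector) manifold
     \<Rightarrow> ('a \<Rightarrow> ('a, 'e) tvector \<Rightarrow> ('a, 'e) tvector \<Rightarrow> real)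
     \<Rightarrow> ('a \<times> ('a, 'e) tvector \<Rightarrow> real) \<Rightarrow> 'a real_chain set \<Rightarrow> real" where
  "mather_beta M g L h = (INF \<mu>\<in>finite_action M g L h. \<integral>p. L p \<partial>\<mu>)"

definition mather_measures ::
  "('a, 'e::real_normed_vector) manifold
     \<Rightarrow> ('a \<Rightarrow> ('a, 'e) tvector \<Rightarrow> ('a, 'e) tvector \<Rightarrow> real)
     \<Rightarrow> ('a \<times> ('a, 'e) tvector \<Rightarrow> real) \<Rightarrow> 'a real_chain set
     \<Rightarrow> ('a \<times> ('a, 'e) tvector) measure set" where
  "mather_measures M g L h = {\<mu> \<in> finite_action M g L h. (\<integral>p. L p \<partial>\<mu>) = mather_beta M g L h}"

definition mather_set ::
  "('a, 'e::real_normed_vector) manifold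
     \<Rightarrow> ('a \<Rightarrow> ('a, 'e) tvector \<Rightarrow> ('a, 'e) tvector \<Rightarrow> real)
     \<Rightarrow> ('a \<times> ('a, 'e) tvector \<Rightarrow> real) \<Rightarrow> 'a real_chain set \<Rightarrow> ('a \<times> ('a, 'e) tvector) set" where
  "mather_set M g L h =
     (TM_topology M) closure_of (\<Union>\<mu>\<in>mather_measures M g L h. msupport (TM_topology M) \<mu>)"

definition add_potential :: "('a \<times> 't \<Rightarrow> real) \<Rightarrow> ('a \<Rightarrow> real) \<Rightarrow> 'a \<times> 't \<Rightarrow> real" where
  "add_potential L V = (\<lambda>(x, v). L (x, v) + V x)"


section \<open>The torus\<close>

text \<open>The points of the torus are the cosets of the integer lattice, with the quotient topology; the
  charts are the local inverses of the projection.\<close>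

definition torus_proj :: "real^'n \<Rightarrow> (real^'n) set" where
  "torus_proj x = {y. \<forall>i. y $ i - x $ i \<in> \<int>}"

definition torus_topology :: "(real^'n) set topology" where
  "torus_topology = topology (\<lambda>W. W \<subseteq> range torus_proj \<and> open (torus_proj -` W))"

lemma openin_torus_topology:
  "openin torus_topology W \<longleftrightarrow> W \<subseteq> range torus_proj \<and> open (torus_proj -` W)"
proof -
  have "istopology (\<lambda>W. W \<subseteq> range torus_proj \<and> open (torus_proj -` W :: (real^'n) set))"
    unfolding istopology_def
    by (intro conjI allI impI) (auto simp: vimage_Union intro!: open_Int open_UN)
  then show ?thesis
    unfolding torus_topology_def by (subst topology_inverse') simp_all
qed

definition torus :: "((real^'n) set, real^'n) manifold" where
  "torus = \<lparr> mtop = torus_topology,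
             atlas = {(torus_proj ` B, inv_into B torus_proj) | B. open B \<and> inj_on torus_proj B} \<rparr>"

text \<open>The transition maps are locally translations, so the coordinates of a tangent vector are the
  same in all charts around its base point; this is the identification of the tangent bundle
  with the product of the torus and \<open>real^'n\<close>.\<close>

definition torus_velocity :: "(real^'n) set \<times> ((real^'n) set, real^'n) tvector \<Rightarrow> real^'n" where
  "torus_velocity = (\<lambda>(x, v). v (SOME c. c \<in> charts_at torus x))"

end

theory Submission
  imports Defs
begin

text \<open>
  Since \<open>V \<le> 0\<close>, every measure has smaller action for \<open>L + V\<close> than for \<open>L\<close>, and the two actions
  agree exactly when \<open>V\<close> vanishes on the support.  Together with the existence of a minimizer this
  gives the first two statements.  A minimizer is a weak limit of a minimizing sequence:
  superlinearity makes the sequence tight and the velocity uniformly integrable, so closedness and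
  the rotation vector survive in the limit.  Weak compactness on the tangent bundle is pulled back
  from Helly's theorem on the real line, because finitely many continuous functions separate the
  points of the tangent bundle and a space-filling curve encodes their values as one real number.

  On the torus a closed form is the differential of a periodic function plus a form with constant
  coefficients.  Hence the homology class \<open>h\<close> of a cycle acts on closed forms through one vector
  \<open>v\<close>, the total displacement of its lifted edges, and Lebesgue measure with constant velocity \<open>v\<close> has
  rotation vector \<open>h\<close>.  By convexity of \<open>\<ell>\<close> it is minimizing, and its support projects onto the
  whole torus.
\<close>

section \<open>A space-filling curve in the Hilbert cube\<close>

text \<open>The topology of the tangent bundle is given by charts, not by a distance, while Helly's
  theorem concerns the real line: hence the detour through a curve. The curve is not injective, so a
  point is encoded by its least parameter, which depends only measurably on the point; decoding, in
  contrast, is continuous on the parameters of each compact set, and this is the direction in which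
  the limit measure travels. Weak convergence tests bounded functions only, whereas the constraints
  may grow linearly in the velocity and the action faster. The Lagrangian is therefore shifted to be
  nonnegative and truncated from above, and the constraints are truncated with an error that the
  action controls. If a class carries no measure of finite action, both infima run over the empty
  set and coincide, so the general statements cover this case as well. On the torus the obstacle is
  that singular simplices are merely continuous: closed forms are integrated along them as
  increments of a primitive along a lift, and the cycle condition cancels the periodic part of the
  primitive.\<close>

definition schoenberg_bump :: "real \<Rightarrow> real" where
  "schoenberg_bump t = max 0 (min 1 (1/2 - cos (pi * t)))"

lemma schoenberg_bump_bounds: "0 \<le> schoenberg_bump t" "schoenberg_bump t \<le> 1"
  by (auto simp: schoenberg_bump_def)

lemma schoenberg_bump_periodic: "schoenberg_bump (2 * of_nat n + t) = schoenberg_bump t"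
proof -
  have "cos (pi * (2 * real n + t)) = cos (2 * real n * pi + pi * t)" by (simp add: algebra_simps)
  also have "\<dots> = cos (pi * t)" by (simp add: cos_add)
  finally show ?thesis by (simp add: schoenberg_bump_def)
qed

text \<open>The offset 1/2 comes from cos (pi/3) = 1/2 and cos (2 pi/3) = -1/2: after clipping, the
  bump is constant on each outer third of [0, 1], where the ternary expansions with digits 0 and 2
  lie.\<close>

lemma schoenberg_bump_low:
  assumes "0 \<le> t" "t \<le> 1/3" shows "schoenberg_bump t = 0"
proof -
  have "cos (pi/3) \<le> cos (pi * t)"
    using assms by (intro cos_monotone_0_pi_le) auto
  then show ?thesis by (simp add: schoenberg_bump_def cos_60)
qed

lemma schoenberg_bump_high:
  assumes "2/3 \<le> t" "t \<le> 1" shows "schoenberg_bump t = 1"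
proof -
  have "cos (pi * t) \<le> cos (2 * pi/3)"
    using assms by (intro cos_monotone_0_pi_le) auto
  then show ?thesis by (simp add: schoenberg_bump_def cos_120)
qed

lemma continuous_on_schoenberg_bump: "continuous_on A schoenberg_bump"
  unfolding schoenberg_bump_def by (intro continuous_intros)

text \<open>The bump reads off the digits of a ternary expansion with digits \<open>0\<close> and \<open>2\<close>;
  \<open>prod_encode\<close> distributes the digits over countably many coordinates.\<close>

definition schoenberg_curve :: "nat \<Rightarrow> real \<Rightarrow> real" where
  "schoenberg_curve i t = suminf (\<lambda>k. schoenberg_bump (3 ^ prod_encode (i, k) * t) / 2 ^ Suc k)"

lemma summable_half_pow: "summable (\<lambda>k. 1 / 2 ^ Suc k :: real)"
  using summable_mult[OF summable_geometric[of "1/2::real"], of "1/2"] by (simp add: power_one_over)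

lemma continuous_on_schoenberg_curve: "continuous_on UNIV (schoenberg_curve i)"
proof -
  have "uniform_limit UNIV (\<lambda>n t. \<Sum>k<n. schoenberg_bump (3 ^ prod_encode (i, k) * t) / 2 ^ Suc k)
          (schoenberg_curve i) sequentially"
    unfolding schoenberg_curve_def
    by (intro Weierstrass_m_test[where M="\<lambda>k. 1 / 2 ^ Suc k"] summable_half_pow)
       (auto simp: schoenberg_bump_bounds divide_right_mono)
  then show ?thesis
    by (rule uniform_limit_theorem[rotated])
       (auto intro!: always_eventually continuous_intros
          continuous_on_compose2[OF continuous_on_schoenberg_bump[of UNIV]])
qed

text \<open>A point of the Cantor set. Avoiding the digit 1 keeps every tail of the expansion in an
  outer third of [0, 1].\<close>

definition ternary :: "(nat \<Rightarrow> bool) \<Rightarrow> real" where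
  "ternary a = suminf (\<lambda>m. 2 * of_bool (a m) / 3 ^ Suc m)"

lemma ternary_summable: "summable (\<lambda>m. 2 * of_bool (a m) / 3 ^ Suc m :: real)"
proof (rule summable_comparison_test')
  show "summable (\<lambda>m. 2 * (1/3) ^ m :: real)" by (intro summable_mult summable_geometric) auto
  fix m :: nat
  show "norm (2 * of_bool (a m) / 3 ^ Suc m :: real) \<le> 2 * (1/3) ^ m"
    by (auto simp: power_one_over divide_simps)
qed

lemma ternary_bounds: "0 \<le> ternary a" "ternary a \<le> 1"
proof -
  show "0 \<le> ternary a" unfolding ternary_def by (intro suminf_nonneg ternary_summable) auto
  have s: "(\<lambda>m. 2/3 * (1/3) ^ m) sums (2/3 * (1 / (1 - 1/3)) :: real)"
    by (intro sums_mult geometric_sums) auto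
  have "ternary a \<le> suminf (\<lambda>m. 2/3 * (1/3) ^ m)"
    unfolding ternary_def using s
    by (intro suminf_le ternary_summable) (auto simp: sums_iff power_one_over)
  then show "ternary a \<le> 1" using s by (simp add: sums_iff)
qed

lemma ternary_shift: "3 * ternary a = 2 * of_bool (a 0) + ternary (\<lambda>m. a (Suc m))"
proof -
  have "ternary a = suminf (\<lambda>m. 2 * of_bool (a (Suc m)) / 3 ^ Suc (Suc m)) + 2 * of_bool (a 0) / 3"
    unfolding ternary_def using suminf_split_head[OF ternary_summable[of a]] by simp
  also have "suminf (\<lambda>m. 2 * of_bool (a (Suc m)) / 3 ^ Suc (Suc m)) = ternary (\<lambda>m. a (Suc m)) / 3"
    unfolding ternary_def using suminf_divide[OF ternary_summable[of "\<lambda>m. a (Suc m)"], of 3]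
    by (simp add: mult.commute)
  finally show ?thesis by (simp add: algebra_simps)
qed

text \<open>Multiplication by 3 moves the first digit in front of the point as 0 or 2, an even
  number that the period 2 of the bump removes; the remainder starts with the next digit. For
  \<open>m = 0\<close> the first digit decides in which outer third the number lies.\<close>

lemma schoenberg_bump_ternary: "schoenberg_bump (3 ^ m * ternary a) = of_bool (a m)"
proof (induction m arbitrary: a)
  case 0
  have t: "ternary a = (2 * of_bool (a 0) + ternary (\<lambda>m. a (Suc m))) / 3"
    using ternary_shift[of a] by simp
  show ?case
    using ternary_bounds[of "\<lambda>m. a (Suc m)"]
    by (cases "a 0") (auto simp: t intro!: schoenberg_bump_low schoenberg_bump_high)
next
  case (Suc m)
  have "3 ^ Suc m * ternary a = 3 ^ m * (3 * ternary a)" by simp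
  also have "\<dots> = 2 * of_nat (3 ^ m * of_bool (a 0)) + 3 ^ m * ternary (\<lambda>m. a (Suc m))"
    by (simp add: ternary_shift distrib_left)
  finally show ?case by (simp only: schoenberg_bump_periodic Suc.IH)
qed

text \<open>The bits are the parities of floor (2^(k+1) y). The partial sums are the truncations
  floor (2^n y) / 2^n, which differ from \<open>y\<close> by at most 2^-n; \<open>y < 1\<close>
  makes the integer part vanish.\<close>

lemma binary_expansion:
  fixes y :: real assumes "0 \<le> y" "y < 1"
  obtains b :: "nat \<Rightarrow> bool" where "(\<lambda>k. of_bool (b k) / 2 ^ Suc k) sums y"
proof
  define b where "b k = odd \<lfloor>2 ^ Suc k * y\<rfloor>" for k
  have step: "\<lfloor>2 ^ Suc k * y\<rfloor> = 2 * \<lfloor>2 ^ k * y\<rfloor> + of_bool (b k)" for k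
  proof -
    have "\<lfloor>2 ^ Suc k * y\<rfloor> div 2 = \<lfloor>2 ^ k * y\<rfloor>"
      using floor_divide_real_eq_div[of 2 "2 ^ Suc k * y"] by simp
    then show ?thesis unfolding b_def
      by (metis of_bool_odd_eq_mod_2 mult_div_mod_eq)
  qed
  have part: "(\<Sum>k<n. of_bool (b k) / 2 ^ Suc k) = of_int \<lfloor>2 ^ n * y\<rfloor> / (2 ^ n :: real)" for n
  proof (induction n)
    case 0 then show ?case using assms by (simp add: floor_eq_iff)
  next
    case (Suc n)
    have "(of_int \<lfloor>2 ^ Suc n * y\<rfloor> :: real) = 2 * of_int \<lfloor>2 ^ n * y\<rfloor> + of_bool (b n)"
      unfolding step by simp
    then show ?case using Suc by (simp add: field_simps del: power_Suc) (simp add: field_simps)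
  qed
  have "(\<lambda>n. of_int \<lfloor>2 ^ n * y\<rfloor> / 2 ^ n) \<longlonglongrightarrow> y"
  proof (rule tendsto_sandwich)
    show "(\<lambda>n. y - (1/2) ^ n) \<longlonglongrightarrow> y"
      using tendsto_diff[OF tendsto_const LIMSEQ_power_zero[of "1/2::real"], of y] by simp
    show "\<forall>\<^sub>F n in sequentially. y - (1/2) ^ n \<le> of_int \<lfloor>2 ^ n * y\<rfloor> / 2 ^ n"
    proof (intro always_eventually allI)
      fix n
      have "2 ^ n * y - 1 \<le> of_int \<lfloor>2 ^ n * y\<rfloor>" by linarith
      then have "(2 ^ n * y - 1) / 2 ^ n \<le> of_int \<lfloor>2 ^ n * y\<rfloor> / 2 ^ n"
        by (intro divide_right_mono) auto
      then show "y - (1/2) ^ n \<le> of_int \<lfloor>2 ^ n * y\<rfloor> / 2 ^ n"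
        by (simp add: power_one_over diff_divide_distrib)
    qed
    show "\<forall>\<^sub>F n in sequentially. of_int \<lfloor>2 ^ n * y\<rfloor> / 2 ^ n \<le> y"
      by (rule always_eventually) (auto simp: field_simps)
  qed auto
  then show "(\<lambda>k. of_bool (b k) / 2 ^ Suc k) sums y" unfolding sums_def part .
qed

lemma schoenberg_curve_surj:
  assumes "\<And>i. 0 \<le> y i" "\<And>i. y i < 1"
  obtains t where "t \<in> {0..1}" "\<And>i. schoenberg_curve i t = y i"
proof -
  have "\<exists>b::nat \<Rightarrow> bool. (\<lambda>k. of_bool (b k) / 2 ^ Suc k) sums y i" for i
    using binary_expansion assms by metis
  then obtain b :: "nat \<Rightarrow> nat \<Rightarrow> bool"
    where b: "\<And>i. (\<lambda>k. of_bool (b i k) / 2 ^ Suc k) sums y i" by metis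
  \<comment> \<open>The binary digits of all coordinates are interleaved into one sequence, so that
    a single parameter realises every coordinate at once.\<close>
  define a where "a m = case_prod b (prod_decode m)" for m
  have "schoenberg_curve i (ternary a) = y i" for i
    using b[of i] by (simp add: schoenberg_curve_def schoenberg_bump_ternary a_def sums_iff)
  then show ?thesis using that ternary_bounds[of a] by auto
qed

section \<open>Weak compactness of tight families\<close>

lemma real_distribution_distr:
  assumes "prob_space M" "f \<in> borel_measurable M"
  shows "real_distribution (distr M borel f)"
proof -
  interpret prob_space M by fact
  show ?thesis using assms(2) by simp
qed

lemma borel_probability_eq:
  "borel_probability X \<mu> \<longleftrightarrow>
     prob_space \<mu> \<and> space \<mu> = topspace X \<and> sets \<mu> = sets (sigma (topspace X) {W. openin X W})"
proof -
  have "{W. openin X W} \<subseteq> Pow (topspace X)" by (auto dest: openin_subset)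
  then show ?thesis by (simp add: borel_probability_def sets_measure_of)
qed

lemma borel_probability_sets_openin:
  assumes "borel_probability X \<mu>" "openin X W" shows "W \<in> sets \<mu>"
  using assms by (auto simp: borel_probability_def)

lemma borel_probability_sets_closedin:
  assumes "borel_probability X \<mu>" "closedin X W" shows "W \<in> sets \<mu>"
proof -
  have "space \<mu> - (topspace X - W) \<in> sets \<mu>"
    using assms by (intro sets.compl_sets borel_probability_sets_openin) auto
  moreover have "space \<mu> - (topspace X - W) = W"
    using assms closedin_subset[OF assms(2)] by (auto simp: borel_probability_def)
  ultimately show ?thesis by simp
qed

lemma borel_probability_measurable:
  assumes "borel_probability X \<mu>" "continuous_map X euclidean f"
  shows "f \<in> borel_measurable \<mu>"
proof (rule borel_measurableI)
  fix S :: "'b set" assume "open S"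
  then have "openin X {x \<in> topspace X. f x \<in> S}"
    using assms(2) by (auto simp: continuous_map_def)
  moreover have "f -` S \<inter> space \<mu> = {x \<in> topspace X. f x \<in> S}"
    using assms(1) by (auto simp: borel_probability_def)
  ultimately show "f -` S \<inter> space \<mu> \<in> sets \<mu>"
    using borel_probability_sets_openin[OF assms(1)] by simp
qed

text \<open>Up to the restriction to \<open>{a..b}\<close>, this is the projection to the line of a
  closed set of coincidences in \<open>K\<close> times the line, and projecting along a compact
  factor is a closed map.\<close>

lemma compact_fibre_parameters:
  fixes p :: "nat \<Rightarrow> real \<Rightarrow> real"
  assumes p: "\<And>i. continuous_on UNIV (p i)"
    and \<phi>: "\<And>i. continuous_map X euclideanreal (\<phi> i)" and K: "compactin X K"
  shows "closed {t \<in> {a..b}. \<exists>x\<in>K. \<forall>i. p i t = \<phi> i x}"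
proof -
  let ?Y = "subtopology X K"
  let ?P = "prod_topology ?Y euclideanreal"
  have cl: "closedin ?P {z \<in> topspace ?P. p i (snd z) = \<phi> i (fst z)}" for i
  proof (rule closedin_continuous_maps_eq[of euclideanreal])
    show "continuous_map ?P euclideanreal (\<lambda>z. p i (snd z))"
      using continuous_map_compose[OF continuous_map_snd,
        of euclideanreal euclideanreal "p i" ?Y] p[of i]
      by (simp add: o_def)
    show "continuous_map ?P euclideanreal (\<lambda>z. \<phi> i (fst z))"
      using continuous_map_compose[OF continuous_map_fst, of ?Y euclideanreal "\<phi> i" euclideanreal]
        continuous_map_from_subtopology[OF \<phi>[of i], of K]
      by (simp add: o_def)
  qed simp
  have "closedin ?P (\<Inter>i. {z \<in> topspace ?P. p i (snd z) = \<phi> i (fst z)})"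
    using cl by (intro closedin_Inter) auto
  moreover have "closed_map ?P euclideanreal snd"
    by (rule Abstract_Topological_Spaces.closed_map_snd) (use K compact_space_subtopology in blast)
  ultimately have "closed (snd ` (\<Inter>i. {z \<in> topspace ?P. p i (snd z) = \<phi> i (fst z)}))"
    by (auto simp: closed_map_def)
  moreover have "{t \<in> {a..b}. \<exists>x\<in>K. \<forall>i. p i t = \<phi> i x} =
      {a..b} \<inter> snd ` (\<Inter>i. {z \<in> topspace ?P. p i (snd z) = \<phi> i (fst z)})"
    using compactin_subset_topspace[OF K] by (auto simp: image_iff Bex_def) blast
  ultimately show ?thesis by auto
qed

text \<open>The same projection argument with the roles exchanged: now the parameter interval is the
  compact factor. This is what makes the choice of the least parameter measurable.\<close>

lemma parameter_image_closed:
  fixes p :: "nat \<Rightarrow> real \<Rightarrow> real"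
  assumes p: "\<And>i. continuous_on UNIV (p i)"
    and \<phi>: "\<And>i. continuous_map X euclideanreal (\<phi> i)" 
  shows "closedin X {x \<in> topspace X. \<exists>t\<in>{a..b}. \<forall>i. p i t = \<phi> i x}"
proof -
  let ?Y = "top_of_set {a..b}"
  let ?P = "prod_topology ?Y X"
  have cl: "closedin ?P {z \<in> topspace ?P. p i (fst z) = \<phi> i (snd z)}" for i
  proof (rule closedin_continuous_maps_eq[of euclideanreal])
    show "continuous_map ?P euclideanreal (\<lambda>z. p i (fst z))"
      using continuous_map_compose[OF continuous_map_fst, of ?Y euclideanreal "p i" X]
        continuous_on_subset[OF p[of i]]
      by (simp add: o_def)
    show "continuous_map ?P euclideanreal (\<lambda>z. \<phi> i (snd z))"
      using continuous_map_compose[OF continuous_map_snd, of X euclideanreal "\<phi> i" ?Y] \<phi>[of i]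
      by (simp add: o_def)
  qed simp
  have "closedin ?P (\<Inter>i. {z \<in> topspace ?P. p i (fst z) = \<phi> i (snd z)})"
    using cl by (intro closedin_Inter) auto
  moreover have "closed_map ?P X snd"
    by (rule Abstract_Topological_Spaces.closed_map_snd) (simp add: compact_space_subtopology)
  ultimately have "closedin X (snd ` (\<Inter>i. {z \<in> topspace ?P. p i (fst z) = \<phi> i (snd z)}))"
    by (auto simp: closed_map_def)
  moreover have "{x \<in> topspace X. \<exists>t\<in>{a..b}. \<forall>i. p i t = \<phi> i x} =
      snd ` (\<Inter>i. {z \<in> topspace ?P. p i (fst z) = \<phi> i (snd z)})"
    by (auto simp: image_iff Bex_def)
  ultimately show ?thesis by simp
qed

text \<open>The Schoenberg curve transports the measures to the unit interval, where Helly's theorem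
  applies; on the preimages of the compact sets the transport can be undone continuously.\<close>

theorem tight_imp_weakly_convergent_subseq:
  fixes X :: "'a topology" and \<mu> :: "nat \<Rightarrow> 'a measure"
  assumes \<phi>: "\<And>i::nat. continuous_map X euclideanreal (\<phi> i)"
    and range: "\<And>i x. 0 \<le> \<phi> i x \<and> \<phi> i x < 1"
    and sep: "\<And>x y. x \<in> topspace X \<Longrightarrow> y \<in> topspace X \<Longrightarrow> (\<And>i. \<phi> i x = \<phi> i y) \<Longrightarrow> x = y"
    and K: "\<And>m::nat. compactin X (K m)" "\<And>m. closedin X (K m)"
    and \<mu>: "\<And>n. borel_probability X (\<mu> n)"
    and tight: "\<And>m n. measure (\<mu> n) (topspace X - K m) \<le> e m" "e \<longlonglongrightarrow> 0"
  obtains r \<mu>' where "strict_mono (r :: nat \<Rightarrow> nat)" "borel_probability X \<mu>'"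
    "\<And>f B. continuous_map X euclideanreal f \<Longrightarrow> (\<And>x. x \<in> topspace X \<Longrightarrow> \<bar>f x\<bar> \<le> B) \<Longrightarrow>
       (\<lambda>n. \<integral>x. f x \<partial>\<mu> (r n)) \<longlonglongrightarrow> (\<integral>x. f x \<partial>\<mu>')"
proof -
  let ?p = schoenberg_curve
  note cont_p = continuous_on_schoenberg_curve
  interpret \<mu>: prob_space "\<mu> n" for n using \<mu> by (simp add: borel_probability_def)
  have space_\<mu>: "space (\<mu> n) = topspace X" for n using \<mu> by (simp add: borel_probability_def)
  define T where "T x = {t \<in> {0..1}. \<forall>i. ?p i t = \<phi> i x}" for x
  \<comment> \<open>A point can have several parameters. The least one is attained because the set
    of parameters is closed, and \<open>enc x \<le> a\<close> says that \<open>x\<close> has a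
    parameter in a compact interval, which is a closed condition on \<open>x\<close>.\<close>
  define enc where "enc x = Inf (T x)" for x
  have T_ne: "T x \<noteq> {}" for x
  proof -
    obtain t where "t \<in> {0..1}" "\<And>i. ?p i t = \<phi> i x"
      using schoenberg_curve_surj[of "\<lambda>i. \<phi> i x"] range by metis
    then show ?thesis by (auto simp: T_def)
  qed
  have T_closed: "closed (T x)" if "x \<in> topspace X" for x
    using compact_fibre_parameters[OF cont_p \<phi>, of "{x}" 0 1] that by (simp add: T_def)
  have enc: "enc x \<in> T x" if "x \<in> topspace X" for x
    unfolding enc_def using T_ne T_closed[OF that]
    by (intro closed_contains_Inf bdd_belowI[of _ 0]) (auto simp: T_def)
  have enc_le: "enc x \<le> t" if "t \<in> T x" for x t
    unfolding enc_def using that by (intro cInf_lower bdd_belowI[of _ 0]) (auto simp: T_def)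
  have enc_meas: "enc \<in> borel_measurable (\<mu> n)" for n
  proof (rule borel_measurable_iff_le[THEN iffD2], rule allI)
    fix a
    have "enc x \<le> a \<longleftrightarrow> (\<exists>t\<in>{0..min 1 a}. \<forall>i. ?p i t = \<phi> i x)" if "x \<in> topspace X" for x
    proof
      assume "enc x \<le> a"
      then show "\<exists>t\<in>{0..min 1 a}. \<forall>i. ?p i t = \<phi> i x"
        using enc[OF that] by (intro bexI[of _ "enc x"]) (auto simp: T_def)
    next
      assume "\<exists>t\<in>{0..min 1 a}. \<forall>i. ?p i t = \<phi> i x"
      then obtain t where "t \<in> T x" "t \<le> a" by (auto simp: T_def)
      then show "enc x \<le> a" using enc_le[of t x] by simp
    qed
    then have "{x \<in> space (\<mu> n). enc x \<le> a} =
        {x \<in> topspace X. \<exists>t\<in>{0..min 1 a}. \<forall>i. ?p i t = \<phi> i x}"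
      by (auto simp: space_\<mu>)
    then show "{x \<in> space (\<mu> n). enc x \<le> a} \<in> sets (\<mu> n)"
      using borel_probability_sets_closedin[OF \<mu> parameter_image_closed[OF cont_p \<phi>]] by simp
  qed
  define \<nu> where "\<nu> n = distr (\<mu> n) borel enc" for n
  have real_\<nu>: "real_distribution (\<nu> n)" for n
    unfolding \<nu>_def by (intro real_distribution_distr \<mu>.prob_space_axioms enc_meas)
  \<comment> \<open>The encoded measures all live on [0, 1], so tightness on the line costs nothing.
    The given tightness enters later, when the limit is located on the encoded compact sets.\<close>
  have "tight \<nu>"
    unfolding tight_def
  proof (intro conjI allI impI real_\<nu>)
    fix \<epsilon> :: real assume "\<epsilon> > 0"
    have "measure (\<nu> n) {-1<..1} = 1" for n
    proof -
      have "enc -` {-1<..1} \<inter> space (\<mu> n) = space (\<mu> n)"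
        using enc by (force simp: space_\<mu> T_def)
      then show ?thesis using \<mu>.prob_space by (simp add: \<nu>_def measure_distr[OF enc_meas])
    qed
    then show "\<exists>a b. a < b \<and> (\<forall>n. 1 - \<epsilon> < measure (\<nu> n) {a<..b})"
      using \<open>\<epsilon> > 0\<close> by (intro exI[of _ "-1"] exI[of _ 1]) auto
  qed
  then obtain r N where r: "strict_mono (r :: nat \<Rightarrow> nat)" and N: "real_distribution N"
      and weak: "weak_conv_m (\<nu> \<circ> r) N"
    using tight_imp_convergent_subsubsequence[of \<nu> id] by (auto simp: strict_mono_id)
  interpret N: real_distribution N by fact
  have N_meas: "h \<in> borel_measurable N" if "h \<in> borel_measurable borel" for h :: "real \<Rightarrow> real"
    using that measurable_cong_sets[OF N.events_eq_borel refl] by blast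
  have conv: "(\<lambda>n. \<integral>t. F t \<partial>\<nu> (r n)) \<longlonglongrightarrow> (\<integral>t. F t \<partial>N)"
    if "continuous_on UNIV F" "\<And>t. \<bar>F t\<bar> \<le> B" for F :: "real \<Rightarrow> real" and B
    using weak_conv_imp_integral_bdd_continuous_conv[OF _ N weak, of F B] that real_\<nu>
    by (simp add: continuous_on_eq_continuous_at)
  have int_\<nu>: "(\<integral>t. F t \<partial>\<nu> n) = (\<integral>x. F (enc x) \<partial>\<mu> n)" if "continuous_on UNIV F"
    for F :: "real \<Rightarrow> real" and n
    unfolding \<nu>_def using that by (intro integral_distr enc_meas) (simp add:
      borel_measurable_continuous_onI)

  \<comment> \<open>Mass of the limit on the encoded compact sets\<close>
  define C where "C m = {t \<in> {0..1}. \<exists>x\<in>K m. \<forall>i. ?p i t = \<phi> i x}" for m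
  have C_closed: "closed (C m)" for m
    unfolding C_def by (rule compact_fibre_parameters[OF cont_p \<phi> K(1)])
  then have C_sets: "C m \<in> sets borel" for m by simp
  have enc_C: "enc x \<in> C m" if "x \<in> K m" for x m
    using enc[of x] that closedin_subset[OF K(2)] by (auto simp: C_def T_def)
  have N_C: "measure N (C m) \<ge> 1 - e m" for m
  \<comment> \<open>The distance to the empty set is 0 by convention, so the functions below would
    not approximate its indicator. If \<open>C m\<close> is empty, so is \<open>K m\<close>, and
    then \<open>e m \<ge> 1\<close>.\<close>
  proof (cases "C m = {}")
    case True
    then have "K m = {}" using enc_C by auto
    then show ?thesis using tight(1)[of 0 m] \<mu>.prob_space[of 0] by (simp add: True space_\<mu>)
  next
    case False
    \<comment> \<open>Continuous functions decreasing to the indicator of the closed set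
      \<open>C m\<close>: each has integral at least \<open>1 - e m\<close> under every encoded
      measure, hence under the weak limit, and dominated convergence passes this to
      \<open>C m\<close>.\<close>
    define F where "F j t = max 0 (1 - of_nat j * infdist t (C m))" for j :: nat and t
    have F_cont: "continuous_on UNIV (F j)" for j
      unfolding F_def by (intro continuous_intros)
    have F_bd: "\<bar>F j t\<bar> \<le> 1" for j t by (auto simp: F_def infdist_nonneg)
    have "1 - e m \<le> (\<integral>t. F j t \<partial>\<nu> n)" for j n
    proof -
      have "1 - e m \<le> measure (\<mu> n) (K m)"
        using tight(1)[of n m] \<mu>.prob_compl[OF borel_probability_sets_closedin[OF \<mu> K(2)], of n m]
        by (simp add: space_\<mu>)
      also have "\<dots> = (\<integral>x. indicator (K m) x \<partial>\<mu> n)"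
        using borel_probability_sets_closedin[OF \<mu>[of n] K(2)[of m]]
        by (simp add: sets.sets_into_space Int_absorb2)
      also have "\<dots> \<le> (\<integral>x. F j (enc x) \<partial>\<mu> n)"
      proof (rule integral_mono)
        show "integrable (\<mu> n) (indicat_real (K m))"
          using borel_probability_sets_closedin[OF \<mu>[of n] K(2)[of m]]
          by (simp add: \<mu>.emeasure_finite less_top[symmetric])
        show "integrable (\<mu> n) (\<lambda>x. F j (enc x))"
          using F_bd by (intro \<mu>.integrable_const_bound[where B=1])
            (auto intro!: measurable_compose[OF enc_meas] borel_measurable_continuous_onI F_cont)
        show "indicator (K m) x \<le> F j (enc x)" for x
          using enc_C by (auto simp: indicator_def F_def)
      qed
      finally show ?thesis using int_\<nu>[OF F_cont] by simp
    qed
    then have ge: "1 - e m \<le> (\<integral>t. F j t \<partial>N)" for j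
      using LIMSEQ_le_const[OF conv[OF F_cont F_bd]] by blast
    have "(\<lambda>j. \<integral>t. F j t \<partial>N) \<longlonglongrightarrow> (\<integral>t. indicator (C m) t \<partial>N)"
    proof (rule integral_dominated_convergence[where w="\<lambda>_. 1"])
      show "AE t in N. (\<lambda>j. F j t) \<longlonglongrightarrow> indicator (C m) t"
      proof (rule AE_I2)
        fix t
        show "(\<lambda>j. F j t) \<longlonglongrightarrow> indicator (C m) t"
        proof (cases "t \<in> C m")
          case True then show ?thesis by (simp add: F_def)
        next
          case outside: False
          then have pos: "infdist t (C m) > 0"
            using in_closed_iff_infdist_zero[OF C_closed False, of t] infdist_nonneg[of t "C m"]
              by simp
          obtain J :: nat where J: "1 < of_nat J * infdist t (C m)"
            using reals_Archimedean3[OF pos] by blast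
          have "F j t = 0" if "j \<ge> J" for j
          proof -
            have "of_nat J * infdist t (C m) \<le> of_nat j * infdist t (C m)"
              using that pos by (intro mult_right_mono) auto
            then show ?thesis using J by (auto simp: F_def)
          qed
          then show ?thesis using outside
            by (intro tendsto_eventually) (auto simp: eventually_sequentially)
        qed
      qed
    qed (use F_bd C_sets in \<open>auto intro: N_meas borel_measurable_continuous_onI[OF F_cont]\<close>)
    then have "(\<lambda>j. \<integral>t. F j t \<partial>N) \<longlonglongrightarrow> measure N (C m)" by simp
    then show ?thesis using LIMSEQ_le_const ge by blast
  qed

  \<comment> \<open>Decoding the limit measure\<close>
  define D where "D = (\<Union>m. C m)"
  obtain x0 where x0: "x0 \<in> topspace X" using \<mu>.not_empty[of 0] unfolding space_\<mu> by blast
  \<comment> \<open>The value off \<open>D\<close> is immaterial: \<open>D\<close> has full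
    \<open>N\<close>-measure because \<open>e m\<close> tends to 0.\<close>
  define dec where "dec t = (if t \<in> D then SOME x. x \<in> topspace X \<and> (\<forall>i. ?p i t = \<phi> i x) else x0)"
    for t
  have dec_eq: "dec t = x" if "t \<in> D" "x \<in> topspace X" "\<And>i. ?p i t = \<phi> i x" for t x
  proof -
    have ex: "\<exists>x. x \<in> topspace X \<and> (\<forall>i. ?p i t = \<phi> i x)" using that by blast
    have d: "dec t = (SOME x. x \<in> topspace X \<and> (\<forall>i. ?p i t = \<phi> i x))"
      using that(1) by (simp only: dec_def if_True)
    have *: "dec t \<in> topspace X \<and> (\<forall>i. ?p i t = \<phi> i (dec t))"
      unfolding d by (rule someI_ex[OF ex])
    show ?thesis
    proof (rule sep)
      show "dec t \<in> topspace X" using * by blast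
      show "\<phi> i (dec t) = \<phi> i x" for i
        using *[THEN conjunct2, rule_format, of i] that(3)[of i] by linarith
    qed (rule that(2))
  qed
  have dec_in: "dec t \<in> topspace X" for t
  proof (cases "t \<in> D")
    case True
    then obtain m x where "x \<in> K m" "\<And>i. ?p i t = \<phi> i x" by (auto simp: D_def C_def)
    then show ?thesis using dec_eq[OF True, of x] closedin_subset[OF K(2)] by auto
  qed (simp add: dec_def x0)
  \<comment> \<open>This is continuity of \<open>dec\<close> on \<open>C m\<close>: since the
    functions \<open>\<phi> i\<close> separate points, the decoded point must be the one in
    \<open>K m\<close>, so the preimage of \<open>S\<close> consists of the parameters of the
    compact set \<open>K m \<inter> S\<close>.\<close>
  have dec_pre: "closed {t \<in> C m. dec t \<in> S}" if "closedin X S" for S m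
  proof -
    have "{t \<in> C m. dec t \<in> S} = {t \<in> {0..1}. \<exists>x\<in>K m \<inter> S. \<forall>i. ?p i t = \<phi> i x}"
    proof (intro equalityI subsetI)
      fix t assume "t \<in> {t \<in> C m. dec t \<in> S}"
      then have t: "t \<in> C m" "dec t \<in> S" by auto
      then obtain x where x: "x \<in> K m" "\<And>i. ?p i t = \<phi> i x" by (auto simp: C_def)
      then have "dec t = x" using t closedin_subset[OF K(2)] by (intro dec_eq) (auto simp: D_def)
      then show "t \<in> {t \<in> {0..1}. \<exists>x\<in>K m \<inter> S. \<forall>i. ?p i t = \<phi> i x}"
        using x t by (auto simp: C_def)
    next
      fix t assume "t \<in> {t \<in> {0..1}. \<exists>x\<in>K m \<inter> S. \<forall>i. ?p i t = \<phi> i x}"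
      then obtain x where t: "t \<in> {0..1}" "x \<in> K m" "x \<in> S" "\<forall>i. ?p i t = \<phi> i x" by auto
      then have "t \<in> C m" by (auto simp: C_def)
      moreover have "dec t = x" using t closedin_subset[OF K(2)] \<open>t \<in> C m\<close>
        by (intro dec_eq) (auto simp: D_def)
      ultimately show "t \<in> {t \<in> C m. dec t \<in> S}" using t by simp
    qed
    then show ?thesis
      using compact_fibre_parameters[OF cont_p \<phi>, of "K m \<inter> S"] closed_Int_compactin[OF that K(1)]
      by (simp add: Int_commute)
  qed
  have D_sets: "D \<in> sets borel" unfolding D_def using C_sets by auto
  let ?BX = "sigma (topspace X) {W. openin X W}"
  have sp: "{W. openin X W} \<subseteq> Pow (topspace X)" by (auto dest: openin_subset)
  have dec_meas: "dec \<in> measurable N ?BX"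
  proof (rule measurable_sigma_sets[OF _ sp])
    show "sets ?BX = sigma_sets (topspace X) {W. openin X W}" using sp by simp
    show "dec \<in> space N \<rightarrow> topspace X" using dec_in by simp
    fix W assume "W \<in> {W. openin X W}"
    then have cl: "closedin X (topspace X - W)" by auto
    have dec_out: "dec t = x0" if "t \<notin> D" for t using that by (simp add: dec_def)
    have "dec -` W \<inter> space N = (\<Union>m. C m - {t \<in> C m. dec t \<in> topspace X - W}) \<union>
        (if x0 \<in> W then - D else {})"
    proof (rule Set.set_eqI)
      fix t
      show "t \<in> dec -` W \<inter> space N \<longleftrightarrow> t \<in> (\<Union>m. C m - {t \<in> C m. dec t \<in> topspace X - W}) \<union>
        (if x0 \<in> W then - D else {})"
        by (cases "t \<in> D") (use dec_in[of t] dec_out in \<open>auto simp: D_def\<close>)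
    qed
    also have "\<dots> \<in> sets N"
      using C_sets dec_pre[OF cl] D_sets by auto
    finally show "dec -` W \<inter> space N \<in> sets N" .
  qed
  define \<mu>' where "\<mu>' = distr N ?BX dec"
  have \<mu>': "borel_probability X \<mu>'"
    unfolding borel_probability_eq \<mu>'_def
    using N.prob_space_distr[OF dec_meas] sp by (simp add: space_measure_of)

  \<comment> \<open>Convergence of the integrals of bounded continuous functions\<close>
  have weak_lim: "(\<lambda>n. \<integral>x. f x \<partial>\<mu> (r n)) \<longlonglongrightarrow> (\<integral>x. f x \<partial>\<mu>')"
    if f: "continuous_map X euclideanreal f" and B: "\<And>x. x \<in> topspace X \<Longrightarrow> \<bar>f x\<bar> \<le> B" for f B
  proof -
    have B0: "0 \<le> B" using B[OF x0] by linarith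
    have f_meas: "f \<in> borel_measurable ?BX"
      using borel_probability_measurable[OF \<mu>' f] by (simp add: \<mu>'_def)
    have fd_meas: "(\<lambda>t. f (dec t)) \<in> borel_measurable N"
      by (rule measurable_compose[OF dec_meas f_meas])
    have int': "(\<integral>x. f x \<partial>\<mu>') = (\<integral>t. f (dec t) \<partial>N)"
      unfolding \<mu>'_def by (rule integral_distr[OF dec_meas f_meas])
    \<comment> \<open>On \<open>C m\<close> the decoded function is continuous, and Tietze extends
      it to the line with the same bound \<open>B\<close>. On \<open>K m\<close> decoding undoes
      encoding, so replacing \<open>f\<close> by the extension errs by at most \<open>2 * B\<close>,
      and only off \<open>K m\<close> or off \<open>C m\<close>, where the mass is at most
      \<open>e m\<close>.\<close>
    have approx: "\<exists>G. continuous_on UNIV G \<and> (\<forall>t. \<bar>G t\<bar> \<le> B) \<and>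
        (\<forall>n. \<bar>(\<integral>x. f x \<partial>\<mu> n) - (\<integral>t. G t \<partial>\<nu> n)\<bar> \<le> 2 * B * e m) \<and>
        \<bar>(\<integral>x. f x \<partial>\<mu>') - (\<integral>t. G t \<partial>N)\<bar> \<le> 2 * B * e m" for m
    proof -
      have "continuous_on (C m) (\<lambda>t. f (dec t))"
        unfolding continuous_on_closed_vimage[OF C_closed]
      proof (intro allI impI)
        fix S :: "real set" assume "closed S"
        then have "closedin X {x \<in> topspace X. f x \<in> S}"
          using f by (simp add: continuous_map_closedin)
        from dec_pre[OF this, of m] show "closed ((\<lambda>t. f (dec t)) -` S \<inter> C m)"
          using dec_in by (simp add: vimage_def Int_def conj_commute)
      qed
      then obtain G where G: "continuous_on UNIV G" "\<And>t. t \<in> C m \<Longrightarrow> G t = f (dec t)"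
          "\<And>t. \<bar>G t\<bar> \<le> B"
        using Tietze[of "C m" "\<lambda>t. f (dec t)" UNIV B] C_closed B0 B dec_in by auto
      have G_meas: "G \<in> borel_measurable borel" using G(1) by (rule borel_measurable_continuous_onI)
      have 1: "\<bar>(\<integral>x. f x \<partial>\<mu> n) - (\<integral>t. G t \<partial>\<nu> n)\<bar> \<le> 2 * B * e m" for n
      proof -
        have i1: "integrable (\<mu> n) f"
          using B by (intro \<mu>.integrable_const_bound[where B=B])
            (auto simp: space_\<mu> intro: borel_probability_measurable[OF \<mu> f])
        have i2: "integrable (\<mu> n) (\<lambda>x. G (enc x))"
          using G(3) by (intro \<mu>.integrable_const_bound[where B=B])
            (auto intro: measurable_compose[OF enc_meas G_meas])
        have KC: "topspace X - K m \<in> sets (\<mu> n)"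
          using borel_probability_sets_openin[OF \<mu>] K(2) by blast
        have "\<bar>(\<integral>x. f x \<partial>\<mu> n) - (\<integral>t. G t \<partial>\<nu> n)\<bar> = \<bar>\<integral>x. f x - G (enc x) \<partial>\<mu> n\<bar>"
          using i1 i2 int_\<nu>[OF G(1)] by simp
        also have "\<dots> \<le> (\<integral>x. \<bar>f x - G (enc x)\<bar> \<partial>\<mu> n)" by (rule integral_abs_bound)
        also have "\<dots> \<le> (\<integral>x. 2 * B * indicator (topspace X - K m) x \<partial>\<mu> n)"
        proof (rule integral_mono)
          show "integrable (\<mu> n) (\<lambda>x. 2 * B * indicat_real (topspace X - K m) x)"
            using KC by (intro integrable_mult_right) (simp add: \<mu>.emeasure_finite
              less_top[symmetric])
          fix x assume x: "x \<in> space (\<mu> n)"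
          show "\<bar>f x - G (enc x)\<bar> \<le> 2 * B * indicat_real (topspace X - K m) x"
          proof (cases "x \<in> K m")
            case True
            then have "enc x \<in> C m" by (rule enc_C)
            moreover have "dec (enc x) = x"
              using x enc[of x] \<open>enc x \<in> C m\<close> by (intro dec_eq) (auto simp: D_def space_\<mu> T_def)
            ultimately show ?thesis using True G(2) by simp
          next
            case False
            then show ?thesis using x B[of x] G(3)[of "enc x"] by (auto simp: space_\<mu>)
          qed
        qed (use i1 i2 in simp)
        also have "\<dots> = 2 * B * measure (\<mu> n) (topspace X - K m)"
          using KC by (simp add: space_\<mu> Int_absorb2 Diff_subset)
        also have "\<dots> \<le> 2 * B * e m" using tight(1) B0 by (intro mult_left_mono) auto
        finally show ?thesis .
      qed
      have 2: "\<bar>(\<integral>x. f x \<partial>\<mu>') - (\<integral>t. G t \<partial>N)\<bar> \<le> 2 * B * e m"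
      proof -
        have i1: "integrable N (\<lambda>t. f (dec t))"
          using B dec_in by (intro N.integrable_const_bound[where B=B] fd_meas) auto
        have i2: "integrable N G"
          using G(3) G_meas by (intro N.integrable_const_bound[where B=B]) auto
        have CC: "- C m \<in> sets N" using C_sets by auto
        have "\<bar>(\<integral>x. f x \<partial>\<mu>') - (\<integral>t. G t \<partial>N)\<bar> = \<bar>\<integral>t. f (dec t) - G t \<partial>N\<bar>"
          using i1 i2 int' by simp
        also have "\<dots> \<le> (\<integral>t. \<bar>f (dec t) - G t\<bar> \<partial>N)" by (rule integral_abs_bound)
        also have "\<dots> \<le> (\<integral>t. 2 * B * indicator (- C m) t \<partial>N)"
        proof (rule integral_mono)
          show "integrable N (\<lambda>x. 2 * B * indicat_real (- C m) x)"
            using CC by (intro integrable_mult_right) (simp add: N.emeasure_finite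
              less_top[symmetric])
          fix t
          show "\<bar>f (dec t) - G t\<bar> \<le> 2 * B * indicat_real (- C m) t"
            using B[OF dec_in, of t] G(2)[of t] G(3)[of t] by (cases "t \<in> C m") auto
        qed (use i1 i2 in simp)
        also have "\<dots> = 2 * B * measure N (- C m)" using CC by simp
        also have "measure N (- C m) = 1 - measure N (C m)"
          using N.prob_compl[of "C m"] C_sets by (simp add: Compl_eq_Diff_UNIV)
        also have "2 * B * (1 - measure N (C m)) \<le> 2 * B * e m"
          using N_C[of m] B0 by (intro mult_left_mono) auto
        finally show ?thesis .
      qed
      show ?thesis using G 1 2 by blast
    qed
    show ?thesis
    proof (rule LIMSEQ_I)
      fix \<epsilon> :: real assume "\<epsilon> > 0"
      have "(\<lambda>m. 2 * B * e m) \<longlonglongrightarrow> 2 * B * 0" by (intro tendsto_intros tight(2))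
      then have "\<forall>\<^sub>F m in sequentially. 2 * B * e m < \<epsilon> / 3"
        using \<open>\<epsilon> > 0\<close> by (intro order_tendstoD(2)[where y=0]) auto
      then obtain m where m: "2 * B * e m < \<epsilon> / 3" using eventually_happens' by force
      from approx[of m] obtain G where G: "continuous_on UNIV G" "\<And>t. \<bar>G t\<bar> \<le> B"
        "\<And>n. \<bar>(\<integral>x. f x \<partial>\<mu> n) - (\<integral>t. G t \<partial>\<nu> n)\<bar> \<le> 2 * B * e m"
        "\<bar>(\<integral>x. f x \<partial>\<mu>') - (\<integral>t. G t \<partial>N)\<bar> \<le> 2 * B * e m" by blast
      from LIMSEQ_D[OF conv[OF G(1,2)], of "\<epsilon>/3"] \<open>\<epsilon> > 0\<close>
      obtain n0 where n0: "\<And>n. n \<ge> n0 \<Longrightarrow> \<bar>(\<integral>t. G t \<partial>\<nu> (r n)) - (\<integral>t. G t \<partial>N)\<bar> < \<epsilon> / 3" by auto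
      show "\<exists>n0. \<forall>n\<ge>n0. norm ((\<integral>x. f x \<partial>\<mu> (r n)) - (\<integral>x. f x \<partial>\<mu>')) < \<epsilon>"
      proof (intro exI[of _ n0] allI impI)
        fix n assume "n \<ge> n0"
        from n0[OF this] G(3)[of "r n"] G(4) m
        show "norm ((\<integral>x. f x \<partial>\<mu> (r n)) - (\<integral>x. f x \<partial>\<mu>')) < \<epsilon>" by (simp add: abs_if split: if_splits)
      qed
    qed
  qed
  show ?thesis by (rule that[OF r \<mu>']) (rule weak_lim; assumption)
qed

section \<open>Minimizers of superlinear actions\<close>

text \<open>Superlinearity bounds the first moment on the complement of a sublevel set of \<open>\<theta>\<close> by a
  small multiple of the action, which gives tightness of minimizing sequences and lets the linear
  constraints pass to the limit.\<close>

theorem action_minimizer_exists: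
  fixes X :: "'a topology" and \<theta> L :: "'a \<Rightarrow> real" and f :: "'i \<Rightarrow> 'a \<Rightarrow> real"
  assumes \<phi>: "\<And>i::nat. continuous_map X euclideanreal (\<phi> i)"
    and range: "\<And>i x. 0 \<le> \<phi> i x \<and> \<phi> i x < 1"
    and sep: "\<And>x y. x \<in> topspace X \<Longrightarrow> y \<in> topspace X \<Longrightarrow> (\<And>i. \<phi> i x = \<phi> i y) \<Longrightarrow> x = y"
    and \<theta>: "continuous_map X euclideanreal \<theta>" "\<And>x. x \<in> topspace X \<Longrightarrow> 0 \<le> \<theta> x"
    and sublevel: "\<And>R. compactin X {x \<in> topspace X. \<theta> x \<le> R}"
    and L: "continuous_map X euclideanreal L"
    and superlinear: "\<And>K. \<exists>R. \<forall>x\<in>topspace X. R \<le> \<theta> x \<longrightarrow> K * \<theta> x \<le> L x"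
    and f: "\<And>i. i \<in> I \<Longrightarrow> continuous_map X euclideanreal (f i)"
    and f_bound: "\<And>i. i \<in> I \<Longrightarrow> \<exists>C\<ge>0. \<forall>x\<in>topspace X. \<bar>f i x\<bar> \<le> C * \<theta> x"
    and S_def: "S = {\<mu>. borel_probability X \<mu> \<and> integrable \<mu> \<theta> \<and>
        (\<forall>i\<in>I. (\<integral>x. f i x \<partial>\<mu>) = a i) \<and> integrable \<mu> L}"
    and S_ne: "S \<noteq> {}"
  obtains \<mu> where "\<mu> \<in> S" "\<And>\<nu>. \<nu> \<in> S \<Longrightarrow> (\<integral>x. L x \<partial>\<mu>) \<le> (\<integral>x. L x \<partial>\<nu>)"
proof -
  have space: "space \<mu> = topspace X" if "borel_probability X \<mu>" for \<mu>
    using that by (simp add: borel_probability_def)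
  have prob: "prob_space \<mu>" if "borel_probability X \<mu>" for \<mu>
    using that by (simp add: borel_probability_def)
  obtain R0 where R0: "\<And>x. x \<in> topspace X \<Longrightarrow> R0 \<le> \<theta> x \<Longrightarrow> 0 \<le> L x"
    using superlinear[of 0] by auto
  have "compact (L ` {x \<in> topspace X. \<theta> x \<le> R0})"
    using image_compactin[OF sublevel L, of R0] by simp
  from compact_imp_bounded[OF this]
  obtain b0 where "\<forall>y\<in>L ` {x \<in> topspace X. \<theta> x \<le> R0}. norm y \<le> b0"
    unfolding bounded_iff by blast
  then have b0: "\<bar>L x\<bar> \<le> b0" if "x \<in> topspace X" "\<theta> x \<le> R0" for x using that by auto
  \<comment> \<open>Above the level \<open>R0\<close> the Lagrangian is nonnegative by
    superlinearity with slope 0; below it compactness bounds it by \<open>b0\<close>. Shifting by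
    \<open>b\<close> therefore makes it nonnegative, and \<open>b \<ge> 0\<close> preserves the
    superlinear lower bounds.\<close>
  define b where "b = max 0 b0"
  define Lp where "Lp x = L x + b" for x
  have Lp_nonneg: "0 \<le> Lp x" if "x \<in> topspace X" for x
    using R0[OF that] b0[OF that] by (cases "\<theta> x \<le> R0") (auto simp: Lp_def b_def)
  have Lp_cont: "continuous_map X euclideanreal Lp"
    unfolding Lp_def by (intro continuous_intros L) simp
  have L_le_Lp: "L x \<le> Lp x" for x by (simp add: Lp_def b_def)
  \<comment> \<open>With the threshold at least 1, a positive slope \<open>K\<close> is itself a
    lower bound of \<open>Lp\<close> beyond it; this is what the Markov inequality for tightness
    needs.\<close>
  have "\<exists>R\<ge>1. \<forall>x\<in>topspace X. R \<le> \<theta> x \<longrightarrow> K * \<theta> x \<le> Lp x" for K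
  proof -
    obtain R where "\<forall>x\<in>topspace X. R \<le> \<theta> x \<longrightarrow> K * \<theta> x \<le> L x" using superlinear by blast
    then show ?thesis using L_le_Lp by (intro exI[of _ "max 1 R"]) (auto intro: order_trans)
  qed
  then obtain R where R1: "\<And>K. R K \<ge> 1"
    and R: "\<And>K x. x \<in> topspace X \<Longrightarrow> R K \<le> \<theta> x \<Longrightarrow> K * \<theta> x \<le> Lp x" by metis
  have int_Lp: "integrable \<mu> Lp" "(\<integral>x. Lp x \<partial>\<mu>) = (\<integral>x. L x \<partial>\<mu>) + b"
    if "borel_probability X \<mu>" "integrable \<mu> L" for \<mu>
  proof -
    interpret prob_space \<mu> using that prob by blast
    show "integrable \<mu> Lp" "(\<integral>x. Lp x \<partial>\<mu>) = (\<integral>x. L x \<partial>\<mu>) + b"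
      unfolding Lp_def using that(2) by (simp_all add: prob_space)
  qed
  define A where "A = (INF \<mu>\<in>S. \<integral>x. L x \<partial>\<mu>)"
  have bdd: "bdd_below ((\<lambda>\<mu>. \<integral>x. L x \<partial>\<mu>) ` S)"
  proof (rule bdd_belowI2[of _ "-b"])
    fix \<mu> assume "\<mu> \<in> S"
    then have \<mu>: "borel_probability X \<mu>" "integrable \<mu> L" by (auto simp: S_def)
    have "0 \<le> (\<integral>x. Lp x \<partial>\<mu>)"
      using Lp_nonneg by (intro Bochner_Integration.integral_nonneg) (simp add: space[OF \<mu>(1)])
    then show "- b \<le> (\<integral>x. L x \<partial>\<mu>)" using int_Lp(2)[OF \<mu>] by simp
  qed
  have A_le: "A \<le> (\<integral>x. L x \<partial>\<nu>)" if "\<nu> \<in> S" for \<nu>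
    unfolding A_def using bdd that by (rule cINF_lower)
  have "\<exists>\<mu>\<in>S. (\<integral>x. L x \<partial>\<mu>) < A + 1 / real (Suc n)" for n
    using cINF_less_iff[OF S_ne bdd, of "A + 1 / real (Suc n)"] by (simp add: A_def[symmetric])
  then obtain \<mu> where \<mu>_S: "\<And>n. \<mu> n \<in> S"
    and \<mu>_less: "\<And>n. (\<integral>x. L x \<partial>\<mu> n) < A + 1 / real (Suc n)" by metis
  have \<mu>: "borel_probability X (\<mu> n)" "integrable (\<mu> n) L" "integrable (\<mu> n) \<theta>"
      "\<And>i. i \<in> I \<Longrightarrow> (\<integral>x. f i x \<partial>\<mu> n) = a i" for n
    using \<mu>_S[of n] by (auto simp: S_def)
  \<comment> \<open>The elements of the minimizing sequence exceed the infimum by at most 1, so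
    \<open>B\<close> bounds their shifted action uniformly.\<close>
  define B where "B = A + 1 + b"
  have B: "(\<integral>x. Lp x \<partial>\<mu> n) \<le> B" for n
  proof -
    have "1 / real (Suc n) \<le> 1" by simp
    then show ?thesis using \<mu>_less[of n] unfolding int_Lp(2)[OF \<mu>(1,2)] B_def by linarith
  qed
  have "0 \<le> (\<integral>x. Lp x \<partial>\<mu> 0)"
    using Lp_nonneg by (intro Bochner_Integration.integral_nonneg) (simp add: space[OF \<mu>(1)])
  with B[of 0] have B0: "0 \<le> B" by linarith

  \<comment> \<open>Tightness of the minimizing sequence\<close>
  define K where "K m = {x \<in> topspace X. \<theta> x \<le> R (real (Suc m))}" for m
  have K_closed: "closedin X (K m)" for m
    using closedin_continuous_map_preimage[OF \<theta>(1), of "{..R (real (Suc m))}"]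
    by (simp add: K_def)
  \<comment> \<open>Markov's inequality: outside \<open>K m\<close> the shifted Lagrangian is at
    least m + 1.\<close>
  have tight: "measure (\<mu> n) (topspace X - K m) \<le> B / real (Suc m)" for m n
  proof -
    interpret prob_space "\<mu> n" using prob \<mu> by blast
    have set: "topspace X - K m \<in> sets (\<mu> n)"
      using borel_probability_sets_openin[OF \<mu>(1)] K_closed by blast
    have "measure (\<mu> n) (topspace X - K m) = (\<integral>x. indicator (topspace X - K m) x \<partial>\<mu> n)"
      using set by (simp add: space[OF \<mu>(1)] Int_absorb2)
    also have "\<dots> \<le> (\<integral>x. Lp x / real (Suc m) \<partial>\<mu> n)"
    proof (rule integral_mono)
      show "integrable (\<mu> n) (indicat_real (topspace X - K m))"
        using set by (simp add: emeasure_finite less_top[symmetric])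
      show "integrable (\<mu> n) (\<lambda>x. Lp x / real (Suc m))" using int_Lp(1)[OF \<mu>(1,2)] by simp
      fix x assume "x \<in> space (\<mu> n)"
      then have x: "x \<in> topspace X" by (simp add: space[OF \<mu>(1)])
      show "indicator (topspace X - K m) x \<le> Lp x / real (Suc m)"
      proof (cases "x \<in> K m")
        case True then show ?thesis using Lp_nonneg[OF x] by simp
      next
        case False
        then have le: "R (real (Suc m)) \<le> \<theta> x" using x by (simp add: K_def)
        have "real (Suc m) * 1 \<le> real (Suc m) * \<theta> x"
          using le R1[of "real (Suc m)"] by (intro mult_left_mono) auto
        also have "\<dots> \<le> Lp x" by (rule R[OF x le])
        finally have "1 \<le> Lp x / real (Suc m)" by (simp add: field_simps)
        then show ?thesis using False x by simp
      qed
    qed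
    also have "\<dots> = (\<integral>x. Lp x \<partial>\<mu> n) / real (Suc m)" by simp
    also have "\<dots> \<le> B / real (Suc m)" using B by (intro divide_right_mono) auto
    finally show ?thesis .
  qed
  have lim0: "(\<lambda>m. B / real (Suc m)) \<longlonglongrightarrow> 0"
    using LIMSEQ_Suc[OF lim_const_over_n[of B]] by simp
  have K_compact: "compactin X (K m)" for m unfolding K_def by (rule sublevel)
  obtain r \<mu>' where r: "strict_mono (r :: nat \<Rightarrow> nat)" and \<mu>': "borel_probability X \<mu>'"
    and conv: "\<And>h B. continuous_map X euclideanreal h \<Longrightarrow> (\<And>x. x \<in> topspace X \<Longrightarrow> \<bar>h x\<bar> \<le> B) \<Longrightarrow>
       (\<lambda>n. \<integral>x. h x \<partial>\<mu> (r n)) \<longlonglongrightarrow> (\<integral>x. h x \<partial>\<mu>')"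
  proof (rule tight_imp_weakly_convergent_subseq[where \<mu>=\<mu>,
    OF \<phi> range _ K_compact K_closed \<mu>(1) tight lim0])
    fix x y assume "x \<in> topspace X" "y \<in> topspace X" "\<And>i. \<phi> i x = \<phi> i y"
    then show "x = y" by (rule sep)
  next
    fix r \<mu>'
    assume r: "strict_mono (r :: nat \<Rightarrow> nat)" "borel_probability X \<mu>'"
      and lim: "\<And>f B. continuous_map X euclideanreal f \<Longrightarrow> (\<And>x. x \<in> topspace X \<Longrightarrow> \<bar>f x\<bar> \<le> B) \<Longrightarrow>
       (\<lambda>n. \<integral>x. f x \<partial>\<mu> (r n)) \<longlonglongrightarrow> (\<integral>x. f x \<partial>\<mu>')"
    show thesis by (rule that[OF r]) (rule lim; assumption)
  qed
  interpret \<mu>': prob_space \<mu>' using prob \<mu>' by blast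
  note meas = borel_probability_measurable
  have trunc_int: "integrable \<nu> h"
    if "borel_probability X \<nu>" "continuous_map X euclideanreal h" "\<And>x. x \<in> topspace X \<Longrightarrow> \<bar>h x\<bar> \<le> c"
      for \<nu> h c
  proof -
    interpret prob_space \<nu> using prob that by blast
    show ?thesis using that by (intro integrable_const_bound[where B=c] meas[of X])
      (auto simp: space)
  qed
  \<comment> \<open>Lower semicontinuity of the action: the truncations are bounded and continuous,
    so their limit integrals exist and are at most \<open>A + b\<close>; monotone convergence in the
    truncation height then gives both integrability of \<open>Lp\<close> and the bound.\<close>
  have Lmin: "continuous_map X euclideanreal (\<lambda>x. min (Lp x) (real c))"
    "\<And>x. x \<in> topspace X \<Longrightarrow> \<bar>min (Lp x) (real c)\<bar> \<le> real c" for c :: nat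
    using Lp_nonneg by (auto intro!: continuous_map_real_min Lp_cont)
  have Lmin_le: "(\<integral>x. min (Lp x) (real c) \<partial>\<mu>') \<le> A + b" for c :: nat
  proof -
    have le: "(\<integral>x. min (Lp x) (real c) \<partial>\<mu> (r n)) \<le> A + b + 1 / real (Suc (r n))" for n
    proof -
      have "(\<integral>x. min (Lp x) (real c) \<partial>\<mu> (r n)) \<le> (\<integral>x. Lp x \<partial>\<mu> (r n))"
        using trunc_int[OF \<mu>(1) Lmin] int_Lp(1)[OF \<mu>(1,2)] by (intro integral_mono) auto
      then show ?thesis using \<mu>_less[of "r n"] unfolding int_Lp(2)[OF \<mu>(1,2)] by linarith
    qed
    have "(\<lambda>n. 1 / real (Suc (r n))) \<longlonglongrightarrow> 0"
      using LIMSEQ_subseq_LIMSEQ[OF LIMSEQ_Suc[OF lim_const_over_n[of "1::real"]] r]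
        by (simp add: o_def)
    then have "(\<lambda>n. A + b + 1 / real (Suc (r n))) \<longlonglongrightarrow> A + b + 0" by (intro tendsto_intros)
    then show ?thesis using LIMSEQ_le[OF conv[OF Lmin]] le by fastforce
  qed
  have inc: "incseq (\<lambda>c. \<integral>x. min (Lp x) (real c) \<partial>\<mu>')"
    by (intro incseq_SucI integral_mono[OF trunc_int[OF \<mu>' Lmin] trunc_int[OF \<mu>' Lmin]]) auto
  obtain l where l: "(\<lambda>c. \<integral>x. min (Lp x) (real c) \<partial>\<mu>') \<longlonglongrightarrow> l" "l \<le> A + b"
    using incseq_convergent[OF inc] Lmin_le LIMSEQ_le_const2 by metis
  have mono: "AE x in \<mu>'. mono (\<lambda>c. min (Lp x) (real c))"
    by (intro AE_I2 monoI min.mono) auto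
  have ptw: "AE x in \<mu>'. (\<lambda>c. min (Lp x) (real c)) \<longlonglongrightarrow> Lp x"
  proof (intro AE_I2 tendsto_eventually)
    fix x
    obtain c0 :: nat where "Lp x \<le> real c0" using real_arch_simple by blast
    then show "\<forall>\<^sub>F c in sequentially. min (Lp x) (real c) = Lp x"
      unfolding eventually_sequentially by (intro exI[of _ c0]) (auto simp: min_def)
  qed
  have Lp_int: "integrable \<mu>' Lp"
    by (rule integrable_monotone_convergence[OF trunc_int[OF \<mu>' Lmin] mono ptw l(1) meas[OF \<mu>'
      Lp_cont]])
  have "(\<integral>x. Lp x \<partial>\<mu>') = l"
    by (rule integral_monotone_convergence[OF trunc_int[OF \<mu>' Lmin] mono ptw l(1) meas[OF \<mu>'
      Lp_cont]])
  then have Lp_le: "(\<integral>x. Lp x \<partial>\<mu>') \<le> A + b" using l(2) by simp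
  have L_int: "integrable \<mu>' L"
  proof -
    have "integrable \<mu>' (\<lambda>x. Lp x - b)" using Lp_int by simp
    then show ?thesis by (simp add: Lp_def)
  qed
  have \<theta>_int: "integrable \<mu>' \<theta>"
  proof (rule Bochner_Integration.integrable_bound)
    show "integrable \<mu>' (\<lambda>x. R 1 + Lp x)" using Lp_int by simp
    show "AE x in \<mu>'. norm (\<theta> x) \<le> norm (R 1 + Lp x)"
    proof (rule AE_I2)
      fix x assume "x \<in> space \<mu>'"
      then have x: "x \<in> topspace X" by (simp add: space[OF \<mu>'])
      show "norm (\<theta> x) \<le> norm (R 1 + Lp x)"
        using \<theta>(2)[OF x] R[OF x, of 1] R1[of 1] Lp_nonneg[OF x] by (cases "R 1 \<le> \<theta> x") auto
    qed
  qed (rule meas[OF \<mu>' \<theta>(1)])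
  have constraint: "(\<integral>x. f i x \<partial>\<mu>') = a i" if i: "i \<in> I" for i
  proof -
    obtain C where C: "C \<ge> 0" "\<And>x. x \<in> topspace X \<Longrightarrow> \<bar>f i x\<bar> \<le> C * \<theta> x" using f_bound[OF i] by blast
    have f_int: "integrable \<nu> (f i)" if "borel_probability X \<nu>" "integrable \<nu> \<theta>" for \<nu>
    proof (rule Bochner_Integration.integrable_bound)
      show "integrable \<nu> (\<lambda>x. C * \<theta> x)" using that by simp
      show "AE x in \<nu>. norm (f i x) \<le> norm (C * \<theta> x)"
        using C(2) by (intro AE_I2) (force simp: space[OF that(1)])
    qed (rule meas[OF that(1) f[OF i]])
    \<comment> \<open>Truncation at height \<open>C * R N\<close> with N = n + 1 changes
      \<open>f i\<close> only where \<open>\<theta>\<close> exceeds \<open>R N\<close>, and there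
      \<open>C * \<theta>\<close> is at most \<open>C / N * Lp\<close>. The error is thus at most
      \<open>C * B / N\<close> for every measure of shifted action at most \<open>B\<close>; it is
      paid once along the sequence and once at the limit.\<close>
    have "\<bar>a i - (\<integral>x. f i x \<partial>\<mu>')\<bar> \<le> 2 * C * B / real (Suc n)" for n
    proof -
      let ?N = "real (Suc n)"
      define T where "T = C * R ?N"
      have T0: "0 \<le> T" using C(1) R1[of ?N] by (simp add: T_def)
      define h where "h x = max (- T) (min T (f i x))" for x
      have h: "continuous_map X euclideanreal h" "\<And>x. x \<in> topspace X \<Longrightarrow> \<bar>h x\<bar> \<le> T"
        unfolding h_def using T0 by (auto intro!: continuous_map_real_min continuous_map_real_max
          f[OF i])
      have diff: "\<bar>f i x - h x\<bar> \<le> C / ?N * Lp x" if x: "x \<in> topspace X" for x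
      proof (cases "\<bar>f i x\<bar> \<le> T")
        case True
        then show ?thesis using C(1) Lp_nonneg[OF x] by (simp add: h_def)
      next
        case False
        then have "C * R ?N < C * \<theta> x" using C(2)[OF x] by (simp add: T_def)
        then have "R ?N \<le> \<theta> x" using C(1) by (meson linorder_not_le mult_left_mono
          order_less_imp_le)
        from R[OF x this] have "C * (?N * \<theta> x) \<le> C * Lp x" using C(1) by (rule mult_left_mono)
        then have "C * \<theta> x \<le> C / ?N * Lp x" by (simp add: field_simps)
        moreover have "\<bar>f i x - h x\<bar> \<le> \<bar>f i x\<bar>" using T0 by (auto simp: h_def)
        ultimately show ?thesis using C(2)[OF x] by linarith
      qed
      have diff_int: "\<bar>(\<integral>x. f i x \<partial>\<nu>) - (\<integral>x. h x \<partial>\<nu>)\<bar> \<le> C * B / ?N"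
        if \<nu>: "borel_probability X \<nu>" "integrable \<nu> \<theta>" "integrable \<nu> Lp" "(\<integral>x. Lp x \<partial>\<nu>) \<le> B" for \<nu>
      proof -
        note fi = f_int[OF \<nu>(1,2)] and hi = trunc_int[OF \<nu>(1) h]
        have "\<bar>(\<integral>x. f i x \<partial>\<nu>) - (\<integral>x. h x \<partial>\<nu>)\<bar> = \<bar>\<integral>x. f i x - h x \<partial>\<nu>\<bar>" using fi hi by simp
        also have "\<dots> \<le> (\<integral>x. \<bar>f i x - h x\<bar> \<partial>\<nu>)" by (rule integral_abs_bound)
        also have "\<dots> \<le> (\<integral>x. C / ?N * Lp x \<partial>\<nu>)"
          using diff fi hi \<nu>(3) by (intro integral_mono) (auto simp: space[OF \<nu>(1)])
        also have "\<dots> = C / ?N * (\<integral>x. Lp x \<partial>\<nu>)" by simp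
        also have "\<dots> \<le> C / ?N * B" using \<nu>(4) C(1) by (intro mult_left_mono) auto
        finally show ?thesis by simp
      qed
      have "\<bar>a i - (\<integral>x. h x \<partial>\<mu> (r k))\<bar> \<le> C * B / ?N" for k
        using diff_int[OF \<mu>(1) \<mu>(3) int_Lp(1)[OF \<mu>(1,2)] B, of "r k"] \<mu>(4)[OF i] by simp
      moreover have "(\<lambda>k. \<bar>a i - (\<integral>x. h x \<partial>\<mu> (r k))\<bar>) \<longlonglongrightarrow> \<bar>a i - (\<integral>x. h x \<partial>\<mu>')\<bar>"
        by (intro tendsto_intros conv[OF h])
      ultimately have "\<bar>a i - (\<integral>x. h x \<partial>\<mu>')\<bar> \<le> C * B / ?N" by (intro LIMSEQ_le_const2) auto
      moreover have "(\<integral>x. Lp x \<partial>\<mu>') \<le> B" using Lp_le by (simp add: B_def)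
      then have "\<bar>(\<integral>x. f i x \<partial>\<mu>') - (\<integral>x. h x \<partial>\<mu>')\<bar> \<le> C * B / ?N"
        by (rule diff_int[OF \<mu>' \<theta>_int Lp_int])
      moreover have "2 * C * B / ?N = C * B / ?N + C * B / ?N"
        by (simp add: add_divide_distrib[symmetric])
      ultimately show ?thesis by linarith
    qed
    moreover have "(\<lambda>n. 2 * C * B / real (Suc n)) \<longlonglongrightarrow> 0"
      using LIMSEQ_Suc[OF lim_const_over_n[of "2 * C * B"]] by simp
    ultimately have "\<bar>a i - (\<integral>x. f i x \<partial>\<mu>')\<bar> \<le> 0" by (intro LIMSEQ_le_const) auto
    then show ?thesis by simp
  qed
  have "\<mu>' \<in> S" using \<mu>' \<theta>_int constraint L_int by (simp add: S_def)
  moreover have "(\<integral>x. L x \<partial>\<mu>') \<le> A" using Lp_le int_Lp(2)[OF \<mu>' L_int] by simp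
  ultimately show ?thesis using that A_le by (meson order_trans)
qed

section \<open>The tangent bundle\<close>

lemma Ck_on_imp_continuous_on: "Ck_on k S f \<Longrightarrow> continuous_on S f"
  by (cases k) (auto intro!: continuous_at_imp_continuous_on differentiable_imp_continuous_within)

lemma smooth_on_imp_continuous_on: "smooth_on S f \<Longrightarrow> continuous_on S f"
  by (auto simp: smooth_on_def intro: Ck_on_imp_continuous_on[of 0])

text \<open>Expanding the vector in the finite standard basis turns separate continuity into joint
  continuity.\<close>

lemma continuous_on_linear_family:
  fixes A :: "'b::topological_space \<Rightarrow> 'e::euclidean_space \<Rightarrow> 'f::real_normed_vector"
  assumes "\<And>y. y \<in> S \<Longrightarrow> linear (A y)" "\<And>w. continuous_on S (\<lambda>y. A y w)"
  shows "continuous_on (S \<times> UNIV) (\<lambda>z. A (fst z) (snd z))"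
proof -
  have eq: "A (fst z) (snd z) = (\<Sum>b\<in>Basis. (snd z \<bullet> b) *\<^sub>R A (fst z) b)" if "z \<in> S \<times> UNIV" for z
  proof -
    interpret linear "A (fst z)" using assms(1) that by auto
    have "A (fst z) (snd z) = A (fst z) (\<Sum>b\<in>Basis. (snd z \<bullet> b) *\<^sub>R b)"
      by (simp add: euclidean_representation)
    then show ?thesis by (simp add: sum scale)
  qed
  have "continuous_on (S \<times> UNIV) (\<lambda>z. \<Sum>b\<in>Basis. (snd z \<bullet> b) *\<^sub>R A (fst z) b)"
    by (intro continuous_intros continuous_on_compose2[OF assms(2)]) auto
  then show ?thesis by (rule continuous_on_eq) (simp add: eq)
qed

lemma continuous_on_quadratic_family:
  fixes A :: "'b::topological_space \<Rightarrow> 'e::euclidean_space \<Rightarrow> 'e \<Rightarrow> real"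
  assumes "\<And>y. y \<in> S \<Longrightarrow> bilinear (A y)" "\<And>u w. continuous_on S (\<lambda>y. A y u w)"
  shows "continuous_on (S \<times> UNIV) (\<lambda>z. A (fst z) (snd z) (snd z))"
proof -
  have eq: "A (fst z) (snd z) (snd z) = (\<Sum>b\<in>Basis. (snd z \<bullet> b) *\<^sub>R A (fst z) (snd z) b)"
    if "z \<in> S \<times> UNIV" for z
  proof -
    interpret linear "A (fst z) (snd z)" using assms(1)[of "fst z"] that
      by (auto simp: bilinear_def)
    have "A (fst z) (snd z) (snd z) = A (fst z) (snd z) (\<Sum>b\<in>Basis. (snd z \<bullet> b) *\<^sub>R b)"
      by (simp add: euclidean_representation)
    then show ?thesis by (simp only: sum scale)
  qed
  have "continuous_on (S \<times> UNIV) (\<lambda>z. \<Sum>b\<in>Basis. (snd z \<bullet> b) *\<^sub>R A (fst z) (snd z) b)"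
    using assms by (intro continuous_intros continuous_on_linear_family[of S "\<lambda>y u. A y u _"])
      (auto simp: bilinear_def)
  then show ?thesis by (rule continuous_on_eq) (simp add: eq)
qed

text \<open>The inverse of the bundle chart \<open>tchart M c\<close>, written out so that functions
  on the bundle can be studied in coordinates.\<close>

definition tparam ::
  "('a, 'e::real_normed_vector) manifold \<Rightarrow> ('a, 'e) chart \<Rightarrow> 'e \<times> 'e \<Rightarrow> 'a \<times> ('a, 'e) tvector" where
  "tparam M c z = (chart_inv c (fst z), tvec M c (chart_inv c (fst z)) (snd z))"

text \<open>The common ground of the two families of constraints: closed forms are smooth, but the
  differential of a C^1 function is only continuous. Continuity already suffices for a linear bound
  in the fibre norm.\<close>

definition continuous_form ::
  "('a, 'e::real_normed_vector) manifold \<Rightarrow> ('a \<times> ('a, 'e) tvector \<Rightarrow> real) \<Rightarrow> bool" where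
  "continuous_form M \<eta> \<longleftrightarrow>
     (\<forall>c\<in>atlas M. (\<forall>y\<in>snd c ` fst c. linear (form_coord M \<eta> c y)) \<and>
        (\<forall>w. continuous_on (snd c ` fst c) (\<lambda>y. form_coord M \<eta> c y w)))"

lemma smooth_imp_continuous_form: "smooth_form M \<eta> \<Longrightarrow> continuous_form M \<eta>"
  by (auto simp: smooth_form_def continuous_form_def intro: smooth_on_imp_continuous_on)

locale smooth_manifold =
  fixes M :: "('a, 'e::euclidean_space) manifold"
  assumes smooth_atlas: "smooth_atlas M"
begin

abbreviation "TMtop \<equiv> TM_topology M"

abbreviation "chart_deriv c d x \<equiv> frechet_derivative (transition c d) (at (snd c x))"

section \<open>Charts and transition maps\<close>

lemma chart_openin: "c \<in> atlas M \<Longrightarrow> openin (mtop M) (fst c)"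
  and chart_image_open: "c \<in> atlas M \<Longrightarrow> open (snd c ` fst c)"
  and chart_homeo: "c \<in> atlas M \<Longrightarrow>
    homeomorphic_map (subtopology (mtop M) (fst c)) (top_of_set (snd c ` fst c)) (snd c)"
  using smooth_atlas by (auto simp: smooth_atlas_def)

lemma charts_cover: "x \<in> topspace (mtop M) \<longleftrightarrow> (\<exists>c\<in>atlas M. x \<in> fst c)"
  using smooth_atlas by (auto simp: smooth_atlas_def)

lemma chart_sub: "c \<in> atlas M \<Longrightarrow> x \<in> fst c \<Longrightarrow> x \<in> topspace (mtop M)"
  using charts_cover by blast

lemma topspace_chart: "c \<in> atlas M \<Longrightarrow> topspace (subtopology (mtop M) (fst c)) = fst c"
  using openin_subset[OF chart_openin] by (simp add: Int_absorb1)

lemma chart_inj: "c \<in> atlas M \<Longrightarrow> inj_on (snd c) (fst c)"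
  using homeomorphic_imp_injective_map[OF chart_homeo] topspace_chart by metis

lemma chart_inv_chart [simp]: "c \<in> atlas M \<Longrightarrow> x \<in> fst c \<Longrightarrow> chart_inv c (snd c x) = x"
  unfolding chart_inv_def by (rule inv_into_f_f[OF chart_inj])

lemma continuous_chart_inv:
  assumes "c \<in> atlas M"
  shows "continuous_map (top_of_set (snd c ` fst c)) (mtop M) (chart_inv c)"
proof -
  obtain h where h: "homeomorphic_maps (subtopology (mtop M) (fst c)) (top_of_set (snd c ` fst c))
    (snd c) h"
    using chart_homeo[OF assms] homeomorphic_map_maps by blast
  then have h_cont: "continuous_map (top_of_set (snd c ` fst c)) (mtop M) h"
    by (simp add: homeomorphic_maps_def continuous_map_in_subtopology)
  have "h y = chart_inv c y" if "y \<in> topspace (top_of_set (snd c ` fst c))" for y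
    using h that assms topspace_chart[OF assms] by (auto simp: homeomorphic_maps_def)
  then show ?thesis by (rule continuous_map_eq[OF h_cont])
qed

lemma chart_image_openin:
  assumes "c \<in> atlas M" "openin (mtop M) A" shows "open (snd c ` (fst c \<inter> A))"
proof -
  have "openin (subtopology (mtop M) (fst c)) (fst c \<inter> A)"
    using assms by (auto simp: openin_subtopology)
  then have "openin (top_of_set (snd c ` fst c)) (snd c ` (fst c \<inter> A))"
    using homeomorphic_imp_open_map[OF chart_homeo[OF assms(1)]] by (simp add: open_map_def)
  then show ?thesis using chart_image_open[OF assms(1)] openin_open_trans by blast
qed

lemma chart_overlap_open: "c \<in> atlas M \<Longrightarrow> d \<in> atlas M \<Longrightarrow> open (snd c ` (fst c \<inter> fst d))"
  by (intro chart_image_openin chart_openin)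

lemma chart_nbhd:
  assumes "c \<in> atlas M" "open B"
  shows "openin (mtop M) {x \<in> fst c. snd c x \<in> B}"
proof -
  have "continuous_map (subtopology (mtop M) (fst c)) (top_of_set (snd c ` fst c)) (snd c)"
    using chart_homeo[OF assms(1)] homeomorphic_imp_continuous_map by blast
  then have "continuous_map (subtopology (mtop M) (fst c)) euclidean (snd c)"
    using continuous_map_into_fulltopology by blast
  then have "openin (subtopology (mtop M) (fst c)) {x \<in> fst c. snd c x \<in> B}"
    using assms unfolding continuous_map_def topspace_chart[OF assms(1)] by simp
  then show ?thesis using chart_openin[OF assms(1)] openin_trans_full by blast
qed

lemma transition_chart: "c \<in> atlas M \<Longrightarrow> x \<in> fst c \<Longrightarrow> transition c d (snd c x) = snd d x"
  by (simp add: transition_def)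

lemma transition_smooth:
  "c \<in> atlas M \<Longrightarrow> d \<in> atlas M \<Longrightarrow> smooth_on (snd c ` (fst c \<inter> fst d)) (transition c d)"
  using smooth_atlas by (auto simp: smooth_atlas_def)

lemma transition_has_derivative:
  assumes "c \<in> atlas M" "d \<in> atlas M" "x \<in> fst c" "x \<in> fst d"
  shows "(transition c d has_derivative chart_deriv c d x) (at (snd c x))"
proof -
  have "Ck_on (Suc 0) (snd c ` (fst c \<inter> fst d)) (transition c d)"
    using transition_smooth[OF assms(1,2)] by (auto simp: smooth_on_def)
  then show ?thesis using assms by (auto simp: frechet_derivative_works[symmetric])
qed

lemma chart_deriv_continuous:
  assumes "c \<in> atlas M" "d \<in> atlas M"
  shows "continuous_on (snd c ` (fst c \<inter> fst d)) (\<lambda>y. frechet_derivative (transition c d) (at y) v)"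
proof -
  have "Ck_on (Suc 0) (snd c ` (fst c \<inter> fst d)) (transition c d)"
    using transition_smooth[OF assms(1,2)] by (auto simp: smooth_on_def)
  then show ?thesis by simp
qed

lemma chart_deriv_linear:
  assumes "c \<in> atlas M" "d \<in> atlas M" "x \<in> fst c" "x \<in> fst d"
  shows "linear (chart_deriv c d x)"
  using has_derivative_linear[OF transition_has_derivative[OF assms]] .

text \<open>Near \<open>snd c x\<close> the composite of the two transitions is the direct
  transition, so the chain rule gives the cocycle identity. It is the compatibility condition that
  \<open>tvec\<close> must satisfy.\<close>

lemma chart_deriv_chain:
  assumes "c \<in> atlas M" "d \<in> atlas M" "e \<in> atlas M" "x \<in> fst c" "x \<in> fst d" "x \<in> fst e"
  shows "chart_deriv c e x w = chart_deriv d e x (chart_deriv c d x w)"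
proof -
  have "(transition d e has_derivative chart_deriv d e x) (at (transition c d (snd c x)))"
    using transition_has_derivative[of d e x] assms by (simp add: transition_chart)
  from diff_chain_at[OF transition_has_derivative[OF assms(1,2,4,5)] this]
  have "((transition d e \<circ> transition c d) has_derivative (chart_deriv d e x \<circ> chart_deriv c d x))
    (at (snd c x))" .
  then have "(transition c e has_derivative (chart_deriv d e x \<circ> chart_deriv c d x)) (at (snd c x))"
    by (rule has_derivative_transform_within_open[OF _ chart_overlap_open[OF assms(1,2)]])
       (use assms in \<open>auto simp: transition_chart\<close>)
  then show ?thesis using frechet_derivative_at by (metis comp_apply)
qed

lemma chart_deriv_refl:
  assumes "c \<in> atlas M" "x \<in> fst c" shows "chart_deriv c c x w = w"
proof -
  have "(transition c c has_derivative (\<lambda>w. w)) (at (snd c x))"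
    by (rule has_derivative_transform_within_open[OF has_derivative_ident chart_image_open[OF
      assms(1)]])
       (use assms in \<open>auto simp: transition_chart\<close>)
  then show ?thesis using frechet_derivative_at by metis
qed

section \<open>Tangent vectors in coordinates\<close>

lemma tvec_coord:
  "d \<in> atlas M \<Longrightarrow> x \<in> fst d \<Longrightarrow> tvec M c x w d = chart_deriv c d x w"
  by (simp add: tvec_def charts_at_def)

lemma tvec_self [simp]: "c \<in> atlas M \<Longrightarrow> x \<in> fst c \<Longrightarrow> tvec M c x w c = w"
  by (simp add: tvec_coord chart_deriv_refl)

lemma tvec_in: "c \<in> atlas M \<Longrightarrow> x \<in> fst c \<Longrightarrow> tvec M c x w \<in> tangent_space M x"
  unfolding tangent_space_def mem_Collect_eq
proof (intro conjI allI ballI impI)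
  fix d e assume c: "c \<in> atlas M" "x \<in> fst c" and "d \<in> charts_at M x" "e \<in> charts_at M x"
  then have "d \<in> atlas M" "e \<in> atlas M" "x \<in> fst d" "x \<in> fst e" by (simp_all add: charts_at_def)
  then show "tvec M c x w e = chart_deriv d e x (tvec M c x w d)"
    using c by (simp add: tvec_coord chart_deriv_chain[of c d e])
qed (simp add: tvec_def)

lemma tangent_coord:
  assumes "v \<in> tangent_space M x" "c \<in> atlas M" "x \<in> fst c" "d \<in> atlas M" "x \<in> fst d"
  shows "v d = chart_deriv c d x (v c)"
  using assms unfolding tangent_space_def charts_at_def by blast

lemma tvec_of_tangent:
  assumes "v \<in> tangent_space M x" "c \<in> atlas M" "x \<in> fst c"
  shows "tvec M c x (v c) = v"
proof
  fix d show "tvec M c x (v c) d = v d"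
  proof (cases "d \<in> charts_at M x")
    case True
    then have "d \<in> atlas M" "x \<in> fst d" by (simp_all add: charts_at_def)
    then show ?thesis using tangent_coord[OF assms] by (simp add: tvec_coord)
  next
    case False
    then have "v d = 0" using assms(1) unfolding tangent_space_def by blast
    with False show ?thesis by (simp add: tvec_def)
  qed
qed

lemma TM_iff: "(x, v) \<in> TM M \<longleftrightarrow> x \<in> topspace (mtop M) \<and> v \<in> tangent_space M x"
  by (auto simp: TM_def)

lemma TM_cases:
  assumes "p \<in> TM M" "c \<in> atlas M" "fst p \<in> fst c"
  shows "p = tparam M c (snd c (fst p), snd p c)"
  using assms tvec_of_tangent[of "snd p" "fst p" c]
  by (cases p) (simp add: tparam_def TM_iff)

lemma TM_chart: "p \<in> TM M \<Longrightarrow> \<exists>c\<in>atlas M. fst p \<in> fst c"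
  using charts_cover by (auto simp: TM_def)

lemma tparam_in:
  assumes "c \<in> atlas M" "z \<in> snd c ` fst c \<times> UNIV"
  shows "tparam M c z \<in> TM M" "fst (tparam M c z) \<in> fst c"
    "snd c (fst (tparam M c z)) = fst z" "snd (tparam M c z) c = snd z"
  using assms by (auto simp: tparam_def TM_iff tvec_in chart_sub)

section \<open>The topology generated by the bundle charts\<close>

lemma openin_TM_generator:
  assumes "c \<in> atlas M" "open W"
  shows "openin TMtop {p \<in> TM M. fst p \<in> fst c \<and> (snd c (fst p), snd p c) \<in> W}"
proof -
  have "openin TMtop {p \<in> fst (tchart M c). snd (tchart M c) p \<in> W}"
    unfolding TM_topology_def using assms by (intro topology_generated_by_Basis) blast
  then show ?thesis by (simp add: tchart_def case_prod_beta)
qed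

lemma topspace_TM: "topspace TMtop = TM M"
proof -
  have "topspace TMtop = (\<Union>c\<in>atlas M. \<Union>W\<in>{W. open W}. {p \<in> fst (tchart M c). snd (tchart M c) p \<in>
    W})"
    unfolding TM_topology_def topology_generated_by_topspace by blast
  also have "\<dots> = TM M"
  proof (intro equalityI subsetI)
    fix p assume p: "p \<in> TM M"
    obtain c where "c \<in> atlas M" "fst p \<in> fst c" using TM_chart[OF p] by blast
    with p show "p \<in> (\<Union>c\<in>atlas M. \<Union>W\<in>{W. open W}. {p \<in> fst (tchart M c). snd (tchart M c) p \<in> W})"
      by (intro UN_I[of c] UN_I[of UNIV]) (simp_all add: tchart_def)
  qed (simp add: tchart_def)
  finally show ?thesis .
qed

text \<open>The preimage of an open set is the union over all charts of what its coordinate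
  expression cuts out, and each of these pieces is a generator of the topology.\<close>

lemma continuous_map_TMI:
  fixes f :: "'a \<times> ('a, 'e) tvector \<Rightarrow> 'b::topological_space"
  assumes "\<And>c. c \<in> atlas M \<Longrightarrow> continuous_on (snd c ` fst c \<times> UNIV) (\<lambda>z. f (tparam M c z))"
  shows "continuous_map TMtop euclidean f"
  unfolding continuous_map_def
proof (intro conjI allI impI)
  fix S :: "'b set" assume "openin euclidean S"
  then have S: "open S" by simp
  let ?W = "\<lambda>c. (snd c ` fst c \<times> UNIV) \<inter> (\<lambda>z. f (tparam M c z)) -` S"
  have W: "open (?W c)" if "c \<in> atlas M" for c
    by (intro continuous_open_preimage assms that open_Times chart_image_open S open_UNIV)
  have "{p \<in> topspace TMtop. f p \<in> S} =
    (\<Union>c\<in>atlas M. {p \<in> TM M. fst p \<in> fst c \<and> (snd c (fst p), snd p c) \<in> ?W c})"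
  proof (intro equalityI subsetI)
    fix p assume "p \<in> {p \<in> topspace TMtop. f p \<in> S}"
    then have p: "p \<in> TM M" "f p \<in> S" by (simp_all add: topspace_TM)
    obtain c where c: "c \<in> atlas M" "fst p \<in> fst c" using TM_chart[OF p(1)] by blast
    then show "p \<in> (\<Union>c\<in>atlas M. {p \<in> TM M. fst p \<in> fst c \<and> (snd c (fst p), snd p c) \<in> ?W c})"
      using p TM_cases[OF p(1) c] by (intro UN_I[OF c(1)]) simp
  next
    fix p assume "p \<in> (\<Union>c\<in>atlas M. {p \<in> TM M. fst p \<in> fst c \<and> (snd c (fst p), snd p c) \<in> ?W c})"
    then obtain c where c: "c \<in> atlas M" "p \<in> TM M" "fst p \<in> fst c" "(snd c (fst p), snd p c) \<in>
      ?W c"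
      by blast
    then show "p \<in> {p \<in> topspace TMtop. f p \<in> S}"
      using TM_cases[OF c(2,1,3)] by (simp add: topspace_TM)
  qed
  then show "openin TMtop {p \<in> topspace TMtop. f p \<in> S}"
    using openin_TM_generator[OF _ W] by auto
qed simp

lemma continuous_coord_change:
  assumes "c \<in> atlas M" "d \<in> atlas M"
  shows "continuous_on (snd c ` (fst c \<inter> fst d) \<times> UNIV)
    (\<lambda>z. (transition c d (fst z), frechet_derivative (transition c d) (at (fst z)) (snd z)))"
proof (rule continuous_on_Pair)
  show "continuous_on (snd c ` (fst c \<inter> fst d) \<times> UNIV) (\<lambda>z. transition c d (fst z))"
    by (rule continuous_on_compose2[OF smooth_on_imp_continuous_on[OF transition_smooth[OF assms]]])
       (auto intro: continuous_intros)
  show "continuous_on (snd c ` (fst c \<inter> fst d) \<times> UNIV)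
      (\<lambda>z. frechet_derivative (transition c d) (at (fst z)) (snd z))"
  proof (rule continuous_on_linear_family[OF _ chart_deriv_continuous[OF assms]])
    fix y assume "y \<in> snd c ` (fst c \<inter> fst d)"
    then obtain x where "y = snd c x" "x \<in> fst c" "x \<in> fst d" by blast
    then show "linear (frechet_derivative (transition c d) (at y))"
      using chart_deriv_linear[OF assms] by simp
  qed
qed

text \<open>A generating open set may come from a different chart \<open>d\<close>; its preimage is
  open because the change of coordinates is jointly continuous in base point and vector on the
  overlap.\<close>

lemma continuous_tparam:
  assumes "c \<in> atlas M"
  shows "continuous_map (top_of_set (snd c ` fst c \<times> UNIV)) TMtop (tparam M c)"
  unfolding TM_topology_def continuous_on_generated_topo_iff
proof (intro conjI allI impI)
  let ?S = "\<lambda>d. snd c ` (fst c \<inter> fst d) \<times> (UNIV :: 'e set)"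
  let ?G = "\<lambda>d z. (transition c d (fst z), frechet_derivative (transition c d) (at (fst z)) (snd
    z))"
  fix U assume "U \<in> {{p \<in> fst (tchart M d). snd (tchart M d) p \<in> W} |d W. d \<in> atlas M \<and> open W}"
  then obtain d W where d: "d \<in> atlas M" "open W"
    and U: "U = {p \<in> TM M. fst p \<in> fst d \<and> (snd d (fst p), snd p d) \<in> W}"
    by (auto simp: tchart_def case_prod_beta)
  have "open (?S d \<inter> ?G d -` W)"
    by (intro continuous_open_preimage continuous_coord_change assms d open_Times
        chart_overlap_open open_UNIV)
  then have op: "openin (top_of_set (snd c ` fst c \<times> UNIV)) (?S d \<inter> ?G d -` W)"
    by (intro open_subset) blast
  have eq: "tparam M c -` U \<inter> topspace (top_of_set (snd c ` fst c \<times> UNIV)) = ?S d \<inter> ?G d -` W"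
    using tparam_in[OF assms] assms d
    by (auto simp: U tparam_def transition_chart tvec_coord image_iff) 
  show "openin (top_of_set (snd c ` fst c \<times> UNIV))
      (tparam M c -` U \<inter> topspace (top_of_set (snd c ` fst c \<times> UNIV)))"
    unfolding eq by (rule op)
next
  show "tparam M c ` topspace (top_of_set (snd c ` fst c \<times> UNIV))
    \<subseteq> \<Union> {{p \<in> fst (tchart M c). snd (tchart M c) p \<in> W} |c W. c \<in> atlas M \<and> open W}"
    using tparam_in[OF assms] topspace_TM
    unfolding TM_topology_def topology_generated_by_topspace by auto
qed

lemma tchart_image: "c \<in> atlas M \<Longrightarrow> snd (tchart M c) ` fst (tchart M c) = snd c ` fst c \<times> UNIV"
proof (intro equalityI subsetI)
  fix z :: "'e \<times> 'e" assume c: "c \<in> atlas M" and z: "z \<in> snd c ` fst c \<times> UNIV"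
  show "z \<in> snd (tchart M c) ` fst (tchart M c)"
    using tparam_in[OF c z] by (intro image_eqI[of _ _ "tparam M c z"]) (auto simp: tchart_def
      case_prod_beta)
qed (auto simp: tchart_def)

lemma chart_inv_tchart:
  assumes c: "c \<in> atlas M" and z: "z \<in> snd c ` fst c \<times> UNIV"
  shows "chart_inv (tchart M c) z = tparam M c z"
proof -
  have "inj_on (snd (tchart M c)) (fst (tchart M c))"
  proof (rule inj_on_inverseI[where g="tparam M c"])
    fix p assume "p \<in> fst (tchart M c)"
    then show "tparam M c (snd (tchart M c) p) = p"
      using TM_cases[OF _ c, of p] by (simp add: tchart_def case_prod_beta)
  qed
  then show ?thesis
    unfolding chart_inv_def using tparam_in[OF c z]
    by (intro inv_into_f_eq) (auto simp: tchart_def case_prod_beta)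
qed

lemma Ck_fun_TM:
  assumes "Ck_fun k (tangent_bundle M) L" "c \<in> atlas M"
  shows "Ck_on k (snd c ` fst c \<times> UNIV) (L \<circ> chart_inv (tchart M c))"
  using assms by (auto simp: Ck_fun_def tangent_bundle_def tchart_image)

lemma Ck_fun_TM_continuous:
  assumes "Ck_fun k (tangent_bundle M) L" shows "continuous_map TMtop euclideanreal L"
proof (rule continuous_map_TMI)
  fix c assume c: "c \<in> atlas M"
  show "continuous_on (snd c ` fst c \<times> UNIV) (\<lambda>z. L (tparam M c z))"
    by (rule continuous_on_eq[OF Ck_on_imp_continuous_on[OF Ck_fun_TM[OF assms c]]])
       (simp add: chart_inv_tchart c)
qed

lemma Ck_fun_lift_continuous:
  assumes "Ck_fun k M V" shows "continuous_map TMtop euclideanreal (\<lambda>p. V (fst p))"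
proof (rule continuous_map_TMI)
  fix c assume c: "c \<in> atlas M"
  have "continuous_on (snd c ` fst c) (V \<circ> chart_inv c)"
    using assms c unfolding Ck_fun_def by (blast intro: Ck_on_imp_continuous_on)
  then have "continuous_on (snd c ` fst c \<times> UNIV) (\<lambda>z. (V \<circ> chart_inv c) (fst z))"
    by (rule continuous_on_compose2) (auto intro: continuous_intros)
  then show "continuous_on (snd c ` fst c \<times> UNIV) (\<lambda>z. V (fst (tparam M c z)))"
    by (simp add: tparam_def)
qed

lemma continuous_form_continuous:
  assumes "continuous_form M \<eta>" shows "continuous_map TMtop euclideanreal \<eta>"
proof (rule continuous_map_TMI)
  fix c assume c: "c \<in> atlas M"
  have "continuous_on (snd c ` fst c \<times> UNIV) (\<lambda>z. form_coord M \<eta> c (fst z) (snd z))"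
    by (rule continuous_on_linear_family) (use assms c in \<open>auto simp: continuous_form_def\<close>)
  then show "continuous_on (snd c ` fst c \<times> UNIV) (\<lambda>z. \<eta> (tparam M c z))"
    by (simp add: form_coord_def tparam_def)
qed

text \<open>\<open>mdiff\<close> evaluates in an arbitrarily chosen chart. The chain rule for the
  transition and the compatibility of the coordinates of \<open>v\<close> make the value independent
  of the choice.\<close>

lemma mdiff_eq:
  assumes f: "Ck_fun 1 M f" and c: "c \<in> atlas M" "x \<in> fst c" and v: "v \<in> tangent_space M x"
  shows "mdiff M f (x, v) = frechet_derivative (f \<circ> chart_inv c) (at (snd c x)) (v c)"
proof -
  define d where "d = (SOME c. c \<in> charts_at M x)"
  have "d \<in> charts_at M x" unfolding d_def by (rule someI[of _ c]) (simp add: charts_at_def c)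
  then have d: "d \<in> atlas M" "x \<in> fst d" by (auto simp: charts_at_def)
  have diff: "(f \<circ> chart_inv e) differentiable (at (snd e x))" if "e \<in> atlas M" "x \<in> fst e" for e
    using f that by (auto simp: Ck_fun_def)
  have "((f \<circ> chart_inv d) has_derivative frechet_derivative (f \<circ> chart_inv d) (at (snd d x)))
      (at (transition c d (snd c x)))"
    using diff[OF d] c by (simp add: transition_chart frechet_derivative_works[symmetric])
  from diff_chain_at[OF transition_has_derivative[OF c(1) d(1) c(2) d(2)] this]
  have "((f \<circ> chart_inv d \<circ> transition c d) has_derivative
      frechet_derivative (f \<circ> chart_inv d) (at (snd d x)) \<circ> chart_deriv c d x) (at (snd c x))" .
  then have "((f \<circ> chart_inv c) has_derivative
      frechet_derivative (f \<circ> chart_inv d) (at (snd d x)) \<circ> chart_deriv c d x) (at (snd c x))"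
    by (rule has_derivative_transform_within_open[OF _ chart_overlap_open[OF c(1) d(1)]])
       (use c d in \<open>auto simp: transition_chart\<close>)
  from fun_cong[OF frechet_derivative_at[OF this], of "v c"]
  have "frechet_derivative (f \<circ> chart_inv c) (at (snd c x)) (v c) =
     frechet_derivative (f \<circ> chart_inv d) (at (snd d x)) (chart_deriv c d x (v c))" by (simp only:
       comp_apply)
  also have "chart_deriv c d x (v c) = v d"
    using tangent_coord[OF v c d] by simp
  finally show ?thesis by (simp only: mdiff_def prod.case Let_def d_def)
qed

lemma mdiff_form_coord:
  assumes f: "Ck_fun 1 M f" and c: "c \<in> atlas M" "y \<in> snd c ` fst c"
  shows "form_coord M (mdiff M f) c y w = frechet_derivative (f \<circ> chart_inv c) (at y) w"
  using c mdiff_eq[OF f c(1) _ tvec_in[OF c(1)]] by (auto simp: form_coord_def)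

lemma mdiff_continuous_form:
  assumes f: "Ck_fun 1 M f" shows "continuous_form M (mdiff M f)"
  unfolding continuous_form_def
proof (intro ballI conjI allI)
  fix c assume c: "c \<in> atlas M"
  have Ck: "(f \<circ> chart_inv c) differentiable (at y)" if "y \<in> snd c ` fst c" for y
    using f c that by (auto simp: Ck_fun_def)
  have cont: "continuous_on (snd c ` fst c) (\<lambda>y. frechet_derivative (f \<circ> chart_inv c) (at y) w)"
    for w
    using f c by (auto simp: Ck_fun_def)
  {
    fix y assume y: "y \<in> snd c ` fst c"
    then show "linear (form_coord M (mdiff M f) c y)"
      using linear_frechet_derivative[OF Ck[OF y]] mdiff_form_coord[OF f c y] by presburger
  }
  show "continuous_on (snd c ` fst c) (\<lambda>y. form_coord M (mdiff M f) c y w)" for w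
    using cont by (rule continuous_on_eq) (simp add: mdiff_form_coord[OF f c])
qed

lemma continuous_tnorm:
  assumes "riemannian_metric M g" shows "continuous_map TMtop euclideanreal (tnorm g)"
proof (rule continuous_map_TMI)
  fix c assume c: "c \<in> atlas M"
  let ?A = "\<lambda>y u w. g (chart_inv c y) (tvec M c (chart_inv c y) u) (tvec M c (chart_inv c y) w)"
  have "continuous_on (snd c ` fst c \<times> UNIV) (\<lambda>z. ?A (fst z) (snd z) (snd z))"
    by (rule continuous_on_quadratic_family)
       (use assms c in \<open>auto simp: riemannian_metric_def intro!: smooth_on_imp_continuous_on\<close>)
  then show "continuous_on (snd c ` fst c \<times> UNIV) (\<lambda>z. tnorm g (tparam M c z))"
    by (auto simp: tnorm_def tparam_def intro: continuous_intros)
qed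

end

section \<open>Compact sets in the tangent bundle of a closed manifold\<close>

text \<open>The separating functions on the bundle are unbounded; an injective map into the open
  unit interval brings them into the range of coordinates that the curve attains.\<close>

lemma arctan_squash: "0 \<le> 1/2 + arctan t / pi \<and> 1/2 + arctan t / pi < 1"
  using arctan_lbound[of t] arctan_ubound[of t] pi_gt_zero by (simp add: field_simps)

lemma arctan_squash_inj: "1/2 + arctan t / pi = 1/2 + arctan s / pi \<Longrightarrow> t = s"
  by (simp add: arctan_eq_iff)

locale closed_riemannian = smooth_manifold M
  for M :: "('a, 'e::euclidean_space) manifold" +
  fixes g :: "'a \<Rightarrow> ('a, 'e) tvector \<Rightarrow> ('a, 'e) tvector \<Rightarrow> real"
  assumes closed_mfd: "closed_manifold M" and riemannian: "riemannian_metric M g"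
begin

lemma metric_bilinear:
  "c \<in> atlas M \<Longrightarrow> x \<in> fst c \<Longrightarrow> bilinear (\<lambda>u w. g x (tvec M c x u) (tvec M c x w))"
  and metric_pos: "c \<in> atlas M \<Longrightarrow> x \<in> fst c \<Longrightarrow> u \<noteq> 0 \<Longrightarrow> g x (tvec M c x u) (tvec M c x u) > 0"
  and metric_smooth: "c \<in> atlas M \<Longrightarrow> smooth_on (snd c ` fst c)
           (\<lambda>y. g (chart_inv c y) (tvec M c (chart_inv c y) u) (tvec M c (chart_inv c y) w))"
  using riemannian unfolding riemannian_metric_def by blast+

lemma metric_nonneg:
  assumes "p \<in> TM M" shows "0 \<le> g (fst p) (snd p) (snd p)"
proof -
  obtain c where c: "c \<in> atlas M" "fst p \<in> fst c" using TM_chart[OF assms] by blast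
  have eq: "tvec M c (fst p) (snd p c) = snd p"
    using assms TM_iff[of "fst p" "snd p"] by (intro tvec_of_tangent c) simp
  show ?thesis
  proof (cases "snd p c = 0")
    case True
    then have "g (fst p) (tvec M c (fst p) (snd p c)) (tvec M c (fst p) (snd p c)) = 0"
      using bilinear_lzero[OF metric_bilinear[OF c]] by simp
    then show ?thesis by (simp add: eq)
  next
    case False
    then show ?thesis using metric_pos[OF c False] by (simp add: eq)
  qed
qed

lemma tnorm_nonneg: "p \<in> TM M \<Longrightarrow> 0 \<le> tnorm g p"
  using metric_nonneg[of p] by (simp add: tnorm_def case_prod_beta)

lemma tnorm_scale:
  assumes "c \<in> atlas M" "x \<in> fst c"
  shows "tnorm g (x, tvec M c x (s *\<^sub>R w)) = \<bar>s\<bar> * tnorm g (x, tvec M c x w)"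
proof -
  have "g x (tvec M c x (s *\<^sub>R w)) (tvec M c x (s *\<^sub>R w)) =
    s * (s * g x (tvec M c x w) (tvec M c x w))"
    using bilinear_lmul[OF metric_bilinear[OF assms]] bilinear_rmul[OF metric_bilinear[OF assms]]
      by simp
  then show ?thesis by (simp add: tnorm_def real_sqrt_mult mult.assoc[symmetric])
qed

lemma chart_cball:
  assumes "c \<in> atlas M" "x \<in> fst c"
  obtains r where "r > 0" "cball (snd c x) r \<subseteq> snd c ` fst c"
  using open_contains_cball[THEN iffD1, OF chart_image_open[OF assms(1)]] assms(2) by blast

text \<open>Over a compact piece of a chart the metric dominates a multiple of the Euclidean one.\<close>

lemma tnorm_le_local_compact:
  assumes x: "x \<in> topspace (mtop M)"
  shows "\<exists>N Q. openin (mtop M) N \<and> x \<in> N \<and> compactin TMtop Q \<and> {p \<in> TM M. fst p \<in> N \<and> tnorm g p \<le>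
    R} \<subseteq> Q"
proof -
  obtain c where c: "c \<in> atlas M" "x \<in> fst c" using charts_cover x by blast
  obtain r where r: "r > 0" "cball (snd c x) r \<subseteq> snd c ` fst c" using chart_cball[OF c] by blast
  define q where "q z = g (chart_inv c (fst z)) (tvec M c (chart_inv c (fst z)) (snd z))
      (tvec M c (chart_inv c (fst z)) (snd z))" for z
  have bil: "bilinear (\<lambda>u w. g (chart_inv c y) (tvec M c (chart_inv c y) u) (tvec M c (chart_inv c
    y) w))"
    if y: "y \<in> snd c ` fst c" for y
  proof -
    obtain x' where "x' \<in> fst c" "y = snd c x'" using y by blast
    then show ?thesis using metric_bilinear[OF c(1), of x'] c(1) by simp
  qed
  have q_cont: "continuous_on (snd c ` fst c \<times> UNIV) q"
    unfolding q_def using bil smooth_on_imp_continuous_on[OF metric_smooth[OF c(1)]]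
    by (rule continuous_on_quadratic_family)
  \<comment> \<open>The minimum \<open>a\<close> of the metric over unit vectors above a closed ball
    is positive, and homogeneity then yields \<open>a * (norm w)\<^sup>2 \<le> q (y, w)\<close> for
    all vectors.\<close>
  let ?K = "cball (snd c x) r \<times> sphere (0::'e) 1"
  have K: "compact ?K" by (intro compact_Times compact_cball compact_sphere)
  have K_ne: "?K \<noteq> {}" using r(1) by (auto simp: less_imp_le)
  have "continuous_on ?K q" using r(2) by (intro continuous_on_subset[OF q_cont]) auto
  from continuous_attains_inf[OF K K_ne this]
  obtain z0 where z0: "z0 \<in> ?K" "\<And>z. z \<in> ?K \<Longrightarrow> q z0 \<le> q z" by blast
  define a where "a = q z0"
  have "fst z0 \<in> snd c ` fst c" using z0(1) r(2) by (auto simp: mem_Times_iff)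
  then obtain x0 where x0: "x0 \<in> fst c" "fst z0 = snd c x0" by blast
  have "snd z0 \<noteq> 0" using z0(1) by (auto simp: mem_Times_iff)
  then have a: "a > 0"
    using metric_pos[OF c(1) x0(1)] x0 c(1) by (simp add: a_def q_def)
  have q_ge: "a * (norm w)\<^sup>2 \<le> q (y, w)" if y: "y \<in> cball (snd c x) r" for y w
  proof (cases "w = 0")
    case True
    then show ?thesis using bilinear_lzero[OF bil[of y]] y r(2) by (auto simp: q_def)
  next
    case False
    let ?u = "(1 / norm w) *\<^sub>R w"
    have "a \<le> q (y, ?u)" unfolding a_def using y False by (intro z0(2)) auto
    also have "q (y, ?u) = (1 / norm w) * ((1 / norm w) * q (y, w))"
      using y r(2) unfolding q_def fst_conv snd_conv
      by (subst bilinear_lmul[OF bil], blast, subst bilinear_rmul[OF bil], blast) simp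
    finally show ?thesis using False by (simp add: field_simps power2_eq_square)
  qed
  define N where "N = {y \<in> fst c. snd c y \<in> ball (snd c x) r}"
  \<comment> \<open>The radius is forced by the estimate: norm at most \<open>R\<close> gives
    \<open>a * (norm w)\<^sup>2 \<le> R\<^sup>2\<close>.\<close>
  define Q where "Q = tparam M c ` (cball (snd c x) r \<times> cball 0 (sqrt (R\<^sup>2 / a)))"
  have "compactin (top_of_set (snd c ` fst c \<times> UNIV)) (cball (snd c x) r \<times> cball (0::'e) (sqrt
    (R\<^sup>2 / a)))"
    using r(2) by (auto simp: compactin_subtopology intro!: compact_Times)
  then have "compactin TMtop Q"
    unfolding Q_def by (rule image_compactin[OF _ continuous_tparam[OF c(1)]])
  moreover have "openin (mtop M) N" unfolding N_def by (rule chart_nbhd[OF c(1)]) simp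
  moreover have "x \<in> N" using c r(1) by (simp add: N_def)
  moreover have "p \<in> Q" if p: "p \<in> TM M" "fst p \<in> N" "tnorm g p \<le> R" for p
  proof -
    have pc: "fst p \<in> fst c" "snd c (fst p) \<in> cball (snd c x) r" using p(2) by (simp_all add: N_def)
    define y w where "y = snd c (fst p)" and "w = snd p c"
    have p_eq: "p = tparam M c (y, w)" unfolding y_def w_def by (rule TM_cases[OF p(1) c(1) pc(1)])
    have y: "y \<in> cball (snd c x) r" using pc by (simp add: y_def)
    have "tnorm g p = sqrt (q (y, w))"
      by (simp add: p_eq tnorm_def q_def tparam_def)
    moreover have "0 \<le> q (y, w)"
      using q_ge[OF y, of w] a by (meson mult_nonneg_nonneg order_trans less_imp_le zero_le_power2)
    ultimately have "q (y, w) = (tnorm g p)\<^sup>2" by simp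
    also have "\<dots> \<le> R\<^sup>2" using p(3) tnorm_nonneg[OF p(1)] by (intro power_mono)
    finally have "a * (norm w)\<^sup>2 \<le> R\<^sup>2" using q_ge[OF y, of w] by linarith
    then have "(norm w)\<^sup>2 \<le> R\<^sup>2 / a" using a by (simp add: field_simps)
    then have "norm w \<le> sqrt (R\<^sup>2 / a)" by (rule real_le_rsqrt)
    then show ?thesis using y unfolding Q_def p_eq by (intro imageI) simp
  qed
  ultimately show ?thesis by (intro exI[of _ N] exI[of _ Q]) blast
qed

lemma finite_open_cover:
  assumes "\<forall>x\<in>topspace (mtop M). \<exists>N. openin (mtop M) N \<and> x \<in> N \<and> P N"
  shows "\<exists>F. finite F \<and> topspace (mtop M) \<subseteq> \<Union>F \<and> (\<forall>N\<in>F. P N)"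
proof -
  have "compact_space (mtop M)" using closed_mfd by (simp add: closed_manifold_def)
  moreover have "\<forall>U\<in>{N. openin (mtop M) N \<and> P N}. openin (mtop M) U" by blast
  moreover have "topspace (mtop M) \<subseteq> \<Union>{N. openin (mtop M) N \<and> P N}" using assms by blast
  ultimately obtain F where "finite F" "F \<subseteq> {N. openin (mtop M) N \<and> P N}" "topspace (mtop M) \<subseteq> \<Union>F"
    unfolding compact_space_alt by meson
  then show ?thesis by blast
qed

text \<open>Finitely many of the local neighbourhoods cover the compact base, so the set is a closed
  part of a finite union of compact sets.\<close>

lemma compact_tnorm_le: "compactin TMtop {p \<in> TM M. tnorm g p \<le> R}"
proof -
  have "\<forall>x\<in>topspace (mtop M). \<exists>N. openin (mtop M) N \<and> x \<in> N \<and> (\<exists>Q. compactin TMtop Q \<and>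
      {p \<in> TM M. fst p \<in> N \<and> tnorm g p \<le> R} \<subseteq> Q)"
    using tnorm_le_local_compact[of _ R] by blast
  from finite_open_cover[OF this] obtain F where F: "finite F" "topspace (mtop M) \<subseteq> \<Union>F"
    "\<forall>N\<in>F. \<exists>Q. compactin TMtop Q \<and> {p \<in> TM M. fst p \<in> N \<and> tnorm g p \<le> R} \<subseteq> Q"
    by blast
  from bchoice[OF F(3)] obtain Q where Q: "\<And>N. N \<in> F \<Longrightarrow> compactin TMtop (Q N)"
    "\<And>N. N \<in> F \<Longrightarrow> {p \<in> TM M. fst p \<in> N \<and> tnorm g p \<le> R} \<subseteq> Q N" by blast
  have cQ: "compactin TMtop (\<Union> (Q ` F))"
    using F(1) Q(1) by (intro compactin_Union) auto
  have "closedin TMtop {p \<in> topspace TMtop. tnorm g p \<in> {..R}}"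
    by (rule closedin_continuous_map_preimage[OF continuous_tnorm[OF riemannian]]) simp
  then have cl: "closedin TMtop {p \<in> TM M. tnorm g p \<le> R}" by (simp add: topspace_TM)
  show ?thesis
  proof (rule closed_compactin[OF cQ _ cl])
    show "{p \<in> TM M. tnorm g p \<le> R} \<subseteq> \<Union> (Q ` F)"
    proof
      fix p assume p: "p \<in> {p \<in> TM M. tnorm g p \<le> R}"
      then have "fst p \<in> topspace (mtop M)" by (auto simp: TM_def)
      then obtain N where "N \<in> F" "fst p \<in> N" using F(2) by blast
      then show "p \<in> \<Union> (Q ` F)" using p Q(2) by blast
    qed
  qed
qed

text \<open>The form is bounded on the compact set of vectors of norm at most 1, and linearity on
  the fibres scales this bound to all vectors. The maximum with 0 covers an empty bundle, where the
  bound \<open>C\<close> could be negative.\<close>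

lemma continuous_form_bound:
  assumes \<eta>: "continuous_form M \<eta>"
  shows "\<exists>C\<ge>0. \<forall>p\<in>TM M. \<bar>\<eta> p\<bar> \<le> C * tnorm g p"
proof -
  have "compact (\<eta> ` {p \<in> TM M. tnorm g p \<le> 1})"
    using image_compactin[OF compact_tnorm_le continuous_form_continuous[OF \<eta>]] by simp
  from compact_imp_bounded[OF this]
  obtain C where "\<forall>y\<in>\<eta> ` {p \<in> TM M. tnorm g p \<le> 1}. norm y \<le> C"
    unfolding bounded_iff by blast
  then have C: "\<bar>\<eta> p\<bar> \<le> C" if "p \<in> TM M" "tnorm g p \<le> 1" for p
    using that by (metis (mono_tags, lifting) image_eqI mem_Collect_eq real_norm_def)
  have "\<bar>\<eta> p\<bar> \<le> max 0 C * tnorm g p" if p: "p \<in> TM M" for p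
  proof -
    obtain c where c: "c \<in> atlas M" "fst p \<in> fst c" using TM_chart[OF p] by blast
    define x w where "x = fst p" and "w = snd p c"
    have p_eq: "p = (x, tvec M c x w)"
      using TM_cases[OF p c] c by (simp add: tparam_def x_def w_def)
    have x: "x \<in> fst c" using c by (simp add: x_def)
    have "linear (form_coord M \<eta> c (snd c x))" using \<eta> c x by (auto simp: continuous_form_def)
    moreover have "form_coord M \<eta> c (snd c x) = (\<lambda>w. \<eta> (x, tvec M c x w))"
      using c x by (simp add: form_coord_def fun_eq_iff)
    ultimately have lin: "linear (\<lambda>w. \<eta> (x, tvec M c x w))" by simp
    show ?thesis
    proof (cases "w = 0")
      case True
      have "\<eta> p = 0" unfolding p_eq True using linear_0[OF lin] by simp
      then show ?thesis using tnorm_nonneg[OF p] by simp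
    next
      case False
      have pos: "tnorm g p > 0"
        using metric_pos[OF c(1) x False] by (simp add: p_eq tnorm_def)
      define s where "s = 1 / tnorm g p"
      have s: "s > 0" using pos by (simp add: s_def)
      let ?p = "(x, tvec M c x (s *\<^sub>R w))"
      have "?p \<in> TM M" using c x by (simp add: TM_iff tvec_in chart_sub)
      moreover have "tnorm g ?p = 1"
        using tnorm_scale[OF c(1) x, of s w] pos s by (simp add: p_eq[symmetric] s_def)
      ultimately have "\<bar>\<eta> ?p\<bar> \<le> C" using C by simp
      moreover have "\<eta> ?p = s * \<eta> p" using linear_scale[OF lin, of s w] by (simp add: p_eq)
      ultimately have "s * \<bar>\<eta> p\<bar> \<le> C" using s by (simp add: abs_mult)
      then have "\<bar>\<eta> p\<bar> \<le> C * tnorm g p" using pos by (simp add: s_def field_simps)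
      also have "\<dots> \<le> max 0 C * tnorm g p" using pos by (intro mult_right_mono) auto
      finally show ?thesis .
    qed
  qed
  then show ?thesis by (intro exI[of _ "max 0 C"]) auto
qed

lemma extend_by_zero_continuous:
  assumes c: "c \<in> atlas M" and B: "compact B" "B \<subseteq> snd c ` fst c"
    and \<psi>: "continuous_on (snd c ` fst c \<times> UNIV) \<psi>" "\<And>y w. y \<in> snd c ` fst c - B \<Longrightarrow> \<psi> (y, w) = 0"
  shows "continuous_map TMtop euclideanreal (\<lambda>p. if fst p \<in> fst c then \<psi> (snd c (fst p),
    snd p c) else 0)"
    (is "continuous_map _ _ ?F")
proof (rule continuous_map_TMI)
  fix d assume d: "d \<in> atlas M"
  have "compactin (mtop M) (chart_inv c ` B)"
    using B by (intro image_compactin[OF _ continuous_chart_inv[OF c]]) (simp add: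
      compactin_subtopology)
  then have "closedin (mtop M) (chart_inv c ` B)"
    using closed_mfd compactin_imp_closedin unfolding closed_manifold_def by blast
  then have op: "openin (mtop M) (topspace (mtop M) - chart_inv c ` B)" by blast
  let ?O1 = "snd d ` (fst d \<inter> fst c)" and ?O2 = "snd d ` (fst d \<inter> (topspace (mtop M) - chart_inv c
    ` B))"
  have cover: "snd d ` fst d = ?O1 \<union> ?O2"
  proof -
    have "x \<in> fst c" if "x \<in> chart_inv c ` B" for x
    proof -
      from that obtain y where "y \<in> B" "x = chart_inv c y" by blast
      moreover obtain x' where "x' \<in> fst c" "y = snd c x'" using B(2) \<open>y \<in> B\<close> by blast
      ultimately show ?thesis using c by simp
    qed
    then have "fst d = (fst d \<inter> fst c) \<union> (fst d \<inter> (topspace (mtop M) - chart_inv c ` B))"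
      using chart_sub[OF d] by blast
    then show ?thesis by (metis image_Un)
  qed
  let ?G = "\<lambda>z. (transition d c (fst z), frechet_derivative (transition d c) (at (fst z)) (snd z))"
  have 1: "continuous_on (?O1 \<times> UNIV) (\<lambda>z. ?F (tparam M d z))"
  proof (rule continuous_on_eq)
    show "continuous_on (?O1 \<times> UNIV) (\<lambda>z. \<psi> (?G z))"
    proof (rule continuous_on_compose2[OF \<psi>(1) continuous_coord_change[OF d c]])
      show "?G ` (?O1 \<times> UNIV) \<subseteq> snd c ` fst c \<times> UNIV"
      proof
        fix z assume "z \<in> ?G ` (?O1 \<times> UNIV)"
        then obtain x w where "x \<in> fst d" "x \<in> fst c" "z = ?G (snd d x, w)" by blast
        then show "z \<in> snd c ` fst c \<times> UNIV" using d by (simp add: transition_chart)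
      qed
    qed
    fix z assume "z \<in> ?O1 \<times> (UNIV :: 'e set)"
    then obtain x w where "x \<in> fst d" "x \<in> fst c" "z = (snd d x, w)" by blast
    then show "\<psi> (?G z) = ?F (tparam M d z)"
      using c d by (simp add: tparam_def transition_chart tvec_coord)
  qed
  have 2: "continuous_on (?O2 \<times> UNIV) (\<lambda>z. ?F (tparam M d z))"
  proof (rule continuous_on_eq)
    fix z assume "z \<in> ?O2 \<times> (UNIV :: 'e set)"
    then obtain x w where x: "x \<in> fst d" "x \<notin> chart_inv c ` B" and z: "z = (snd d x, w)" by blast
    have "snd c x \<notin> B" if "x \<in> fst c"
      using x(2) that chart_inv_chart[OF c that] by (metis imageI)
    then show "0 = ?F (tparam M d z)"
      using \<psi>(2) d x z by (simp add: tparam_def)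
  qed simp
  have "continuous_on (?O1 \<times> UNIV \<union> ?O2 \<times> UNIV) (\<lambda>z. ?F (tparam M d z))"
    using chart_image_openin[OF d] chart_openin[OF c] op
    by (intro continuous_on_open_Un 1 2 open_Times) auto
  then show "continuous_on (snd d ` fst d \<times> UNIV) (\<lambda>z. ?F (tparam M d z))"
    unfolding cover by (simp add: Sigma_Un_distrib1)
qed

text \<open>The bump, its products with the base coordinates and its products with the fibre
  coordinates suffice. Only \<open>p\<close> is assumed to lie over \<open>N\<close>: equality of
  the positive bump values forces \<open>q\<close> into the same chart, and dividing by the bump
  recovers all coordinates.\<close>

lemma TM_separating_local:
  assumes x: "x \<in> topspace (mtop M)"
  shows "\<exists>N. openin (mtop M) N \<and> x \<in> N \<and> (\<exists>\<Phi>. finite \<Phi> \<and>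
    (\<forall>f\<in>\<Phi>. continuous_map TMtop euclideanreal f) \<and>
    (\<forall>p\<in>TM M. \<forall>q\<in>TM M. fst p \<in> N \<longrightarrow> (\<forall>f\<in>\<Phi>. f p = f q) \<longrightarrow> p = q))"
proof -
  obtain c where c: "c \<in> atlas M" "x \<in> fst c" using charts_cover x by blast
  obtain r where r: "r > 0" "cball (snd c x) r \<subseteq> snd c ` fst c" using chart_cball[OF c] by blast
  define ext :: "('e \<times> 'e \<Rightarrow> real) \<Rightarrow> 'a \<times> ('a, 'e) tvector \<Rightarrow> real"
    where "ext \<psi> p = (if fst p \<in> fst c then \<psi> (snd c (fst p), snd p c) else 0)" for \<psi> p
  define bump :: "'e \<times> 'e \<Rightarrow> real" where "bump z = max 0 (r - dist (snd c x) (fst z))" for z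
  define \<Phi> where "\<Phi> = {ext bump} \<union> (\<lambda>b. ext (\<lambda>z. bump z * (fst z \<bullet> b))) ` Basis
      \<union> (\<lambda>b. ext (\<lambda>z. bump z * (snd z \<bullet> b))) ` Basis"
  define N where "N = {y \<in> fst c. snd c y \<in> ball (snd c x) r}"
  have bump_cont: "continuous_on S bump" for S unfolding bump_def by (intro continuous_intros)
  have bump_0: "bump (y, w) = 0" if "y \<notin> cball (snd c x) r" for y w
    using that by (simp add: bump_def)
  have cont: "continuous_map TMtop euclideanreal (ext \<psi>)"
    if "continuous_on UNIV \<psi>" "\<And>y w. y \<notin> cball (snd c x) r \<Longrightarrow> \<psi> (y, w) = 0" for \<psi>
    unfolding ext_def using that r(2)
    by (intro extend_by_zero_continuous[OF c(1) compact_cball]) (auto intro: continuous_on_subset)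
  have "p = q" if p: "p \<in> TM M" "fst p \<in> N" and q: "q \<in> TM M" and eq: "\<forall>f\<in>\<Phi>. f p = f q" for p q
  proof -
    have pc: "fst p \<in> fst c" "bump (snd c (fst p), w) > 0" for w
      using p(2) by (simp_all add: N_def bump_def)
    have ext_eq: "ext bump p = ext bump q" using eq by (simp add: \<Phi>_def)
    moreover have "ext bump p > 0" using pc by (simp add: ext_def)
    ultimately have "ext bump q > 0" by simp
    then have qc: "fst q \<in> fst c" by (rule contrapos_pp) (simp add: ext_def)
    then have bump_eq: "bump (snd c (fst p), snd p c) = bump (snd c (fst q), snd q c)"
      using ext_eq pc(1) by (simp add: ext_def)
    have *: "(\<psi> (snd c (fst p), snd p c) :: real) = \<psi> (snd c (fst q), snd q c)"
      if "ext (\<lambda>z. bump z * \<psi> z) p = ext (\<lambda>z. bump z * \<psi> z) q" for \<psi>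
      using that pc(1) qc bump_eq pc(2)[of "snd p c"] by (simp add: ext_def)
    have "snd c (fst p) = snd c (fst q)"
    proof (rule euclidean_eqI)
      fix b :: 'e assume "b \<in> Basis"
      then show "snd c (fst p) \<bullet> b = snd c (fst q) \<bullet> b"
        using eq *[of "\<lambda>z. fst z \<bullet> b"] by (simp add: \<Phi>_def)
    qed
    moreover have "snd p c = snd q c"
    proof (rule euclidean_eqI)
      fix b :: 'e assume "b \<in> Basis"
      then show "snd p c \<bullet> b = snd q c \<bullet> b"
        using eq *[of "\<lambda>z. snd z \<bullet> b"] by (simp add: \<Phi>_def)
    qed
    ultimately show ?thesis using TM_cases[OF p(1) c(1) pc(1)] TM_cases[OF q c(1) qc] by simp
  qed
  moreover have "openin (mtop M) N" unfolding N_def by (rule chart_nbhd[OF c(1)]) simp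
  moreover have "x \<in> N" using c r(1) by (simp add: N_def)
  moreover have "finite \<Phi>" by (simp add: \<Phi>_def)
  moreover have "\<forall>f\<in>\<Phi>. continuous_map TMtop euclideanreal f"
    unfolding \<Phi>_def using bump_0
    by (auto intro!: cont continuous_intros bump_cont)
  ultimately show ?thesis by (intro exI[of _ N]) blast
qed

lemma TM_separating:
  obtains \<phi> :: "nat \<Rightarrow> 'a \<times> ('a, 'e) tvector \<Rightarrow> real"
  where "\<And>i. continuous_map TMtop euclideanreal (\<phi> i)" "\<And>i p. 0 \<le> \<phi> i p \<and> \<phi> i p < 1"
    "\<And>p q. p \<in> topspace TMtop \<Longrightarrow> q \<in> topspace TMtop \<Longrightarrow> (\<And>i. \<phi> i p = \<phi> i q) \<Longrightarrow> p = q"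
proof -
  have "\<forall>x\<in>topspace (mtop M). \<exists>N. openin (mtop M) N \<and> x \<in> N \<and> (\<exists>\<Phi>. finite \<Phi> \<and>
    (\<forall>f\<in>\<Phi>. continuous_map TMtop euclideanreal f) \<and>
    (\<forall>p\<in>TM M. \<forall>q\<in>TM M. fst p \<in> N \<longrightarrow> (\<forall>f\<in>\<Phi>. f p = f q) \<longrightarrow> p = q))"
    by (rule ballI[OF TM_separating_local])
  from finite_open_cover[OF this] obtain F where F: "finite F" "topspace (mtop M) \<subseteq> \<Union>F" "\<forall>N\<in>F. \<exists>\<Phi>.
    finite \<Phi> \<and>
    (\<forall>f\<in>\<Phi>. continuous_map TMtop euclideanreal f) \<and>
    (\<forall>p\<in>TM M. \<forall>q\<in>TM M. fst p \<in> N \<longrightarrow> (\<forall>f\<in>\<Phi>. f p = f q) \<longrightarrow> p = q)"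
    by blast
  from bchoice[OF F(3)] obtain \<Phi> where \<Phi>: "\<forall>N\<in>F. finite (\<Phi> N) \<and>
    (\<forall>f\<in>\<Phi> N. continuous_map TMtop euclideanreal f) \<and>
    (\<forall>p\<in>TM M. \<forall>q\<in>TM M. fst p \<in> N \<longrightarrow> (\<forall>f\<in>\<Phi> N. f p = f q) \<longrightarrow> p = q)" ..
  \<comment> \<open>The zero function keeps the set nonempty, so that \<open>from_nat_into\<close>
    lists exactly its elements, with repetitions: the curve expects a sequence of
    coordinates.\<close>
  define \<Psi> where "\<Psi> = insert (\<lambda>_. 0) (\<Union> (\<Phi> ` F))"
  have fin: "finite \<Psi>" unfolding \<Psi>_def using F(1) \<Phi> by blast
  have \<Psi>_cont: "continuous_map TMtop euclideanreal f" if "f \<in> \<Psi>" for f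
  proof -
    from that consider "f = (\<lambda>_. 0)" | N where "N \<in> F" "f \<in> \<Phi> N" unfolding \<Psi>_def by blast
    then show ?thesis
    proof cases
      case 2 then show ?thesis using \<Phi> by blast
    qed simp
  qed
  have sep: "p = q" if p: "p \<in> TM M" "q \<in> TM M" "\<And>f. f \<in> \<Psi> \<Longrightarrow> f p = f q" for p q
  proof -
    have "fst p \<in> topspace (mtop M)" using p(1) by (auto simp: TM_def)
    then obtain N where N: "N \<in> F" "fst p \<in> N" using F(2) by blast
    have "\<forall>f\<in>\<Phi> N. f p = f q" using p(3) N(1) unfolding \<Psi>_def by blast
    moreover have "\<forall>p\<in>TM M. \<forall>q\<in>TM M. fst p \<in> N \<longrightarrow> (\<forall>f\<in>\<Phi> N. f p = f q) \<longrightarrow> p = q"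
      using \<Phi> N(1) by blast
    ultimately show ?thesis using p(1,2) N(2) by blast
  qed
  have ran: "range (from_nat_into \<Psi>) = \<Psi>"
    using fin by (intro range_from_nat_into) (auto simp: \<Psi>_def countable_finite)
  show ?thesis
  proof (rule that[of "\<lambda>i p. 1/2 + arctan (from_nat_into \<Psi> i p) / pi"])
    fix i
    have "continuous_map TMtop euclideanreal (from_nat_into \<Psi> i)" using \<Psi>_cont ran by blast
    moreover have "continuous_map euclideanreal euclideanreal (\<lambda>t. 1/2 + arctan t / pi)"
      by (auto intro!: continuous_intros)
    ultimately show "continuous_map TMtop euclideanreal (\<lambda>p. 1/2 +
      arctan (from_nat_into \<Psi> i p) / pi)"
      using continuous_map_compose[of TMtop euclideanreal "from_nat_into \<Psi> i" euclideanreal "\<lambda>t.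
        1/2 + arctan t / pi"]
      by (simp add: o_def)
  next
    fix p q assume p: "p \<in> topspace TMtop" "q \<in> topspace TMtop"
      and eq: "\<And>i. 1/2 + arctan (from_nat_into \<Psi> i p) / pi = 1/2 +
        arctan (from_nat_into \<Psi> i q) / pi"
    show "p = q"
    proof (rule sep)
      fix f assume "f \<in> \<Psi>"
      then obtain i where "f = from_nat_into \<Psi> i" using ran by blast
      then show "f p = f q" using arctan_squash_inj[OF eq[of i]] by simp
    qed (use p in \<open>simp_all add: topspace_TM\<close>)
  qed (rule arctan_squash)
qed

end

section \<open>Mather's beta-function under a nonpositive potential\<close>

context closed_riemannian
begin

text \<open>The vectors of norm at most 0 form the zero section, a compact copy of the base.
  Compactness in the bundle thus also bounds functions of the base point.\<close>

lemma Ck_fun_bounded: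
  assumes "Ck_fun k M V" obtains b where "\<And>p. p \<in> TM M \<Longrightarrow> \<bar>V (fst p)\<bar> \<le> b"
proof -
  have "compact ((\<lambda>p. V (fst p)) ` {p \<in> TM M. tnorm g p \<le> 0})"
    using image_compactin[OF compact_tnorm_le Ck_fun_lift_continuous[OF assms]] by simp
  from compact_imp_bounded[OF this]
  obtain b where b: "\<forall>y\<in>(\<lambda>p. V (fst p)) ` {p \<in> TM M. tnorm g p \<le> 0}. norm y \<le> b"
    unfolding bounded_iff by blast
  show ?thesis
  proof (rule that)
    fix p assume p: "p \<in> TM M"
    obtain c where c: "c \<in> atlas M" "fst p \<in> fst c" using TM_chart[OF p] by blast
    let ?q = "(fst p, tvec M c (fst p) 0)"
    have "?q \<in> TM M" using c by (simp add: TM_iff tvec_in chart_sub)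
    moreover have "tnorm g ?q = 0" using tnorm_scale[OF c, of 0 0] by simp
    ultimately have "V (fst ?q) \<in> (\<lambda>p. V (fst p)) ` {p \<in> TM M. tnorm g p \<le> 0}"
      by (intro image_eqI[of _ _ ?q]) simp_all
    from bspec[OF b this] show "\<bar>V (fst p)\<bar> \<le> b" by simp
  qed
qed

section \<open>Lower bounds for Tonelli Lagrangians\<close>

lemma tonelli_superlinear:
  assumes "tonelli M g L"
  shows "\<exists>R. \<forall>p\<in>topspace TMtop. R \<le> tnorm g p \<longrightarrow> K * tnorm g p \<le> L p"
proof -
  obtain R where R: "R > 0" "\<forall>p\<in>TM M. tnorm g p \<ge> R \<longrightarrow> L p / tnorm g p \<ge> K"
    using assms unfolding tonelli_def by blast
  have "K * tnorm g p \<le> L p" if p: "p \<in> TM M" "R \<le> tnorm g p" for p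
  proof -
    have "K \<le> L p / tnorm g p" using R(2) p by blast
    then show ?thesis using R(1) p(2) by (simp add: field_simps)
  qed
  then show ?thesis by (intro exI[of _ R]) (simp add: topspace_TM)
qed

lemma tonelli_continuous: "tonelli M g L \<Longrightarrow> continuous_map TMtop euclideanreal L"
  by (intro Ck_fun_TM_continuous[of 2]) (simp add: tonelli_def)

lemma tonelli_bounded_below:
  assumes L: "tonelli M g L" obtains b where "\<And>p. p \<in> TM M \<Longrightarrow> b \<le> L p"
proof -
  obtain R where R: "\<And>p. p \<in> TM M \<Longrightarrow> R \<le> tnorm g p \<Longrightarrow> 0 * tnorm g p \<le> L p"
    using tonelli_superlinear[OF L, of 0] unfolding topspace_TM by blast
  have "compact (L ` {p \<in> TM M. tnorm g p \<le> R})"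
    using image_compactin[OF compact_tnorm_le tonelli_continuous[OF L]] by simp
  from compact_imp_bounded[OF this]
  obtain b where b: "\<forall>y\<in>L ` {p \<in> TM M. tnorm g p \<le> R}. norm y \<le> b"
    unfolding bounded_iff by blast
  show ?thesis
  proof (rule that)
    fix p assume p: "p \<in> TM M"
    show "- \<bar>b\<bar> \<le> L p"
    proof (cases "tnorm g p \<le> R")
      case True
      then have "L p \<in> L ` {p \<in> TM M. tnorm g p \<le> R}" using p by blast
      from bspec[OF b this] show ?thesis by (simp add: abs_if split: if_splits)
    next
      case False then show ?thesis using R[OF p] by simp
    qed
  qed
qed

section \<open>Measures of finite action\<close>

lemma finite_action_borel:
  "\<mu> \<in> finite_action M g L h \<Longrightarrow> borel_probability TMtop \<mu>"
  by (simp add: finite_action_def rotation_fibre_def closed_measures_def)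

lemma finite_action_integrable: "\<mu> \<in> finite_action M g L h \<Longrightarrow> integrable \<mu> L"
  by (simp add: finite_action_def)

lemma bounded_integrable:
  assumes \<mu>: "borel_probability TMtop \<mu>" and f: "continuous_map TMtop euclideanreal f"
    and b: "\<And>p. p \<in> TM M \<Longrightarrow> \<bar>f p\<bar> \<le> b"
  shows "integrable \<mu> f"
proof -
  interpret prob_space \<mu> using \<mu> by (simp add: borel_probability_def)
  have "space \<mu> = TM M" using \<mu> by (simp add: borel_probability_def topspace_TM)
  then show ?thesis using b by (intro integrable_const_bound[where B=b]
    borel_probability_measurable[OF \<mu> f]) auto
qed

lemma potential_integrable:
  assumes "borel_probability TMtop \<mu>" "Ck_fun k M V" shows "integrable \<mu> (\<lambda>p. V (fst p))"
  using Ck_fun_bounded[OF assms(2)] bounded_integrable[OF assms(1) Ck_fun_lift_continuous[OF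
    assms(2)]]
  by metis

lemma add_potential_eq: "add_potential L V = (\<lambda>p. L p + V (fst p))"
  by (simp add: add_potential_def fun_eq_iff)

text \<open>A bounded potential does not affect integrability, so both beta-functions are infima
  over the same set of measures.\<close>

lemma finite_action_add_potential:
  assumes V: "Ck_fun k M V"
  shows "finite_action M g (add_potential L V) h = finite_action M g L h"
proof -
  have "integrable \<mu> (add_potential L V) \<longleftrightarrow> integrable \<mu> L" if "\<mu> \<in> rotation_fibre M g h" for \<mu>
  proof -
    have V_int: "integrable \<mu> (\<lambda>p. V (fst p))"
      using that potential_integrable[OF _ V] by (simp add: rotation_fibre_def closed_measures_def)
    show ?thesis
    proof
      assume "integrable \<mu> (add_potential L V)"
      then have "integrable \<mu> (\<lambda>p. (L p + V (fst p)) - V (fst p))"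
        unfolding add_potential_eq by (intro Bochner_Integration.integrable_diff V_int)
      then show "integrable \<mu> L" by simp
    next
      assume "integrable \<mu> L"
      then show "integrable \<mu> (add_potential L V)"
        unfolding add_potential_eq by (intro Bochner_Integration.integrable_add V_int)
    qed
  qed
  then show ?thesis by (auto simp: finite_action_def)
qed

lemma integral_add_potential:
  assumes "Ck_fun k M V" "\<mu> \<in> finite_action M g L h"
  shows "(\<integral>p. add_potential L V p \<partial>\<mu>) = (\<integral>p. L p \<partial>\<mu>) + (\<integral>p. V (fst p) \<partial>\<mu>)"
  unfolding add_potential_eq
  by (intro Bochner_Integration.integral_add finite_action_integrable[OF assms(2)]
      potential_integrable[OF finite_action_borel[OF assms(2)] assms(1)])

lemma integral_potential_le_0:
  fixes V :: "'a \<Rightarrow> real"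
  assumes "borel_probability TMtop \<mu>" "\<forall>x\<in>topspace (mtop M). V x \<le> 0"
  shows "(\<integral>p. V (fst p) \<partial>\<mu>) \<le> 0"
proof -
  have "0 \<le> (\<integral>p. - V (fst p) \<partial>\<mu>)"
  proof (rule Bochner_Integration.integral_nonneg)
    fix p assume "p \<in> space \<mu>"
    then have "p \<in> TM M" using assms(1) by (simp add: borel_probability_def topspace_TM)
    then have "fst p \<in> topspace (mtop M)" by (auto simp: TM_def)
    then show "0 \<le> - V (fst p)" using assms(2) by simp
  qed
  then show ?thesis by simp
qed

lemma action_bdd_below:
  assumes L: "tonelli M g L" and V: "Ck_fun k M V"
  shows "bdd_below ((\<lambda>\<mu>. \<integral>p. add_potential L V p \<partial>\<mu>) ` finite_action M g L h)"
proof -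
  obtain b where b: "\<And>p. p \<in> TM M \<Longrightarrow> b \<le> L p" using tonelli_bounded_below[OF L] by blast
  obtain b' where b': "\<And>p. p \<in> TM M \<Longrightarrow> \<bar>V (fst p)\<bar> \<le> b'" using Ck_fun_bounded[OF V] by blast
  show ?thesis
  proof (rule bdd_belowI2[of _ "b - b'"])
    fix \<mu> assume \<mu>: "\<mu> \<in> finite_action M g L h"
    note bp = finite_action_borel[OF \<mu>]
    interpret prob_space \<mu> using bp by (simp add: borel_probability_def)
    have "(\<integral>p. b - b' \<partial>\<mu>) \<le> (\<integral>p. add_potential L V p \<partial>\<mu>)"
    proof (rule integral_mono)
      show "integrable \<mu> (add_potential L V)"
        using \<mu> finite_action_add_potential[OF V] finite_action_integrable by blast
      fix p assume "p \<in> space \<mu>"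
      then have "p \<in> TM M" using bp by (simp add: borel_probability_def topspace_TM)
      from b[OF this] b'[OF this] show "b - b' \<le> add_potential L V p"
        by (simp add: add_potential_eq)
    qed simp
    then show "b - b' \<le> (\<integral>p. add_potential L V p \<partial>\<mu>)" by (simp add: prob_space)
  qed
qed

text \<open>With the zero potential, statements about \<open>add_potential L V\<close> specialise to
  \<open>L\<close> itself.\<close>

lemma Ck_fun_zero: "Ck_fun k M (\<lambda>_. 0)"
proof -
  have "Ck_on k S (\<lambda>_. 0 :: real)" for S :: "'e set"
    by (induction k) (simp_all add: frechet_derivative_const)
  then show ?thesis by (simp add: Ck_fun_def o_def)
qed

lemma add_potential_zero: "add_potential L (\<lambda>_. 0) = L"
  by (simp add: add_potential_eq)

lemma mather_beta_le:
  assumes "tonelli M g L" "Ck_fun k M V" "\<mu> \<in> finite_action M g L h"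
  shows "mather_beta M g (add_potential L V) h \<le> (\<integral>p. add_potential L V p \<partial>\<mu>)"
  unfolding mather_beta_def finite_action_add_potential[OF assms(2)]
  by (rule cINF_lower[OF action_bdd_below[OF assms(1,2)] assms(3)])

lemmas mather_beta_le' = mather_beta_le[OF _ Ck_fun_zero, unfolded add_potential_zero]

theorem mather_beta_add_potential_le:
  assumes L: "tonelli M g L" and V: "Ck_fun k M V" "\<forall>x\<in>topspace (mtop M). V x \<le> 0"
  shows "mather_beta M g (add_potential L V) h \<le> mather_beta M g L h"
proof (cases "finite_action M g L h = {}")
  \<comment> \<open>Both sides are the infimum of the empty set of reals, hence the same default
    value.\<close>
  case True
  then show ?thesis by (simp add: mather_beta_def finite_action_add_potential[OF V(1)])
next
  case False
  have "mather_beta M g (add_potential L V) h \<le> (\<integral>p. L p \<partial>\<mu>)" if "\<mu> \<in> finite_action M g L h" for \<mu>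
    using mather_beta_le[OF L V(1) that] integral_add_potential[OF V(1) that]
      integral_potential_le_0[OF finite_action_borel[OF that] V(2)] by simp
  then show ?thesis
    unfolding mather_beta_def[of M g L] using False by (intro cINF_greatest) auto
qed

theorem mather_measures_nonempty:
  assumes L: "tonelli M g L" and ne: "finite_action M g L h \<noteq> {}"
  shows "mather_measures M g L h \<noteq> {}"
proof -
  \<comment> \<open>One index set for both families of linear constraints: differentials with
    right-hand side 0 and closed forms with right-hand side the pairing with
    \<open>h\<close>.\<close>
  define I where "I = Inl ` {f. Ck_fun 1 M f} \<union> Inr ` {\<eta>. closed_form M \<eta>}"
  define F where "F = (\<lambda>i. case i of Inl f \<Rightarrow> mdiff M f | Inr \<eta> \<Rightarrow> \<eta>)"
  define a :: "('a \<Rightarrow> real) + ('a \<times> ('a, 'e) tvector \<Rightarrow> real) \<Rightarrow> real"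
    where "a = (\<lambda>i. case i of Inl f \<Rightarrow> 0 | Inr \<eta> \<Rightarrow> pairing M \<eta> h)"
  have form: "continuous_form M (F i)" if "i \<in> I" for i
    using that mdiff_continuous_form smooth_imp_continuous_form
    unfolding I_def F_def closed_form_def by (auto split: sum.splits)
  have S: "finite_action M g L h = {\<mu>. borel_probability TMtop \<mu> \<and> integrable \<mu> (tnorm g) \<and>
        (\<forall>i\<in>I. (\<integral>p. F i p \<partial>\<mu>) = a i) \<and> integrable \<mu> L}"
    unfolding finite_action_def rotation_fibre_def closed_measures_def I_def F_def a_def
    by (auto simp: ball_Un)
  obtain \<phi> :: "nat \<Rightarrow> 'a \<times> ('a, 'e) tvector \<Rightarrow> real"
    where \<phi>: "\<And>i. continuous_map TMtop euclideanreal (\<phi> i)" "\<And>i p. 0 \<le> \<phi> i p \<and> \<phi> i p < 1"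
      "\<And>p q. p \<in> topspace TMtop \<Longrightarrow> q \<in> topspace TMtop \<Longrightarrow> (\<And>i. \<phi> i p = \<phi> i q) \<Longrightarrow> p = q"
    using TM_separating by blast
  obtain \<mu> where \<mu>: "\<mu> \<in> finite_action M g L h"
    "\<And>\<nu>. \<nu> \<in> finite_action M g L h \<Longrightarrow> (\<integral>p. L p \<partial>\<mu>) \<le> (\<integral>p. L p \<partial>\<nu>)"
  proof (rule action_minimizer_exists[where X=TMtop and \<theta>="tnorm g" and L=L and f=F and I=I and a=a
        and S="finite_action M g L h" and \<phi>=\<phi>])
    show "p = q" if "p \<in> topspace TMtop" "q \<in> topspace TMtop" "\<And>i. \<phi> i p = \<phi> i q" for p q
      using that by (rule \<phi>(3))
    show "\<exists>C\<ge>0. \<forall>p\<in>topspace TMtop. \<bar>F i p\<bar> \<le> C * tnorm g p" if "i \<in> I" for i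
      using continuous_form_bound[OF form[OF that]] by (simp add: topspace_TM)
    show "compactin TMtop {p \<in> topspace TMtop. tnorm g p \<le> R}" for R
      using compact_tnorm_le by (simp add: topspace_TM)
    show "0 \<le> tnorm g p" if "p \<in> topspace TMtop" for p
      using that tnorm_nonneg by (simp add: topspace_TM)
  qed (use \<phi>(1,2) continuous_tnorm[OF riemannian] tonelli_continuous[OF L] tonelli_superlinear[OF L]
      continuous_form_continuous[OF form] S ne in \<open>assumption | blast\<close>)+
  have "(\<integral>p. L p \<partial>\<mu>) = mather_beta M g L h"
  proof (rule antisym)
    show "(\<integral>p. L p \<partial>\<mu>) \<le> mather_beta M g L h"
      unfolding mather_beta_def using ne \<mu>(2) by (rule cINF_greatest)
  qed (rule mather_beta_le'[OF L \<mu>(1)])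
  then show ?thesis using \<mu>(1) by (auto simp: mather_measures_def)
qed

text \<open>The set where \<open>V < 0\<close> is covered by countably many compact sets; each of them is covered by
  finitely many null open sets if \<open>V\<close> vanishes on the support.\<close>

lemma integral_potential_zero_if_support:
  assumes \<mu>: "borel_probability TMtop \<mu>" and V: "Ck_fun k M V" "\<forall>x\<in>topspace (mtop M). V x \<le> 0"
    and supp: "\<And>p. p \<in> msupport TMtop \<mu> \<Longrightarrow> V (fst p) = 0"
  shows "(\<integral>p. V (fst p) \<partial>\<mu>) = 0"
proof -
  have space: "space \<mu> = TM M" using \<mu> by (simp add: borel_probability_def topspace_TM)
  note Vc = Ck_fun_lift_continuous[OF V(1)]
  define K where "K n = {p \<in> TM M. tnorm g p \<le> real n} \<inter> {p \<in> TM M. V (fst p) \<le>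
    - 1 / real (Suc n)}" for n
  have "closedin TMtop {p \<in> topspace TMtop. V (fst p) \<in> {..- 1 / real (Suc n)}}" for n
    by (rule closedin_continuous_map_preimage[OF Vc]) simp
  then have K: "compactin TMtop (K n)" for n
    unfolding K_def using closed_Int_compactin[OF _ compact_tnorm_le]
    by (subst Int_commute) (simp add: topspace_TM)
  have null: "K n \<in> null_sets \<mu>" for n
  proof -
    let ?U = "{W. openin TMtop W \<and> emeasure \<mu> W = 0}"
    have "K n \<subseteq> \<Union>?U"
    proof
      fix p assume p: "p \<in> K n"
      then have "p \<in> topspace TMtop" "V (fst p) \<le> - 1 / real (Suc n)"
        unfolding K_def topspace_TM by blast+
      moreover have "- 1 / real (Suc n) < 0" by simp
      ultimately have "V (fst p) \<noteq> 0" by linarith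
      then have "p \<notin> msupport TMtop \<mu>" using supp[of p] by blast
      then obtain W where "openin TMtop W" "p \<in> W" "\<not> emeasure \<mu> W > 0"
        using \<open>p \<in> topspace TMtop\<close> unfolding msupport_def by blast
      then show "p \<in> \<Union>?U" by (auto simp: zero_less_iff_neq_zero)
    qed
    then obtain F where F: "finite F" "F \<subseteq> ?U" "K n \<subseteq> \<Union>F"
      using compactinD[OF K, of ?U n] by blast
    have "\<Union>F \<in> null_sets \<mu>"
    proof (rule null_sets_UN'[of F "\<lambda>W. W", simplified])
      show "countable F" using F(1) by (rule countable_finite)
      fix W assume "W \<in> F"
      then show "W \<in> null_sets \<mu>" using F(2) borel_probability_sets_openin[OF \<mu>]
        by (auto intro: null_setsI)
    qed
    moreover have "K n \<in> sets \<mu>"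
    proof -
      have "K n = {p \<in> space \<mu>. tnorm g p \<le> real n \<and> V (fst p) \<le> - 1 / real (Suc n)}"
        by (auto simp: K_def space)
      also have "\<dots> \<in> sets \<mu>"
        using borel_probability_measurable[OF \<mu> Vc]
          borel_probability_measurable[OF \<mu> continuous_tnorm[OF riemannian]] by measurable
      finally show ?thesis .
    qed
    ultimately show ?thesis using F(3) null_sets_subset by blast
  qed
  have "AE p in \<mu>. V (fst p) = 0"
  proof (rule AE_I')
    show "(\<Union>n. K n) \<in> null_sets \<mu>" by (rule null_sets_UN) (rule null)
    show "{p \<in> space \<mu>. V (fst p) \<noteq> 0} \<subseteq> (\<Union>n. K n)"
    proof
      fix p assume p: "p \<in> {p \<in> space \<mu>. V (fst p) \<noteq> 0}"
      then have pT: "p \<in> TM M" by (simp add: space)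
      then have "fst p \<in> topspace (mtop M)" by (auto simp: TM_def)
      then have neg: "V (fst p) < 0" using bspec[OF V(2), of "fst p"] p by auto
      obtain n1 :: nat where n1: "tnorm g p \<le> real n1" using real_arch_simple by blast
      obtain n2 :: nat where n2: "1 / real (Suc n2) < - V (fst p)"
        using nat_approx_posE[of "- V (fst p)"] neg by auto
      define n where "n = max n1 n2"
      have "1 / real (Suc n) \<le> 1 / real (Suc n2)" by (intro divide_left_mono) (auto simp: n_def)
      then have "V (fst p) \<le> - 1 / real (Suc n)" using n2 by simp
      moreover have "tnorm g p \<le> real n" using n1 by (simp add: n_def)
      ultimately have "p \<in> K n" using pT unfolding K_def by blast
      then show "p \<in> (\<Union>n. K n)" by blast
    qed
  qed
  then show ?thesis using integral_cong_AE[of "\<lambda>p. V (fst p)" \<mu> "\<lambda>_. 0"]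
      borel_probability_measurable[OF \<mu> Vc] by simp
qed

text \<open>A nonnegative function with integral 0 vanishes almost everywhere, so the open set where
  \<open>V < 0\<close> is null; an open set that meets the support has positive measure.\<close>

lemma potential_zero_on_support:
  assumes \<mu>: "borel_probability TMtop \<mu>" and V: "Ck_fun k M V" "\<forall>x\<in>topspace (mtop M). V x \<le> 0"
    and int: "(\<integral>p. V (fst p) \<partial>\<mu>) = 0" and p: "p \<in> msupport TMtop \<mu>"
  shows "V (fst p) = 0"
proof (rule ccontr)
  assume "V (fst p) \<noteq> 0"
  have pT: "p \<in> topspace TMtop" using p by (simp add: msupport_def)
  then have "fst p \<in> topspace (mtop M)" by (auto simp: TM_def topspace_TM)
  with \<open>V (fst p) \<noteq> 0\<close> have neg: "V (fst p) < 0" using bspec[OF V(2), of "fst p"] by linarith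
  have space: "space \<mu> = topspace TMtop" using \<mu> by (simp add: borel_probability_def)
  note Vc = Ck_fun_lift_continuous[OF V(1)]
  have "AE q in \<mu>. - V (fst q) = 0"
  proof (subst integral_nonneg_eq_0_iff_AE[symmetric])
    show "integrable \<mu> (\<lambda>q. - V (fst q))" using potential_integrable[OF \<mu> V(1)] by simp
    show "AE q in \<mu>. 0 \<le> - V (fst q)"
    proof (rule AE_I2)
      fix q assume "q \<in> space \<mu>"
      then have "fst q \<in> topspace (mtop M)" by (auto simp: TM_def topspace_TM space)
      then show "0 \<le> - V (fst q)" using V(2) by simp
    qed
  qed (use int in simp)
  then have AE: "AE q in \<mu>. q \<notin> {q \<in> topspace TMtop. V (fst q) \<in> {..<0}}" by eventually_elim simp
  have op: "openin TMtop {q \<in> topspace TMtop. V (fst q) \<in> {..<0}}"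
    by (rule openin_continuous_map_preimage[OF Vc]) simp
  have "emeasure \<mu> {q \<in> topspace TMtop. V (fst q) \<in> {..<0}} = 0"
    using AE_iff_measurable[OF borel_probability_sets_openin[OF \<mu> op], of "\<lambda>q. q \<notin> {q \<in>
      topspace TMtop. V (fst q) \<in> {..<0}}"]
      AE space by auto
  moreover have "emeasure \<mu> {q \<in> topspace TMtop. V (fst q) \<in> {..<0}} > 0"
    using p op pT neg unfolding msupport_def by blast
  ultimately show False by simp
qed

text \<open>Let \<mu> minimize the action of \<open>L\<close>. Equal beta-values squeeze the
  integral of \<open>V\<close>: its action for L + V is at least the common value and equals that
  value plus the integral, which is at most 0. So the integral is 0, \<mu> minimizes for L + V too,
  and \<open>V\<close> vanishes on its support. The zero set of \<open>V\<close> is closed and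
  therefore contains the whole Mather set, closure included.\<close>

theorem mather_beta_add_potential_eq_iff:
  assumes L: "tonelli M g L" and V: "Ck_fun k M V" "\<forall>x\<in>topspace (mtop M). V x \<le> 0"
  shows "mather_beta M g (add_potential L V) h = mather_beta M g L h \<longleftrightarrow>
    mather_measures M g L h \<subseteq> mather_measures M g (add_potential L V) h \<and>
    mather_set M g L h \<subseteq> mather_set M g (add_potential L V) h \<and>
    (\<forall>(x, v)\<in>mather_set M g L h. V x = 0)"
    (is "?eq \<longleftrightarrow> ?meas \<and> ?set \<and> ?zero")
proof
  assume eq: ?eq
  have *: "\<mu> \<in> mather_measures M g (add_potential L V) h \<and> (\<integral>p. V (fst p) \<partial>\<mu>) = 0"
    if "\<mu> \<in> mather_measures M g L h" for \<mu>
  proof -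
    have \<mu>: "\<mu> \<in> finite_action M g L h" "(\<integral>p. L p \<partial>\<mu>) = mather_beta M g L h"
      using that by (auto simp: mather_measures_def)
    have "(\<integral>p. V (fst p) \<partial>\<mu>) = 0"
      using mather_beta_le[OF L V(1) \<mu>(1)] integral_add_potential[OF V(1) \<mu>(1)] \<mu>(2) eq
        integral_potential_le_0[OF finite_action_borel[OF \<mu>(1)] V(2)] by simp
    then show ?thesis
      using \<mu> eq integral_add_potential[OF V(1) \<mu>(1)] finite_action_add_potential[OF V(1), of L h]
      by (simp add: mather_measures_def)
  qed
  then have meas: ?meas by blast
  then have ?set unfolding mather_set_def by (intro closure_of_mono) blast
  have "(\<Union>\<mu>\<in>mather_measures M g L h. msupport TMtop \<mu>) \<subseteq> {p \<in> topspace TMtop. V (fst p) \<in> {0}}"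
  proof
    fix p assume "p \<in> (\<Union>\<mu>\<in>mather_measures M g L h. msupport TMtop \<mu>)"
    then obtain \<mu> where \<mu>: "\<mu> \<in> mather_measures M g L h" "p \<in> msupport TMtop \<mu>" by blast
    then have "borel_probability TMtop \<mu>" by (auto simp: mather_measures_def intro:
      finite_action_borel)
    then have "V (fst p) = 0" using potential_zero_on_support[OF _ V _ \<mu>(2)] *[OF \<mu>(1)] by blast
    then show "p \<in> {p \<in> topspace TMtop. V (fst p) \<in> {0}}" using \<mu>(2) by (simp add: msupport_def)
  qed
  moreover have "closedin TMtop {p \<in> topspace TMtop. V (fst p) \<in> {0}}"
    by (rule closedin_continuous_map_preimage[OF Ck_fun_lift_continuous[OF V(1)]]) simp
  ultimately have "mather_set M g L h \<subseteq> {p \<in> topspace TMtop. V (fst p) \<in> {0}}"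
    unfolding mather_set_def by (rule closure_of_minimal)
  then have ?zero by auto
  with meas \<open>?set\<close> show "?meas \<and> ?set \<and> ?zero" by blast
next
  assume rhs: "?meas \<and> ?set \<and> ?zero"
  show ?eq
  proof (cases "finite_action M g L h = {}")
    case True
    then show ?thesis by (simp add: mather_beta_def finite_action_add_potential[OF V(1)])
  next
    case False
    \<comment> \<open>Existence of a minimizer is what gives the converse its content: with no
      Mather measure the right-hand side would hold vacuously.\<close>
    then obtain \<mu> where \<mu>: "\<mu> \<in> mather_measures M g L h" using mather_measures_nonempty[OF L]
      by blast
    then have fin: "\<mu> \<in> finite_action M g L h" and L_eq: "(\<integral>p. L p \<partial>\<mu>) = mather_beta M g L h"
      by (auto simp: mather_measures_def)
    have "\<mu> \<in> mather_measures M g (add_potential L V) h" using rhs \<mu> by blast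
    then have LV_eq: "(\<integral>p. add_potential L V p \<partial>\<mu>) = mather_beta M g (add_potential L V) h"
      by (simp add: mather_measures_def)
    have "(\<integral>p. V (fst p) \<partial>\<mu>) = 0"
    proof (rule integral_potential_zero_if_support[OF finite_action_borel[OF fin] V])
      fix p assume p: "p \<in> msupport TMtop \<mu>"
      have "(\<Union>\<mu>\<in>mather_measures M g L h. msupport TMtop \<mu>) \<subseteq> mather_set M g L h"
        unfolding mather_set_def by (rule closure_of_subset) (auto simp: msupport_def)
      then have "p \<in> mather_set M g L h" using p \<mu> by blast
      then show "V (fst p) = 0" using rhs by (auto simp: case_prod_beta)
    qed
    then show ?thesis using integral_add_potential[OF V(1) fin] L_eq LV_eq by simp
  qed
qed

end

section \<open>The torus as a closed manifold\<close>

lemma Ck_on_const: "Ck_on k S (\<lambda>_. c)"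
  by (induction k arbitrary: c) (simp_all add: frechet_derivative_const)

text \<open>The two functions have exactly the same derivatives at \<open>x\<close>, so the choice
  made by \<open>frechet_derivative\<close> agrees even where no derivative exists.\<close>

lemma frechet_derivative_cong_open:
  assumes "open S" "x \<in> S" "\<And>y. y \<in> S \<Longrightarrow> f y = g y"
  shows "frechet_derivative f (at x) = frechet_derivative g (at x)"
    and "f differentiable (at x) \<longleftrightarrow> g differentiable (at x)"
proof -
  have "(f has_derivative D) (at x) \<longleftrightarrow> (g has_derivative D) (at x)" for D
    using has_derivative_transform_within_open[OF _ assms(1,2), of f D UNIV g]
      has_derivative_transform_within_open[OF _ assms(1,2), of g D UNIV f] assms(3) by auto
  then show "frechet_derivative f (at x) = frechet_derivative g (at x)"
    and "f differentiable (at x) \<longleftrightarrow> g differentiable (at x)"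
    by (simp_all add: frechet_derivative_def differentiable_def)
qed

lemma Ck_on_cong_open:
  assumes "open S" "\<And>y. y \<in> S \<Longrightarrow> f y = g y"
  shows "Ck_on k S f \<longleftrightarrow> Ck_on k S g"
  using assms(2)
proof (induction k arbitrary: f g)
  case 0
  then show ?case by (simp cong: continuous_on_cong)
next
  case (Suc k)
  have "f differentiable (at x) \<longleftrightarrow> g differentiable (at x)" if "x \<in> S" for x
    by (rule frechet_derivative_cong_open(2)[OF assms(1) that Suc.prems])
  moreover have "Ck_on k S (\<lambda>x. frechet_derivative f (at x) v) \<longleftrightarrow>
    Ck_on k S (\<lambda>x. frechet_derivative g (at x) v)" for v
    by (rule Suc.IH) (simp add: frechet_derivative_cong_open(1)[OF assms(1) _ Suc.prems])
  ultimately show ?case by simp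
qed

text \<open>Every directional derivative is constant on \<open>S\<close>. This covers the transition
  maps of the torus, which are translations only locally.\<close>

lemma Ck_on_locally_translation:
  fixes f :: "'e::real_normed_vector \<Rightarrow> 'e"
  assumes "open S" and deriv: "\<And>x. x \<in> S \<Longrightarrow> (f has_derivative (\<lambda>w. w)) (at x)"
  shows "Ck_on k S f"
proof (cases k)
  case 0
  then show ?thesis using has_derivative_continuous[OF deriv]
    by (simp add: continuous_at_imp_continuous_on)
next
  case (Suc m)
  have "Ck_on m S (\<lambda>x. frechet_derivative f (at x) v)" for v
  proof (rule iffD1[OF Ck_on_cong_open[OF assms(1)] Ck_on_const[of m S v]])
    show "v = frechet_derivative f (at y) v" if "y \<in> S" for y
      using frechet_derivative_at[OF deriv[OF that]] by metis
  qed
  then show ?thesis using deriv by (auto simp: Suc differentiable_def)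
qed

section \<open>The integer lattice and the quotient topology\<close>

definition int_vec :: "real^'n \<Rightarrow> bool" where "int_vec k \<longleftrightarrow> (\<forall>i. k $ i \<in> \<int>)"

lemma int_vec_simps: "int_vec 0" "int_vec k \<Longrightarrow> int_vec (- k)" "int_vec k \<Longrightarrow> int_vec m \<Longrightarrow> int_vec (k +
  m)"
  "int_vec (axis i 1)"
  by (simp_all add: int_vec_def axis_def)

lemma torus_proj_eq_iff: "torus_proj x = torus_proj y \<longleftrightarrow> int_vec (y - x)"
proof
  assume "torus_proj x = torus_proj y"
  moreover have "y \<in> torus_proj y" by (simp add: torus_proj_def)
  ultimately have "y \<in> torus_proj x" by simp
  then show "int_vec (y - x)" by (simp add: torus_proj_def int_vec_def)
next
  assume k: "int_vec (y - x)"
  have "(z $ i - x $ i \<in> \<int>) \<longleftrightarrow> (z $ i - y $ i \<in> \<int>)" for z i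
  proof -
    have "y $ i - x $ i \<in> \<int>" using k by (simp add: int_vec_def)
    then show ?thesis
      using Ints_add[of "z $ i - y $ i" "y $ i - x $ i"] Ints_diff[of "z $ i - x $ i" "y $ i - x $
        i"] by auto
  qed
  then show "torus_proj x = torus_proj y" by (simp add: torus_proj_def)
qed

lemma torus_proj_add: "int_vec k \<Longrightarrow> torus_proj (x + k) = torus_proj x"
  using torus_proj_eq_iff[of x "x + k"] by simp

text \<open>The radius 1/2 puts any two points of the ball at distance less than 1, and an integer
  of absolute value less than 1 is 0.\<close>

lemma torus_proj_inj_ball: "inj_on torus_proj (ball (z :: real^'n) (1/2))"
proof (rule inj_onI)
  fix x y :: "real^'n" assume xy: "x \<in> ball z (1/2)" "y \<in> ball z (1/2)"
    and eq: "torus_proj x = torus_proj y"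
  have "norm (y - x) < 1"
    using xy dist_triangle_half_r[of z x 1 y] by (simp add: dist_norm norm_minus_commute)
  then have "\<bar>(y - x) $ i\<bar> < 1" for i using component_le_norm_cart[of "y - x" i] by linarith
  moreover have "(y - x) $ i \<in> \<int>" for i using eq by (simp add: torus_proj_eq_iff int_vec_def)
  ultimately have "(y - x) $ i = 0" for i using Ints_nonzero_abs_less1 by blast
  then show "x = y" by (simp add: vec_eq_iff)
qed

text \<open>The saturation is the union of all integer translates of \<open>B\<close>. It follows
  that the projection is an open map.\<close>

lemma open_torus_saturation: "open B \<Longrightarrow> open (torus_proj -` torus_proj ` B)"
proof -
  assume B: "open B"
  have "torus_proj -` torus_proj ` B = (\<Union>k\<in>{k. int_vec k}. (+) k ` B)"
  proof (intro equalityI subsetI)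
    fix y assume "y \<in> torus_proj -` torus_proj ` B"
    then obtain x where "x \<in> B" "torus_proj x = torus_proj y" by auto
    then show "y \<in> (\<Union>k\<in>{k. int_vec k}. (+) k ` B)"
      by (intro UN_I[of "y - x"] image_eqI[of _ _ x]) (simp_all add: torus_proj_eq_iff)
  next
    fix y assume "y \<in> (\<Union>k\<in>{k. int_vec k}. (+) k ` B)"
    then obtain k x where "int_vec k" "x \<in> B" "y = x + k" by (auto simp: add.commute)
    then show "y \<in> torus_proj -` torus_proj ` B" by (simp add: torus_proj_add)
  qed
  then show ?thesis using B by (auto intro: open_translation)
qed

lemma topspace_torus: "topspace torus_topology = range torus_proj"
proof
  show "topspace torus_topology \<subseteq> range torus_proj"
    using openin_topspace[of torus_topology] unfolding openin_torus_topology by blast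
  have "openin torus_topology (range torus_proj)" by (simp add: openin_torus_topology vimage_def)
  then show "range torus_proj \<subseteq> topspace torus_topology" by (rule openin_subset)
qed

lemma mtop_torus [simp]: "mtop torus = torus_topology"
  by (simp add: torus_def)

lemma torus_proj_in: "torus_proj y \<in> topspace torus_topology"
  by (simp add: topspace_torus)

lemma continuous_torus_proj: "continuous_map euclidean torus_topology torus_proj"
  unfolding continuous_map_def
  by (auto simp: topspace_torus openin_torus_topology vimage_def)

lemma openin_torus_image: "open B \<Longrightarrow> openin torus_topology (torus_proj ` B)"
  by (auto simp: openin_torus_topology open_torus_saturation)

text \<open>The universal property of the quotient topology.\<close>

lemma continuous_map_from_torus:
  assumes "continuous_map euclidean Y (\<lambda>y. f (torus_proj y))"
  shows "continuous_map torus_topology Y f"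
  unfolding continuous_map_def
proof (intro conjI allI impI)
  show "f \<in> topspace torus_topology \<rightarrow> topspace Y"
    using assms by (auto simp: topspace_torus continuous_map_def)
  fix U assume "openin Y U"
  then have "open {y. f (torus_proj y) \<in> U}" using assms by (simp add: continuous_map_def)
  moreover have "torus_proj -` {x \<in> topspace torus_topology. f x \<in> U} = {y. f (torus_proj y) \<in> U}"
    by (auto simp: topspace_torus)
  ultimately show "openin torus_topology {x \<in> topspace torus_topology. f x \<in> U}"
    by (auto simp: openin_torus_topology topspace_torus)
qed

lemma torus_chart_cases:
  assumes "c \<in> atlas torus"
  obtains B where "open B" "inj_on torus_proj B" "fst c = torus_proj ` B" "snd c =
    inv_into B torus_proj"
    "snd c ` fst c = B" "\<And>y. y \<in> B \<Longrightarrow> chart_inv c y = torus_proj y"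
    "\<And>x. x \<in> fst c \<Longrightarrow> torus_proj (snd c x) = x"
proof -
  obtain B where B: "open B" "inj_on torus_proj B" "c = (torus_proj ` B, inv_into B torus_proj)"
    using assms by (auto simp: torus_def)
  have im: "snd c ` fst c = B" using B by (force simp: image_image)
  have inj: "inj_on (snd c) (fst c)" using B by (simp add: inj_on_inv_into)
  have ci: "chart_inv c y = torus_proj y" if "y \<in> B" for y
    unfolding chart_inv_def using B that inj by (intro inv_into_f_eq) auto
  have "torus_proj (snd c x) = x" if "x \<in> fst c" for x
    using B that by (simp add: f_inv_into_f)
  with B im ci show ?thesis by (intro that[of B]) auto
qed

definition torus_chart :: "real^'n \<Rightarrow> ((real^'n) set, real^'n) chart" where
  "torus_chart a = (torus_proj ` ball a (1/2), inv_into (ball a (1/2)) torus_proj)"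

lemma torus_chart_atlas [simp]: "torus_chart a \<in> atlas torus"
  unfolding torus_chart_def torus_def using torus_proj_inj_ball
    by (auto intro!: exI[of _ "ball a (1/2)"])

lemma torus_chart_simps [simp]:
  "fst (torus_chart a) = torus_proj ` ball a (1/2)"
  "y \<in> ball a (1/2) \<Longrightarrow> snd (torus_chart a) (torus_proj y) = y"
  "snd (torus_chart a) ` torus_proj ` ball a (1/2) = ball a (1/2)"
  using torus_proj_inj_ball[of a] by (force simp: torus_chart_def image_image)+

lemma torus_chart_inv: "y \<in> ball a (1/2) \<Longrightarrow> chart_inv (torus_chart a) y = torus_proj y"
  unfolding chart_inv_def torus_chart_def using torus_proj_inj_ball[of a]
  by (intro inv_into_f_eq) (auto simp: inj_on_inv_into)

text \<open>Near \<open>snd c x\<close> the transition is the translation by the integer vector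
  \<open>k\<close> that takes one coordinate vector of \<open>x\<close> to the other. Other points
  of the overlap may need a different \<open>k\<close>.\<close>

lemma transition_torus_derivative:
  assumes c: "c \<in> atlas torus" and d: "d \<in> atlas torus" and x: "x \<in> fst c" "x \<in> fst d"
  shows "(transition c d has_derivative (\<lambda>w. w)) (at (snd c x))"
proof -
  obtain B where B: "open B" "inj_on torus_proj B" "fst c = torus_proj ` B" "snd c =
    inv_into B torus_proj"
    "snd c ` fst c = B" "\<And>y. y \<in> B \<Longrightarrow> chart_inv c y = torus_proj y"
    "\<And>x. x \<in> fst c \<Longrightarrow> torus_proj (snd c x) = x"
    using torus_chart_cases[OF c] by blast
  obtain B' where B': "open B'" "inj_on torus_proj B'" "fst d = torus_proj ` B'" "snd d =
    inv_into B' torus_proj"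
    "snd d ` fst d = B'" "\<And>y. y \<in> B' \<Longrightarrow> chart_inv d y = torus_proj y"
    "\<And>x. x \<in> fst d \<Longrightarrow> torus_proj (snd d x) = x"
    using torus_chart_cases[OF d] by blast
  define k where "k = snd d x - snd c x"
  have k: "int_vec k"
    using B(7)[OF x(1)] B'(7)[OF x(2)] by (simp add: k_def torus_proj_eq_iff[symmetric])
  have op: "open (B \<inter> (\<lambda>y. y + k) -` B')"
    using B(1) B'(1) by (intro open_Int open_vimage) (auto intro: continuous_intros)
  have mem: "snd c x \<in> B \<inter> (\<lambda>y. y + k) -` B'" using B(5) B'(5) x by (auto simp: k_def)
  have "y + k = transition c d y" if "y \<in> B \<inter> (\<lambda>y. y + k) -` B'" for y
  proof -
    have "transition c d y = inv_into B' torus_proj (torus_proj (y + k))"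
      using that B(6) B'(4) k by (simp add: transition_def torus_proj_add)
    also have "\<dots> = y + k" using that B'(2) by simp
    finally show ?thesis by simp
  qed
  moreover have "((\<lambda>y. y + k) has_derivative (\<lambda>w. w)) (at (snd c x))"
    by (auto intro!: derivative_eq_intros)
  ultimately show ?thesis using has_derivative_transform_within_open[OF _ op mem] by blast
qed

lemma smooth_atlas_torus: "smooth_atlas (torus :: ((real^'n) set, real^'n) manifold)"
  unfolding smooth_atlas_def mtop_torus
proof (intro conjI ballI)
  show "\<Union> (fst ` atlas torus) = topspace (torus_topology :: (real^'n) set topology)"
  proof (intro equalityI subsetI)
    fix x :: "(real^'n) set" assume "x \<in> \<Union> (fst ` atlas torus)"
    then show "x \<in> topspace torus_topology" by (auto simp: torus_def topspace_torus)
  next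
    fix x :: "(real^'n) set" assume "x \<in> topspace torus_topology"
    then obtain y where y: "x = torus_proj y" by (auto simp: topspace_torus)
    then have "x \<in> fst (torus_chart y)" by simp
    then show "x \<in> \<Union> (fst ` atlas torus)" using torus_chart_atlas by blast
  qed
next
  fix c :: "((real^'n) set, real^'n) chart" assume c: "c \<in> atlas torus"
  obtain B where B: "open B" "inj_on torus_proj B" "fst c = torus_proj ` B" "snd c =
    inv_into B torus_proj"
    "snd c ` fst c = B" "\<And>y. y \<in> B \<Longrightarrow> chart_inv c y = torus_proj y"
    "\<And>x. x \<in> fst c \<Longrightarrow> torus_proj (snd c x) = x"
    using torus_chart_cases[OF c] by blast
  show op: "openin torus_topology (fst c)" using B by (simp add: openin_torus_image)
  show "open (snd c ` fst c)" using B by simp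
  have top: "topspace (subtopology torus_topology (fst c)) = fst c"
    using openin_subset[OF op] by (simp add: Int_absorb1)
  have "homeomorphic_maps (subtopology torus_topology (fst c)) (top_of_set B) (snd c) torus_proj"
    unfolding homeomorphic_maps_def
  proof (intro conjI ballI)
    show "continuous_map (top_of_set B) (subtopology torus_topology (fst c)) torus_proj"
      using B(3) continuous_map_from_subtopology[OF continuous_torus_proj]
      by (auto simp: continuous_map_in_subtopology)
    show "continuous_map (subtopology torus_topology (fst c)) (top_of_set B) (snd c)"
      unfolding continuous_map_def top
    proof (intro conjI allI impI)
      show "snd c \<in> fst c \<rightarrow> topspace (top_of_set B)" using B(5) by auto
      fix U assume "openin (top_of_set B) U"
      then have U: "open U" "U \<subseteq> B" using B(1) openin_open_eq by blast+
      have "{x \<in> fst c. snd c x \<in> U} = torus_proj ` U"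
        using U(2) B(2,3,4,7) by (auto intro: image_eqI)
      then show "openin (subtopology torus_topology (fst c)) {x \<in> fst c. snd c x \<in> U}"
        using openin_torus_image[OF U(1)] U(2) B(3) op
          by (simp add: openin_open_subtopology image_mono)
    qed
    show "torus_proj (snd c x) = x" if "x \<in> topspace (subtopology torus_topology (fst c))" for x
      using that B(7) by (simp add: top)
    show "snd c (torus_proj y) = y" if "y \<in> topspace (top_of_set B)" for y
      using that B(2,4) by simp
  qed
  then show "homeomorphic_map (subtopology torus_topology (fst c)) (top_of_set (snd c ` fst c))
    (snd c)"
    unfolding B(5) homeomorphic_map_maps by blast
  fix d :: "((real^'n) set, real^'n) chart" assume d: "d \<in> atlas torus"
  obtain B' where B': "open B'" "fst d = torus_proj ` B'"
    using d by (auto simp: torus_def)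
  have "snd c ` (fst c \<inter> fst d) = B \<inter> torus_proj -` torus_proj ` B'"
  proof (intro equalityI subsetI)
    fix y assume "y \<in> snd c ` (fst c \<inter> fst d)"
    then obtain x where "x \<in> fst c" "x \<in> fst d" "y = snd c x" by blast
    then show "y \<in> B \<inter> torus_proj -` torus_proj ` B'" using B(5,7) B'(2) by auto
  next
    fix y assume y: "y \<in> B \<inter> torus_proj -` torus_proj ` B'"
    then have "snd c (torus_proj y) = y" using B(2,4) by simp
    then show "y \<in> snd c ` (fst c \<inter> fst d)"
      using y B(3) B'(2) by (intro image_eqI[of _ _ "torus_proj y"]) auto
  qed
  then have "open (snd c ` (fst c \<inter> fst d))"
    using B(1) open_torus_saturation[OF B'(1)] by (simp add: open_Int)
  then show "smooth_on (snd c ` (fst c \<inter> fst d)) (transition c d)"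
    unfolding smooth_on_def using transition_torus_derivative[OF c d]
    by (auto intro!: Ck_on_locally_translation)
qed

interpretation torus: smooth_manifold "torus :: ((real^'n) set, real^'n) manifold"
  by unfold_locales (rule smooth_atlas_torus)

section \<open>The trivialised tangent bundle of the torus\<close>

definition torus_tvec :: "(real^'n) set \<Rightarrow> real^'n \<Rightarrow> ((real^'n) set, real^'n) tvector" where
  "torus_tvec x w = (\<lambda>d. if d \<in> charts_at torus x then w else 0)"

definition torus_point :: "real^'n \<Rightarrow> real^'n \<Rightarrow> (real^'n) set \<times> ((real^'n) set,
  real^'n) tvector" where
  "torus_point y w = (torus_proj y, torus_tvec (torus_proj y) w)"

lemma tvec_torus:
  assumes "c \<in> atlas torus" "x \<in> fst c" shows "tvec torus c x w = torus_tvec x w"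
proof
  fix d
  show "tvec torus c x w d = torus_tvec x w d"
  proof (cases "d \<in> charts_at torus x")
    case True
    then have d: "d \<in> atlas torus" "x \<in> fst d" by (simp_all add: charts_at_def)
    have "(\<lambda>w. w) = frechet_derivative (transition c d) (at (snd c x))"
      by (rule frechet_derivative_at[OF transition_torus_derivative[OF assms(1) d(1) assms(2)
        d(2)]])
    from fun_cong[OF this, of w] show ?thesis using True by (simp add: tvec_def torus_tvec_def)
  next
    case False then show ?thesis by (simp add: tvec_def torus_tvec_def)
  qed
qed

lemma charts_at_torus: "x \<in> topspace torus_topology \<Longrightarrow> (SOME c. c \<in> charts_at torus x) \<in>
  charts_at torus x"
proof -
  assume "x \<in> topspace torus_topology"
  then obtain c where "c \<in> atlas torus" "x \<in> fst c" using torus.charts_cover[of x] by auto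
  then have "c \<in> charts_at torus x" by (simp add: charts_at_def)
  then show ?thesis by (rule someI)
qed

lemma torus_velocity_tvec: "x \<in> topspace torus_topology \<Longrightarrow> torus_velocity (x, torus_tvec x w) = w"
  using charts_at_torus[of x] by (simp add: torus_velocity_def torus_tvec_def)

lemma torus_velocity_point [simp]: "torus_velocity (torus_point y w) = w"
  by (simp add: torus_point_def torus_velocity_tvec torus_proj_in)

lemma torus_point_in: "torus_point y w \<in> TM torus"
  using torus.tvec_in[of "torus_chart y" "torus_proj y" w]
  by (simp add: torus_point_def torus.TM_iff torus_proj_in tvec_torus)

lemma torus_point_add: "int_vec k \<Longrightarrow> torus_point (y + k) w = torus_point y w"
  by (simp add: torus_point_def torus_proj_add)

lemma tparam_torus:
  assumes "c \<in> atlas torus" "y \<in> snd c ` fst c" shows "tparam torus c (y, w) = torus_point y w"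
proof -
  have "chart_inv c y = torus_proj y" using torus_chart_cases[OF assms(1)] assms(2) by metis
  moreover have "chart_inv c y \<in> fst c" using assms by (auto simp: torus.chart_inv_chart)
  ultimately show ?thesis using assms(1) by (simp add: tparam_def torus_point_def tvec_torus)
qed

lemma form_coord_torus:
  assumes "c \<in> atlas torus" "y \<in> snd c ` fst c" shows "form_coord torus \<eta> c y w =
    \<eta> (torus_point y w)"
  using tparam_torus[OF assms, of w] by (simp add: form_coord_def tparam_def)

text \<open>Over each ball of radius 1/2 the map is the inverse of a bundle chart, and these balls
  cover the whole space.\<close>

lemma continuous_torus_point:
  "continuous_map euclidean (TM_topology torus) (\<lambda>z :: (real^'n) \<times> (real^'n). torus_point (fst z)
    (snd z))"
  unfolding continuous_map_def
proof (intro conjI allI impI)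
  show "(\<lambda>z :: (real^'n) \<times> (real^'n). torus_point (fst z) (snd z)) \<in>
    topspace euclidean \<rightarrow> topspace (TM_topology torus)"
    by (simp add: torus.topspace_TM torus_point_in)
  fix W :: "((real^'n) set \<times> ((real^'n) set, real^'n) tvector) set" assume W: "openin (TM_topology
    torus) W"
  have "open {z \<in> ball a (1/2) \<times> UNIV. torus_point (fst z) (snd z) \<in> W}" for a :: "real^'n"
  proof -
    have "openin (top_of_set (ball a (1/2) \<times> UNIV)) {z \<in>
      ball a (1/2) \<times> UNIV. tparam torus (torus_chart a) z \<in> W}"
      using torus.continuous_tparam[OF torus_chart_atlas, of a] W by (simp add: continuous_map_def)
    then have "open {z \<in> ball a (1/2) \<times> UNIV. tparam torus (torus_chart a) z \<in> W}"
      by (rule openin_open_trans) (simp add: open_Times)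
    moreover have "tparam torus (torus_chart a) z = torus_point (fst z) (snd z)"
      if "z \<in> ball a (1/2) \<times> UNIV" for z
      using tparam_torus[OF torus_chart_atlas, of "fst z" a "snd z"] that by auto
    then have "{z \<in> ball a (1/2) \<times> UNIV. torus_point (fst z) (snd z) \<in> W} =
        {z \<in> ball a (1/2) \<times> UNIV. tparam torus (torus_chart a) z \<in> W}" by auto
    ultimately show ?thesis by simp
  qed
  then have "open (\<Union>a. {z \<in> ball a (1/2) \<times> UNIV. torus_point (fst z) (snd z :: real^'n) \<in> W})"
    by blast
  moreover have "(\<Union>a. {z \<in> ball a (1/2) \<times> UNIV. torus_point (fst z) (snd z) \<in> W}) =
     {z. torus_point (fst z) (snd z) \<in> W}"
  proof (intro equalityI subsetI)
    fix z :: "(real^'n) \<times> (real^'n)" assume "z \<in> {z. torus_point (fst z) (snd z) \<in> W}"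
    then show "z \<in> (\<Union>a. {z \<in> ball a (1/2) \<times> UNIV. torus_point (fst z) (snd z) \<in> W})"
      by (intro UN_I[of "fst z"]) (auto simp: mem_Times_iff)
  qed auto
  ultimately show "openin euclidean {z \<in> topspace euclidean. torus_point (fst z) (snd z) \<in> W}"
    by simp
qed

section \<open>Circle-valued coordinates and separation of points\<close>

definition circle_coord :: "'n \<Rightarrow> (real^'n) set \<Rightarrow> complex" where
  "circle_coord i x = cis (2 * pi * inv_into UNIV torus_proj x $ i)"

text \<open>Representatives of a point differ by integer vectors, so the one that
  \<open>inv_into\<close> picks does not matter. These coordinates separate the points of the torus
  and later turn path lifting into taking logarithms.\<close>

lemma circle_coord_proj: "circle_coord i (torus_proj y) = cis (2 * pi * y $ i)"
proof -
  let ?y = "inv_into UNIV torus_proj (torus_proj y)"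
  have "torus_proj ?y = torus_proj y" by (rule f_inv_into_f) simp
  then have "y $ i - ?y $ i \<in> \<int>" by (simp add: torus_proj_eq_iff int_vec_def)
  then obtain m where "y $ i = ?y $ i + of_int m" by (metis Ints_cases add.commute diff_add_cancel)
  then have "cis (2 * pi * y $ i) = cis (2 * pi * ?y $ i + 2 * pi * of_int m)"
    by (simp add: distrib_left)
  also have "\<dots> = cis (2 * pi * ?y $ i) * cis (2 * pi * of_int m)" by (simp only: cis_mult)
  also have "cis (2 * pi * of_int m) = 1" by (rule cis_multiple_2pi) simp
  finally show ?thesis by (simp add: circle_coord_def)
qed

lemma continuous_circle_coord: "continuous_map torus_topology euclidean (circle_coord i)"
  by (rule continuous_map_from_torus) (auto simp: circle_coord_proj intro!: continuous_intros)

lemma circle_coord_inj: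
  assumes "\<And>i. circle_coord i (torus_proj x) = circle_coord i (torus_proj y)"
  shows "torus_proj x = torus_proj y"
proof -
  have "(y - x) $ i \<in> \<int>" for i
  proof -
    have "exp (\<i> * of_real (2 * pi * y $ i)) = exp (\<i> * of_real (2 * pi * x $ i))"
      using assms[of i] by (simp add: circle_coord_proj cis_conv_exp)
    then obtain m :: int where "\<i> * of_real (2 * pi * y $ i) = \<i> * of_real (2 * pi * x $ i) +
      (of_int (2 * m) * pi) * \<i>"
      using exp_eq by metis
    then have "Im (\<i> * of_real (2 * pi * y $ i)) = Im (\<i> * of_real (2 * pi * x $ i) +
      (of_int (2 * m) * pi) * \<i>)"
      by simp
    then have "2 * pi * (y $ i) = 2 * pi * (x $ i + of_int m)" by (simp add: algebra_simps)
    then have "y $ i - x $ i = of_int m" using pi_neq_zero by simp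
    then show ?thesis by simp
  qed
  then show ?thesis by (simp add: torus_proj_eq_iff int_vec_def)
qed

lemma int_vec_reduce:
  fixes y :: "real^'n"
  obtains k where "int_vec k" "\<And>i. 0 \<le> (y + k) $ i" "\<And>i. (y + k) $ i < 1"
proof
  let ?k = "(\<chi> i. - of_int \<lfloor>y $ i\<rfloor>) :: real^'n"
  show "int_vec ?k" by (simp add: int_vec_def)
  show "0 \<le> (y + ?k) $ i" for i by simp
  show "(y + ?k) $ i < 1" for i using floor_correct[of "y $ i"] by simp linarith
qed

lemma torus_proj_cbox: "torus_proj ` cbox 0 1 = topspace (torus_topology :: (real^'n) set topology)"
proof (intro equalityI subsetI)
  fix x :: "(real^'n) set" assume "x \<in> topspace torus_topology"
  then obtain y where y: "x = torus_proj y" by (auto simp: topspace_torus)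
  obtain k where k: "int_vec k" "\<And>i. 0 \<le> (y + k) $ i" "\<And>i. (y + k) $ i < 1" using int_vec_reduce
    by blast
  have "y + k \<in> cbox 0 1" using k by (auto simp: mem_box_cart less_imp_le)
  then show "x \<in> torus_proj ` cbox 0 1" using torus_proj_add[OF k(1), of y] y by (metis imageI)
qed (auto simp: topspace_torus)

lemma closed_manifold_torus: "closed_manifold (torus :: ((real^'n) set, real^'n) manifold)"
  unfolding closed_manifold_def mtop_torus
proof (intro conjI smooth_atlas_torus)
  have "compactin torus_topology (torus_proj ` cbox 0 (1 :: real^'n))"
    by (rule image_compactin[OF _ continuous_torus_proj]) simp
  then show "compact_space (torus_topology :: (real^'n) set topology)"
    by (simp add: torus_proj_cbox compact_space_def)
  show "Hausdorff_space (torus_topology :: (real^'n) set topology)"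
    unfolding Hausdorff_space_def
  proof (intro allI impI, elim conjE)
    fix p q :: "(real^'n) set" assume p: "p \<in> topspace torus_topology" "q \<in>
      topspace torus_topology" "p \<noteq> q"
    obtain a b where ab: "p = torus_proj a" "q = torus_proj b" using p
      by (auto simp: topspace_torus)
    obtain i where neq: "circle_coord i p \<noteq> circle_coord i q"
      using circle_coord_inj[of a b] p(3) unfolding ab by blast
    obtain U V where UV: "open U" "open V" "circle_coord i p \<in> U" "circle_coord i q \<in> V" "U \<inter> V =
      {}"
      using hausdorff[OF neq] by blast
    have op: "openin torus_topology {x \<in> topspace torus_topology. circle_coord i x \<in> U}"
      "openin torus_topology {x \<in> topspace torus_topology. circle_coord i x \<in> V}"
      using UV by (auto intro!: openin_continuous_map_preimage[OF continuous_circle_coord])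
    have "disjnt {x \<in> topspace torus_topology. circle_coord i x \<in> U} {x \<in>
      topspace torus_topology. circle_coord i x \<in> V}"
      unfolding disjnt_def using UV(5) by blast
    with op show "\<exists>U V. openin torus_topology U \<and> openin torus_topology V \<and> p \<in> U \<and> q \<in> V \<and>
      disjnt U V"
      using UV(3,4) p(1,2) by blast
  qed
  show "second_countable (torus_topology :: (real^'n) set topology)"
  proof -
    obtain \<B> :: "(real^'n) set set" where \<B>: "countable \<B>" "\<And>C. C \<in> \<B> \<Longrightarrow> open C"
      "\<And>S. open S \<Longrightarrow> \<exists>U. U \<subseteq> \<B> \<and> S = \<Union>U"
      by (metis univ_second_countable)
    show ?thesis
      unfolding second_countable_def
    proof (intro exI conjI ballI allI impI)
      show "countable ((`) torus_proj ` \<B>)" using \<B>(1) by simp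
      show "openin torus_topology V" if "V \<in> (`) torus_proj ` \<B>" for V
        using that \<B>(2) openin_torus_image by auto
      fix U :: "(real^'n) set set" and x assume Ux: "openin torus_topology U \<and> x \<in> U"
      then have U: "U \<subseteq> range torus_proj" "open (torus_proj -` U)"
        by (auto simp: openin_torus_topology)
      then obtain y where y: "x = torus_proj y" using Ux by blast
      obtain D where D: "D \<subseteq> \<B>" "torus_proj -` U = \<Union>D" using \<B>(3)[OF U(2)] by blast
      then obtain C where "C \<in> D" "y \<in> C" using y Ux by blast
      then show "\<exists>V\<in>(`) torus_proj ` \<B>. x \<in> V \<and> V \<subseteq> U"
        using D y by (intro bexI[of _ "torus_proj ` C"]) auto
    qed
  qed
qed

section \<open>Closed forms and cycles on the torus\<close>

text \<open>The primitive is the integral along rays from the origin: F x is the integral of E (t x)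
  x over t in [0, 1]. By symmetry of \<open>D\<close>, the derivative of the integrand in direction
  u is the t-derivative of t E (t x) u, which integrates to E x u.\<close>

lemma poincare_lemma:
  fixes E :: "'e::euclidean_space \<Rightarrow> 'e \<Rightarrow> real" and D :: "'e \<Rightarrow> 'e \<Rightarrow> 'e \<Rightarrow> real"
  assumes lin: "\<And>y. linear (E y)"
    and deriv: "\<And>y w. ((\<lambda>z. E z w) has_derivative D y w) (at y)"
    and cont: "\<And>w u. continuous_on UNIV (\<lambda>y. D y w u)"
    and sym: "\<And>y u w. D y w u = D y u w"
  obtains F where "\<And>y. (F has_derivative E y) (at y)"
proof -
  have E_sum: "E y u = (\<Sum>b\<in>Basis. (u \<bullet> b) * E y b)" for y u
  proof -
    have "E y u = E y (\<Sum>b\<in>Basis. (u \<bullet> b) *\<^sub>R b)" by (simp add: euclidean_representation)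
    then show ?thesis using lin[of y] by (simp add: linear_sum linear_scale)
  qed
  have D_lin: "linear (D y w)" for y w using has_derivative_linear[OF deriv] .
  have D_sum: "D y w u = (\<Sum>b\<in>Basis. (u \<bullet> b) * D y w b)" for y w u
  proof -
    have "D y w u = D y w (\<Sum>b\<in>Basis. (u \<bullet> b) *\<^sub>R b)" by (simp add: euclidean_representation)
    then show ?thesis using D_lin[of y w] by (simp add: linear_sum linear_scale)
  qed
  have E_cont: "continuous_on UNIV (\<lambda>y. E y w)" for w
    using has_derivative_continuous[OF deriv] by (simp add: continuous_at_imp_continuous_on)
  define G where "G x t u = (\<Sum>b\<in>Basis. (u \<bullet> b) * E (t *\<^sub>R x) b + (x \<bullet> b) * (t * D (t *\<^sub>R x) b u))"
    for x t u
  have scale_deriv: "((\<lambda>x. E (t *\<^sub>R x) b) has_derivative (\<lambda>u. t * D (t *\<^sub>R x) b u)) (at x)"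
    for t b x
  proof -
    have "((\<lambda>x. t *\<^sub>R x) has_derivative (\<lambda>u. t *\<^sub>R u)) (at x)"
      by (auto intro!: derivative_eq_intros)
    from has_derivative_compose[OF this deriv]
    show ?thesis using linear_scale[OF D_lin] by simp
  qed
  have G_deriv: "((\<lambda>x. E (t *\<^sub>R x) x) has_derivative G x t) (at x)" for x t
  proof -
    have eq: "(\<lambda>x. E (t *\<^sub>R x) x) = (\<lambda>x. \<Sum>b\<in>Basis. (x \<bullet> b) * E (t *\<^sub>R x) b)"
      by (rule ext) (rule E_sum)
    show ?thesis unfolding eq G_def
      by (auto intro!: derivative_eq_intros scale_deriv simp: algebra_simps)
  qed
  have G_bl: "bounded_linear (G x t)" for x t using G_deriv has_derivative_bounded_linear by blast
  have comp_cont: "continuous_on S (\<lambda>z. f (snd z *\<^sub>R fst z))"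
    if "continuous_on UNIV f" for f :: "'e \<Rightarrow> real" and S
    by (rule continuous_on_compose2[OF that]) (auto intro!: continuous_intros)
  have G_cont: "continuous_on S (\<lambda>z. G (fst z) (snd z) u)" for u S
    unfolding G_def by (intro continuous_intros comp_cont E_cont cont)
  \<comment> \<open>The same derivative packaged as a bounded linear function, the form in which
    \<open>leibniz_rule\<close> differentiates under the integral.\<close>
  define GB where "GB x t = Blinfun (G x t)" for x t
  have GB: "blinfun_apply (GB x t) = G x t" for x t
    unfolding GB_def by (rule bounded_linear_Blinfun_apply[OF G_bl])
  have GB_cont: "continuous_on S (\<lambda>(x, t). GB x t)" for S
    unfolding case_prod_beta by (rule continuous_on_blinfun_componentwise) (simp add: GB G_cont)
  have E_path: "continuous_on A (\<lambda>t. E (t *\<^sub>R x) w)" for A x w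
    by (rule continuous_on_compose2[OF E_cont]) (auto intro!: continuous_intros)
  have GB_path: "continuous_on A (GB x)" for A x
  proof -
    have "continuous_on A (\<lambda>t. (\<lambda>(x, t). GB x t) (x, t))"
      by (rule continuous_on_compose2[OF GB_cont[of UNIV]]) (auto intro!: continuous_intros)
    then show ?thesis by simp
  qed
  define F where "F x = integral (cbox 0 1) (\<lambda>t::real. E (t *\<^sub>R x) x)" for x
  have "(F has_derivative E x) (at x)" for x
  proof -
    have "(F has_derivative blinfun_apply (integral (cbox 0 1) (GB x))) (at x within UNIV)"
      unfolding F_def
      by (rule leibniz_rule[OF _ _ GB_cont])
         (auto simp: GB intro!: G_deriv[THEN has_derivative_at_withinI] integrable_continuous_real
           E_path)
    moreover have app: "blinfun_apply (integral (cbox 0 1) (GB x)) u = E x u" for u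
    proof -
      have "GB x integrable_on cbox 0 1" using GB_path by (intro integrable_continuous) auto
      from integral_linear[OF this blinfun.bounded_linear_left[of u]]
      have "blinfun_apply (integral (cbox 0 1) (GB x)) u = integral (cbox 0 1) (\<lambda>t. G x t u)"
        by (simp add: o_def GB)
      also have "((\<lambda>t. G x t u) has_integral (1 * E (1 *\<^sub>R x) u - 0 * E (0 *\<^sub>R x) u)) {0..1}"
      proof (rule fundamental_theorem_of_calculus)
        fix t :: real
        have "((\<lambda>t. t *\<^sub>R x) has_derivative (\<lambda>s. s *\<^sub>R x)) (at t)"
          by (auto intro!: derivative_eq_intros)
        from has_derivative_compose[OF this deriv]
        have "((\<lambda>t. E (t *\<^sub>R x) u) has_derivative (\<lambda>s. s * D (t *\<^sub>R x) u x)) (at t)"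
          using linear_scale[OF D_lin] by simp
        then have "((\<lambda>t. E (t *\<^sub>R x) u) has_field_derivative D (t *\<^sub>R x) u x) (at t)"
          by (simp add: has_field_derivative_def mult_commute_abs)
        then have "((\<lambda>t. t * E (t *\<^sub>R x) u) has_field_derivative (E (t *\<^sub>R x) u +
          t * D (t *\<^sub>R x) u x)) (at t)"
          by (auto intro!: derivative_eq_intros)
        \<comment> \<open>The symmetry enters here: it exchanges \<open>u\<close> with the basis
          vectors, so that the second sum in \<open>G\<close> reassembles to the derivative in
          direction \<open>x\<close>.\<close>
        moreover have "G x t u = E (t *\<^sub>R x) u + t * D (t *\<^sub>R x) u x"
          unfolding G_def sum.distrib E_sum[of "t *\<^sub>R x" u] D_sum[of "t *\<^sub>R x" u x] sum_distrib_left
          by (simp add: sym[of "t *\<^sub>R x" u] mult.left_commute)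
        ultimately show "((\<lambda>t. t * E (t *\<^sub>R x) u) has_vector_derivative G x t u) (at t within
          {0..1})"
          by (simp add: has_real_derivative_iff_has_vector_derivative
            has_vector_derivative_at_within)
      qed simp
      then have "integral (cbox 0 1) (\<lambda>t. G x t u) = E x u" by (simp add: integral_unique)
      finally show ?thesis .
    qed
    moreover have "blinfun_apply (integral (cbox 0 1) (GB x)) = E x" by (rule ext) (rule app)
    ultimately show ?thesis by simp
  qed
  then show ?thesis by (rule that)
qed

text \<open>\<open>F\<close> is a primitive of the pullback of \<eta> to the universal cover, and
  \<open>a\<close> is the vector of its periods over the coordinate circles; it represents the de
  Rham class of \<eta>.\<close>

definition periodic_primitive ::
  "((real^'n) set \<times> ((real^'n) set, real^'n) tvector \<Rightarrow> real) \<Rightarrow> (real^'n \<Rightarrow> real) \<Rightarrow> real^'n \<Rightarrow> bool"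
    where
  "periodic_primitive \<eta> F a \<longleftrightarrow>
     (\<forall>y. (F has_derivative (\<lambda>w. \<eta> (torus_point y w))) (at y)) \<and>
     (\<forall>y k. int_vec k \<longrightarrow> F (y + k) = F y + a \<bullet> k)"

text \<open>Composing translations shows that \<open>A\<close> is additive on the lattice. The
  integer vectors on which it agrees with the inner product form a subgroup that contains the axis
  vectors, hence all of them.\<close>

lemma int_vec_additive:
  fixes F :: "real^'n \<Rightarrow> real"
  assumes A: "\<And>y k. int_vec k \<Longrightarrow> F (y + k) = F y + A k" and k: "int_vec k"
  shows "A k = (\<chi> i. A (axis i 1)) \<bullet> k"
proof -
  let ?a = "\<chi> i. A (axis i 1)"
  define P where "P = {k. int_vec k \<and> A k = ?a \<bullet> k}"
  have add: "A (k + m) = A k + A m" if "int_vec k" "int_vec m" for k m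
    using A[of "k + m" 0] A[of k 0] A[of m k] that by (simp add: int_vec_simps add.commute)
  have zero: "A 0 = 0" using A[of 0 0] by (simp add: int_vec_simps)
  have neg: "A (- k) = - A k" if "int_vec k" for k
    using add[of k "- k"] that zero by (simp add: int_vec_simps)
  have P_add: "k + m \<in> P" if "k \<in> P" "m \<in> P" for k m
    using that add by (auto simp: P_def int_vec_simps inner_add_right)
  have P_neg: "- k \<in> P" if "k \<in> P" for k using that neg by (auto simp: P_def int_vec_simps)
  have P_0: "0 \<in> P" using zero by (simp add: P_def int_vec_simps)
  have P_axis: "axis i 1 \<in> P" for i by (simp add: P_def int_vec_simps inner_axis)
  have P_nat: "of_nat n *\<^sub>R axis i 1 \<in> P" for i and n :: nat
    by (induction n) (simp_all add: P_0 scaleR_add_left P_add P_axis)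
  have P_int: "of_int m *\<^sub>R axis i 1 \<in> P" for i and m :: int
  proof (cases m rule: int_cases2)
    case (nonneg n) then show ?thesis using P_nat[of n i] by simp
  next
    case (nonpos n) then show ?thesis using P_neg[OF P_nat[of n i]] by simp
  qed
  have P_sum: "(\<Sum>i\<in>I. (k $ i) *\<^sub>R axis i 1) \<in> P" if "finite I" for I
    using that
  proof (induction I rule: finite_induct)
    case (insert i I)
    obtain m where "k $ i = of_int m" using k by (auto simp: int_vec_def elim: Ints_cases)
    then show ?case using insert P_int[of m i] by (simp add: P_add)
  qed (simp add: P_0)
  have "k = (\<Sum>i\<in>UNIV. (k $ i) *\<^sub>R axis i 1)"
    by (simp add: vec_eq_iff axis_def if_distrib[of "\<lambda>x. _ * x"] cong: if_cong)
  then have "k \<in> P" using P_sum[of UNIV] by simp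
  then show ?thesis by (simp add: P_def)
qed

text \<open>The pulled-back form is invariant under integer translations, so
  \<open>F (y + k) - F y\<close> has zero derivative and depends on \<open>k\<close> alone.\<close>

lemma periodic_primitiveI:
  fixes F :: "real^'n \<Rightarrow> real"
  assumes F: "\<And>y. (F has_derivative (\<lambda>w. \<eta> (torus_point y w))) (at y)"
  shows "\<exists>a. periodic_primitive \<eta> F a"
proof -
  have "\<exists>A. \<forall>y. F (y + k) = F y + A" if k: "int_vec k" for k
  proof -
    have "((\<lambda>y. F (y + k) - F y) has_derivative (\<lambda>w. 0)) (at y within UNIV)" for y
    proof -
      have "((\<lambda>y. y + k) has_derivative (\<lambda>w. w)) (at y)" by (auto intro!: derivative_eq_intros)
      from has_derivative_compose[OF this F]
      have "((\<lambda>y. F (y + k)) has_derivative (\<lambda>w. \<eta> (torus_point y w))) (at y)"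
        by (simp add: torus_point_add[OF k])
      from has_derivative_diff[OF this F[of y]] show ?thesis by simp
    qed
    then have "\<exists>c. \<forall>y\<in>UNIV. F (y + k) - F y = c"
      by (intro has_derivative_zero_constant) auto
    then obtain c where "\<And>y. F (y + k) - F y = c" by auto
    then show ?thesis by (intro exI[of _ c]) (metis add.commute diff_add_cancel)
  qed
  then obtain A where A: "\<And>y k. int_vec k \<Longrightarrow> F (y + k) = F y + A k" by metis
  then show ?thesis
    using F int_vec_additive[OF A] unfolding periodic_primitive_def by metis
qed

text \<open>Smoothness and closedness of the pullback are local and are read off at each point in
  the chart centred there; on the simply connected cover the form then has a primitive.\<close>

lemma closed_form_periodic_primitive:
  fixes \<eta> :: "(real^'n) set \<times> ((real^'n) set, real^'n) tvector \<Rightarrow> real"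
  assumes \<eta>: "closed_form torus \<eta>"
  obtains F a where "periodic_primitive \<eta> F a"
proof -
  define E where "E y w = \<eta> (torus_point y w)" for y w
  let ?D = "\<lambda>y w. frechet_derivative (\<lambda>z. E z w) (at y)"
  have coord: "form_coord torus \<eta> (torus_chart a) y w = E y w" if "y \<in> ball a (1/2)" for a y w
    using form_coord_torus[OF torus_chart_atlas, of y a \<eta> w] that by (simp add: E_def)
  have smooth: "smooth_form torus \<eta>" using \<eta> by (simp add: closed_form_def)
  have chart: "snd (torus_chart a) ` fst (torus_chart a) = ball a (1/2)" for a :: "real^'n" by simp
  have Ck: "Ck_on k (ball a (1/2)) (\<lambda>y. E y w)" for k a w
  proof (rule iffD1[OF Ck_on_cong_open])
    show "Ck_on k (ball a (1/2)) (\<lambda>y. form_coord torus \<eta> (torus_chart a) y w)"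
      using smooth torus_chart_atlas[of a] unfolding smooth_form_def smooth_on_def
        chart[symmetric] by blast
  qed (simp_all add: coord)
  have lin: "linear (E y)" for y
  proof -
    have "linear (form_coord torus \<eta> (torus_chart y) y)"
      using smooth torus_chart_atlas[of y] chart[of y] unfolding smooth_form_def
        by (metis centre_in_ball half_gt_zero zero_less_one)
    moreover have "form_coord torus \<eta> (torus_chart y) y = E y" by (rule ext) (simp add: coord)
    ultimately show ?thesis by simp
  qed
  have deriv: "((\<lambda>z. E z w) has_derivative ?D y w) (at y)" for y w
    using Ck[of "Suc 0" y w] by (auto simp: frechet_derivative_works[symmetric])
  have cont: "continuous_on UNIV (\<lambda>y. ?D y w u)" for w u
  proof (rule continuous_at_imp_continuous_on, rule ballI)
    fix y
    have "continuous_on (ball y (1/2)) (\<lambda>y. ?D y w u)" using Ck[of "Suc 0" y w] by simp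
    then show "isCont (\<lambda>y. ?D y w u) y" by (simp add: continuous_on_eq_continuous_at)
  qed
  have sym: "?D y w u = ?D y u w" for y u w
  proof -
    have D_eq: "frechet_derivative (\<lambda>z. form_coord torus \<eta> (torus_chart y) z w) (at y) = ?D y w"
      for w
      by (rule frechet_derivative_cong_open(1)[of "ball y (1/2)"]) (simp_all add: coord)
    have "\<forall>z\<in>snd (torus_chart y) ` fst (torus_chart y). \<forall>u w.
        frechet_derivative (\<lambda>z. form_coord torus \<eta> (torus_chart y) z w) (at z) u =
        frechet_derivative (\<lambda>z. form_coord torus \<eta> (torus_chart y) z u) (at z) w"
      using \<eta> torus_chart_atlas unfolding closed_form_def by blast
    moreover have "y \<in> snd (torus_chart y) ` fst (torus_chart y)" unfolding chart by simp
    ultimately have "frechet_derivative (\<lambda>z. form_coord torus \<eta> (torus_chart y) z w) (at y) u =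
        frechet_derivative (\<lambda>z. form_coord torus \<eta> (torus_chart y) z u) (at y) w" by blast
    then show ?thesis by (simp only: D_eq)
  qed
  obtain F where "\<And>y. (F has_derivative E y) (at y)"
    using poincare_lemma[OF lin deriv cont sym] by blast
  then have "\<And>y. (F has_derivative (\<lambda>w. \<eta> (torus_point y w))) (at y)" by (simp add: E_def[abs_def])
  then show ?thesis using periodic_primitiveI that by blast
qed

section \<open>Integration along continuous paths and lifting of paths\<close>

lemma (in smooth_manifold) primitive_along_unique:
  assumes \<gamma>: "continuous_map (top_of_set {0..1}) (mtop M) \<gamma>"
    and F: "primitive_along M \<eta> \<gamma> F" and G: "primitive_along M \<eta> \<gamma> G"
  shows "F 1 - F 0 = G 1 - G 0"
proof -
  \<comment> \<open>Two local primitives of the same form differ by a constant on a small ball in a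
    chart, so \<open>F - G\<close> is locally constant along the path. This makes the definite
    description in \<open>path_integral\<close> meaningful.\<close>
  have loc: "\<exists>\<epsilon>>0. \<forall>s\<in>{0..1}. \<bar>s - t\<bar> < \<epsilon> \<longrightarrow> F s - G s = F t - G t" if t: "t \<in> {0..1}" for t
  proof -
    obtain U f \<epsilon>1 where U: "local_primitive M \<eta> U f" "\<epsilon>1 > 0"
      and f: "\<And>s. s \<in> {0..1} \<Longrightarrow> \<bar>s - t\<bar> < \<epsilon>1 \<Longrightarrow> \<gamma> s \<in> U \<and> F s - F t = f (\<gamma> s) - f (\<gamma> t)"
      using F t unfolding primitive_along_def by meson
    obtain V g \<epsilon>2 where V: "local_primitive M \<eta> V g" "\<epsilon>2 > 0"
      and g: "\<And>s. s \<in> {0..1} \<Longrightarrow> \<bar>s - t\<bar> < \<epsilon>2 \<Longrightarrow> \<gamma> s \<in> V \<and> G s - G t = g (\<gamma> s) - g (\<gamma> t)"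
      using G t unfolding primitive_along_def by meson
    have xU: "\<gamma> t \<in> U" "\<gamma> t \<in> V" using f[OF t] g[OF t] U(2) V(2) by auto
    have op: "openin (mtop M) (U \<inter> V)" using U(1) V(1) unfolding local_primitive_def by blast
    have "\<gamma> t \<in> topspace (mtop M)" using openin_subset[OF op] xU by blast
    then obtain c where c: "c \<in> atlas M" "\<gamma> t \<in> fst c" using charts_cover by blast
    have "open (snd c ` (fst c \<inter> (U \<inter> V)))" by (rule chart_image_openin[OF c(1) op])
    moreover have "snd c (\<gamma> t) \<in> snd c ` (fst c \<inter> (U \<inter> V))" using c xU by blast
    ultimately obtain r where r: "r > 0" "ball (snd c (\<gamma> t)) r \<subseteq> snd c ` (fst c \<inter> (U \<inter> V))"
      using open_contains_ball by blast
    let ?B = "ball (snd c (\<gamma> t)) r"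
    have "\<exists>k. \<forall>y\<in>?B. (f \<circ> chart_inv c) y - (g \<circ> chart_inv c) y = k"
    proof (rule has_derivative_zero_constant)
      fix y assume "y \<in> ?B"
      then obtain x where x: "x \<in> fst c" "x \<in> U" "x \<in> V" "y = snd c x" using r(2) by blast
      have ch: "c \<in> charts_at M x" using c x by (simp add: charts_at_def)
      have "((f \<circ> chart_inv c) has_derivative form_coord M \<eta> c y) (at y)"
        using U(1) x ch unfolding local_primitive_def by blast
      moreover have "((g \<circ> chart_inv c) has_derivative form_coord M \<eta> c y) (at y)"
        using V(1) x ch unfolding local_primitive_def by blast
      ultimately have "((\<lambda>y. (f \<circ> chart_inv c) y - (g \<circ> chart_inv c) y) has_derivative (\<lambda>h.
        form_coord M \<eta> c y h - form_coord M \<eta> c y h)) (at y)"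
        by (rule has_derivative_diff)
      then show "((\<lambda>y. (f \<circ> chart_inv c) y - (g \<circ> chart_inv c) y) has_derivative (\<lambda>h. 0)) (at y
        within ?B)"
        by (simp add: has_derivative_at_withinI)
    qed simp
    then obtain k where k: "\<And>y. y \<in> ?B \<Longrightarrow> f (chart_inv c y) - g (chart_inv c y) = k" by auto
    have k': "f x - g x = k" if "x \<in> fst c" "snd c x \<in> ?B" for x using k[OF that(2)] c(1) that(1)
      by simp
    have Nop: "openin (mtop M) {x \<in> fst c. snd c x \<in> ?B}" by (rule chart_nbhd[OF c(1) open_ball])
    have "openin (top_of_set {0..1}) {s \<in> {0..1}. \<gamma> s \<in> {x \<in> fst c. snd c x \<in> ?B}}"
      using openin_continuous_map_preimage[OF \<gamma> Nop] by simp
    moreover have "t \<in> {s \<in> {0..1}. \<gamma> s \<in> {x \<in> fst c. snd c x \<in> ?B}}" using t c r(1) by simp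
    ultimately obtain \<epsilon>3 where \<epsilon>3: "\<epsilon>3 > 0"
      "\<And>s. s \<in> {0..1} \<Longrightarrow> dist s t < \<epsilon>3 \<Longrightarrow> s \<in> {s \<in> {0..1}. \<gamma> s \<in> {x \<in> fst c. snd c x \<in> ?B}}"
      unfolding openin_euclidean_subtopology_iff by blast
    show ?thesis
    proof (intro exI[of _ "min \<epsilon>1 (min \<epsilon>2 \<epsilon>3)"] conjI ballI impI)
      fix s assume s: "s \<in> {0..1}" "\<bar>s - t\<bar> < min \<epsilon>1 (min \<epsilon>2 \<epsilon>3)"
      have "f (\<gamma> s) - g (\<gamma> s) = k" using \<epsilon>3(2)[OF s(1)] s(2)
        by (intro k') (auto simp: dist_real_def)
      moreover have "f (\<gamma> t) - g (\<gamma> t) = k" using c r(1) by (intro k') auto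
      moreover have "F s - F t = f (\<gamma> s) - f (\<gamma> t)" using f[OF s(1)] s(2) by simp
      moreover have "G s - G t = g (\<gamma> s) - g (\<gamma> t)" using g[OF s(1)] s(2) by simp
      ultimately show "F s - G s = F t - G t" by linarith
    qed (use U(2) V(2) \<epsilon>3(1) in simp)
  qed
  have "\<exists>k. \<forall>t\<in>{0..1::real}. F t - G t = k"
  proof (rule has_derivative_zero_constant)
    fix t :: real assume t: "t \<in> {0..1}"
    obtain \<epsilon> where \<epsilon>: "\<epsilon> > 0" "\<And>s. s \<in> {0..1} \<Longrightarrow> \<bar>s - t\<bar> < \<epsilon> \<Longrightarrow> F t - G t = F s - G s"
      using loc[OF t] by metis
    show "((\<lambda>t. F t - G t) has_derivative (\<lambda>h. 0)) (at t within {0..1})"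
      by (rule has_derivative_transform_within[OF has_derivative_const[of "F t - G t"] \<epsilon>(1) t])
         (use \<epsilon>(2) in \<open>auto simp: dist_real_def\<close>)
  qed simp
  then obtain k where "\<And>t. t \<in> {0..1} \<Longrightarrow> F t - G t = k" by blast
  from this[of 0] this[of 1] show ?thesis by simp
qed

lemma (in smooth_manifold) path_integral_eq:
  assumes "continuous_map (top_of_set {0..1}) (mtop M) \<gamma>" "primitive_along M \<eta> \<gamma> F"
  shows "path_integral M \<eta> \<gamma> = F 1 - F 0"
  unfolding path_integral_def
proof (rule the_equality)
  show "\<exists>G. primitive_along M \<eta> \<gamma> G \<and> F 1 - F 0 = G 1 - G 0" using assms(2) by blast
  fix I assume "\<exists>G. primitive_along M \<eta> \<gamma> G \<and> I = G 1 - G 0"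
  then obtain G where "primitive_along M \<eta> \<gamma> G" "I = G 1 - G 0" by blast
  then show "I = F 1 - F 0" using primitive_along_unique[OF assms] by simp
qed

lemma local_primitive_torus:
  fixes F :: "real^'n \<Rightarrow> real"
  assumes F: "\<And>y. (F has_derivative (\<lambda>w. \<eta> (torus_point y w))) (at y)"
  shows "local_primitive torus \<eta> (torus_proj ` ball a (1/2)) (F \<circ> snd (torus_chart a))"
  unfolding local_primitive_def
proof (intro conjI ballI)
  show "openin (mtop torus) (torus_proj ` ball a (1/2))" by (simp add: openin_torus_image)
  fix x c assume x: "x \<in> torus_proj ` ball a (1/2)" and "c \<in> charts_at torus x"
  then have c: "c \<in> atlas torus" "x \<in> fst c" by (simp_all add: charts_at_def)
  obtain y where y: "y \<in> ball a (1/2)" "x = torus_proj y" using x by blast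
  have "snd (torus_chart a) x = y" using y by simp
  then have "transition c (torus_chart a) (snd c x) = y" using torus.transition_chart[OF c] by simp
  moreover have "(transition c (torus_chart a) has_derivative (\<lambda>w. w)) (at (snd c x))"
    using c x by (intro transition_torus_derivative) simp_all
  ultimately have "((\<lambda>z. F (transition c (torus_chart a) z)) has_derivative (\<lambda>w. \<eta> (torus_point y
    w))) (at (snd c x))"
    using has_derivative_compose[OF _ F, of "transition c (torus_chart a)" "\<lambda>w. w" "snd c x" UNIV]
      by simp
  moreover have "F \<circ> snd (torus_chart a) \<circ> chart_inv c = (\<lambda>z. F (transition c (torus_chart a) z))"
    by (simp add: fun_eq_iff transition_def)
  moreover have "form_coord torus \<eta> c (snd c x) = (\<lambda>w. \<eta> (torus_point y w))"
    using c y by (simp add: fun_eq_iff form_coord_def tvec_torus torus_point_def)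
  ultimately show "((F \<circ> snd (torus_chart a) \<circ> chart_inv c) has_derivative form_coord torus \<eta> c
    (snd c x)) (at (snd c x))"
    by simp
qed

text \<open>The primitive along the path is \<open>F\<close> composed with the lift: while the lift
  stays within 1/2 of its value at time t, it is the path read in the chart centred at that
  value.\<close>

lemma path_integral_torus:
  fixes F :: "real^'n \<Rightarrow> real"
  assumes F: "\<And>y. (F has_derivative (\<lambda>w. \<eta> (torus_point y w))) (at y)"
    and \<gamma>: "continuous_map (top_of_set {0..1}) torus_topology \<gamma>"
    and lift: "continuous_on {0..1} \<gamma>'" "\<And>t. t \<in> {0..1} \<Longrightarrow> torus_proj (\<gamma>' t) = \<gamma> t"
  shows "path_integral torus \<eta> \<gamma> = F (\<gamma>' 1) - F (\<gamma>' 0)"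
proof (rule torus.path_integral_eq)
  show "continuous_map (top_of_set {0..1}) (mtop torus) \<gamma>" using \<gamma> by simp
  show "primitive_along torus \<eta> \<gamma> (\<lambda>t. F (\<gamma>' t))"
    unfolding primitive_along_def
  proof
    fix t :: real assume t: "t \<in> {0..1}"
    obtain d where d: "d > 0" "\<And>s. s \<in> {0..1} \<Longrightarrow> dist s t < d \<Longrightarrow> dist (\<gamma>' s) (\<gamma>' t) < 1/2"
      using lift(1) t unfolding continuous_on_iff by (metis half_gt_zero zero_less_one)
    have ball: "\<gamma>' s \<in> ball (\<gamma>' t) (1/2)" if "s \<in> {0..1}" "\<bar>s - t\<bar> < d" for s
      using d(2)[of s] that by (simp add: dist_real_def dist_commute)
    have chart: "snd (torus_chart (\<gamma>' t)) (\<gamma> s) = \<gamma>' s" "\<gamma> s \<in> torus_proj ` ball (\<gamma>' t) (1/2)"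
      if "s \<in> {0..1}" "\<bar>s - t\<bar> < d" for s
      using ball[OF that] lift(2)[OF that(1)] torus_chart_simps(2) by (metis, metis imageI)
    show "\<exists>U f. local_primitive torus \<eta> U f \<and>
        (\<exists>\<epsilon>>0. \<forall>s\<in>{0..1}. \<bar>s - t\<bar> < \<epsilon> \<longrightarrow> \<gamma> s \<in> U \<and> F (\<gamma>' s) - F (\<gamma>' t) = f (\<gamma> s) - f (\<gamma> t))"
      using local_primitive_torus[OF F, of "\<gamma>' t"] chart t d(1)
      by (intro exI[of _ "torus_proj ` ball (\<gamma>' t) (1/2)"] exI[of _ "F \<circ> snd (torus_chart (\<gamma>'
        t))"] conjI
          exI[of _ d]) auto
  qed
qed

text \<open>The interval is contractible, so each circle coordinate of the path has a continuous
  logarithm; its imaginary part divided by 2 pi is a coordinate of the lift.\<close>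

lemma torus_path_lift:
  fixes \<gamma> :: "real \<Rightarrow> (real^'n) set"
  assumes \<gamma>: "continuous_map (top_of_set {0..1}) torus_topology \<gamma>"
  obtains \<gamma>' where "continuous_on {0..1} \<gamma>'" "\<And>t. t \<in> {0..1} \<Longrightarrow> torus_proj (\<gamma>' t) = \<gamma> t"
proof -
  have "\<exists>g. continuous_on {0..1} g \<and> (\<forall>t\<in>{0..1}. circle_coord i (\<gamma> t) = exp (g t))" for i
  proof -
    have "continuous_on {0..1} (\<lambda>t. circle_coord i (\<gamma> t))"
      using continuous_map_compose[OF \<gamma> continuous_circle_coord[of i]] by (simp add: o_def)
    moreover have "circle_coord i (\<gamma> t) \<noteq> 0" for t by (simp add: circle_coord_def)
    moreover have "contractible {0..1::real}" by (intro convex_imp_contractible) simp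
    ultimately show ?thesis by (metis continuous_logarithm_on_contractible)
  qed
  then obtain g where g: "\<And>i. continuous_on {0..1} (g i)"
    "\<And>i t. t \<in> {0..1} \<Longrightarrow> circle_coord i (\<gamma> t) = exp (g i t)" by metis
  define \<gamma>' where "\<gamma>' t = (\<chi> i. Im (g i t) / (2 * pi))" for t
  show ?thesis
  proof (rule that)
    show "continuous_on {0..1} \<gamma>'"
      unfolding \<gamma>'_def by (intro continuous_on_vec_lambda continuous_intros g(1)) simp
    fix t :: real assume t: "t \<in> {0..1}"
    then have "\<gamma> t \<in> topspace torus_topology" using \<gamma> by (auto simp: continuous_map_def)
    then obtain y where y: "\<gamma> t = torus_proj y" by (auto simp: topspace_torus)
    have "(y - \<gamma>' t) $ i \<in> \<int>" for i
    proof -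
      have "exp (\<i> * of_real (2 * pi * y $ i)) = exp (g i t)"
        using g(2)[OF t, of i] by (simp add: y circle_coord_proj cis_conv_exp)
      then obtain m :: int where "\<i> * of_real (2 * pi * y $ i) = g i t + (of_int (2 * m) * pi) * \<i>"
        using exp_eq by metis
      then have "Im (\<i> * of_real (2 * pi * y $ i)) = Im (g i t + (of_int (2 * m) * pi) * \<i>)" by simp
      then have "2 * pi * (y $ i) = Im (g i t) + 2 * pi * of_int m" by (simp add: algebra_simps)
      then have "y $ i - \<gamma>' t $ i = of_int m" by (simp add: \<gamma>'_def field_simps)
      then show ?thesis by simp
    qed
    then show "torus_proj (\<gamma>' t) = \<gamma> t" by (simp add: y torus_proj_eq_iff int_vec_def)
  qed
qed

section \<open>Linear functionals on chains and the displacement of a cycle\<close>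

definition chain_eval :: "'a real_chain \<Rightarrow> (((nat \<Rightarrow> real) \<Rightarrow> 'a) \<Rightarrow> real) \<Rightarrow> real" where
  "chain_eval c \<psi> = (\<Sum>\<sigma>\<in>Poly_Mapping.keys c. Poly_Mapping.lookup c \<sigma> * \<psi> \<sigma>)"

lemma chain_eval_superset:
  assumes "finite S" "Poly_Mapping.keys c \<subseteq> S"
  shows "chain_eval c \<psi> = (\<Sum>\<sigma>\<in>S. Poly_Mapping.lookup c \<sigma> * \<psi> \<sigma>)"
  unfolding chain_eval_def using assms by (intro sum.mono_neutral_left) (auto simp: in_keys_iff)

lemma chain_eval_add: "chain_eval (c + d) \<psi> = chain_eval c \<psi> + chain_eval d \<psi>"
proof -
  let ?S = "Poly_Mapping.keys c \<union> Poly_Mapping.keys d"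
  have "Poly_Mapping.keys (c + d) \<subseteq> ?S" by (rule Poly_Mapping.keys_add)
  then show ?thesis
    using chain_eval_superset[of ?S c] chain_eval_superset[of ?S d] chain_eval_superset[of ?S "c +
      d"]
    by (simp add: lookup_add distrib_right sum.distrib)
qed

lemma chain_eval_zero: "chain_eval 0 \<psi> = 0" by (simp add: chain_eval_def)

lemma chain_eval_single: "chain_eval (Poly_Mapping.single \<sigma> r) \<psi> = r * \<psi> \<sigma>"
  using chain_eval_superset[of "{\<sigma>}" "Poly_Mapping.single \<sigma> r" \<psi>] by simp

lemma chain_eval_sum: "finite A \<Longrightarrow> chain_eval (\<Sum>i\<in>A. f i) \<psi> = (\<Sum>i\<in>A. chain_eval (f i) \<psi>)"
  by (induction A rule: finite_induct) (simp_all add: chain_eval_zero chain_eval_add)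

text \<open>The left-hand side is the value on the boundary of \<open>c\<close> of the linear
  functional that evaluates \<phi> at a 0-simplex, and the boundary of a cycle is zero.\<close>

lemma cycle_endpoint_sum:
  assumes "c \<in> real_cycles 1 X"
  shows "(\<Sum>\<sigma>\<in>Poly_Mapping.keys c. Poly_Mapping.lookup c \<sigma> *
      (\<phi> (simplex_path \<sigma> 1) - \<phi> (simplex_path \<sigma> 0))) = (0 :: real)"
proof -
  let ?e = "\<lambda>i::nat. if i = 0 then 1 else (0::real)"
  let ?\<psi> = "\<lambda>\<tau>. \<phi> (\<tau> ?e)"
  have e: "?e \<in> standard_simplex 0" by (auto simp: standard_simplex_def)
  \<comment> \<open>Face 0 omits the initial vertex and leaves the end of the edge, face 1 leaves
    its start; the alternating signs give end minus start.\<close>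
  have face0: "singular_face 1 0 \<sigma> ?e = simplex_path \<sigma> 1" for \<sigma> :: "(nat \<Rightarrow> real) \<Rightarrow> 'a"
  proof -
    have "simplical_face 0 ?e = (\<lambda>i. if i = 0 then 1 - 1 else if i = 1 then 1 else 0)"
      by (auto simp: simplical_face_def fun_eq_iff)
    then show ?thesis using e by (simp add: singular_face_def simplex_path_def)
  qed
  have face1: "singular_face 1 1 \<sigma> ?e = simplex_path \<sigma> 0" for \<sigma> :: "(nat \<Rightarrow> real) \<Rightarrow> 'a"
  proof -
    have "simplical_face 1 ?e = (\<lambda>i. if i = 0 then 1 - 0 else if i = 1 then 0 else 0)"
      by (auto simp: simplical_face_def fun_eq_iff)
    then show ?thesis using e by (simp add: singular_face_def simplex_path_def)
  qed
  have "0 = chain_eval (real_boundary 1 c) ?\<psi>"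
    using assms by (simp add: real_cycles_def chain_eval_zero)
  also have "\<dots> = (\<Sum>\<sigma>\<in>Poly_Mapping.keys c. \<Sum>k\<le>1. (-1) ^ k * Poly_Mapping.lookup c \<sigma> * ?\<psi>
    (singular_face 1 k \<sigma>))"
    by (simp add: real_boundary_def chain_eval_sum chain_eval_single del: sum.atMost_Suc)
  also have "\<dots> = (\<Sum>\<sigma>\<in>Poly_Mapping.keys c. Poly_Mapping.lookup c \<sigma> *
      (\<phi> (simplex_path \<sigma> 1) - \<phi> (simplex_path \<sigma> 0)))"
  proof (rule sum.cong[OF refl])
    fix \<sigma>
    have "{..1::nat} = {0, 1}" by auto
    then show "(\<Sum>k\<le>1. (-1) ^ k * Poly_Mapping.lookup c \<sigma> * ?\<psi> (singular_face 1 k \<sigma>)) =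
        Poly_Mapping.lookup c \<sigma> * (\<phi> (simplex_path \<sigma> 1) - \<phi> (simplex_path \<sigma> 0))"
      using face0 face1 by (simp add: right_diff_distrib)
  qed
  finally show ?thesis by simp
qed

lemma continuous_simplex_path:
  assumes "singular_simplex 1 X \<sigma>"
  shows "continuous_map (top_of_set {0..1}) X (simplex_path \<sigma>)"
proof -
  let ?e = "\<lambda>t (i::nat). if i = 0 then 1 - t else if i = 1 then t else (0::real)"
  have \<sigma>: "continuous_map (subtopology (powertop_real UNIV) (standard_simplex 1)) X \<sigma>"
    using assms by (simp add: singular_simplex_def)
  have "continuous_map (top_of_set {0..1}) (powertop_real UNIV) ?e"
    unfolding continuous_map_componentwise_UNIV
  proof
    fix i :: nat
    show "continuous_map (top_of_set {0..1}) euclideanreal (\<lambda>t. ?e t i)"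
      by (cases "i = 0"; cases "i = 1") (auto intro!: continuous_intros)
  qed
  moreover have "?e t \<in> standard_simplex 1" if "t \<in> {0..1}" for t
  proof -
    have "{..1::nat} = {0, 1}" by auto
    then show ?thesis using that by (auto simp: standard_simplex_def)
  qed
  ultimately have "continuous_map (top_of_set {0..1}) (subtopology (powertop_real UNIV)
    (standard_simplex 1)) ?e"
    by (auto simp: continuous_map_in_subtopology)
  from continuous_map_compose[OF this \<sigma>] show ?thesis by (simp add: o_def simplex_path_def[abs_def])
qed

text \<open>Modulo the differential of a periodic function a closed form has constant coefficients \<open>a\<close>,
  so only the total displacement of the lifted edges of a cycle matters.\<close>

theorem torus_rotation_vector:
  assumes h: "h \<in> H1 (torus :: ((real^'n) set, real^'n) manifold)"
  obtains v where "\<And>\<eta> F a. periodic_primitive \<eta> F a \<Longrightarrow> pairing torus \<eta> h = a \<bullet> v"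
proof -
  obtain c0 where c0: "c0 \<in> real_cycles 1 (torus_topology :: (real^'n) set topology)"
    "h = real_homologous 1 torus_topology `` {c0}"
    using h by (auto simp: H1_def quotient_def)
  \<comment> \<open>\<open>pairing\<close> picks an arbitrary element of the class. That zero is a
    boundary puts \<open>c0\<close> in its own class, so there is an element to pick.\<close>
  have "(0 :: (real^'n) set real_chain) \<in> real_boundary 2 ` real_singular_chains 2 torus_topology"
    by (rule image_eqI[of _ _ 0]) (simp_all add: real_boundary_def real_singular_chains_def)
  then have "c0 \<in> h" using c0 by (simp add: real_homologous_def numeral_2_eq_2)
  define c where "c = (SOME c. c \<in> h)"
  have "c \<in> h" unfolding c_def using \<open>c0 \<in> h\<close> by (rule someI)
  then have c: "c \<in> real_cycles 1 torus_topology" using c0 by (simp add: real_homologous_def)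
  then have path: "continuous_map (top_of_set {0..1}) torus_topology (simplex_path \<sigma>)"
    if "\<sigma> \<in> Poly_Mapping.keys c" for \<sigma>
    using that by (intro continuous_simplex_path) (auto simp: real_cycles_def
      real_singular_chains_def)
  have "\<exists>\<gamma>'. continuous_on {0..1} \<gamma>' \<and> (\<forall>t\<in>{0..1}. torus_proj (\<gamma>' t) = simplex_path \<sigma> t)"
    if "\<sigma> \<in> Poly_Mapping.keys c" for \<sigma>
    using torus_path_lift[OF path[OF that]] by metis
  then obtain \<Gamma> where \<Gamma>: "\<And>\<sigma>. \<sigma> \<in> Poly_Mapping.keys c \<Longrightarrow> continuous_on {0..1} (\<Gamma> \<sigma>)"
    "\<And>\<sigma> t. \<sigma> \<in> Poly_Mapping.keys c \<Longrightarrow> t \<in> {0..1} \<Longrightarrow> torus_proj (\<Gamma> \<sigma> t) = simplex_path \<sigma> t"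
    by metis
  define v where "v = (\<Sum>\<sigma>\<in>Poly_Mapping.keys c. Poly_Mapping.lookup c \<sigma> *\<^sub>R (\<Gamma> \<sigma> 1 - \<Gamma> \<sigma> 0))"
  show ?thesis
  proof (rule that)
    fix \<eta> F and a :: "real^'n" assume prim: "periodic_primitive \<eta> F a"
    then have F: "\<And>y. (F has_derivative (\<lambda>w. \<eta> (torus_point y w))) (at y)"
      and per: "\<And>y k. int_vec k \<Longrightarrow> F (y + k) = F y + a \<bullet> k"
      by (auto simp: periodic_primitive_def)
    \<comment> \<open>The part of the primitive that descends to the torus: subtracting the linear
      function with the same periods leaves a periodic function. Its increments over the edges
      cancel by the cycle condition.\<close>
    define f where "f x = F (inv_into UNIV torus_proj x) - a \<bullet> inv_into UNIV torus_proj x" for x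
    have f: "f (torus_proj y) = F y - a \<bullet> y" for y
    proof -
      define k where "k = inv_into UNIV torus_proj (torus_proj y) - y"
      have eq: "inv_into UNIV torus_proj (torus_proj y) = y + k" by (simp add: k_def)
      have "torus_proj (inv_into UNIV torus_proj (torus_proj y)) = torus_proj y"
        by (rule f_inv_into_f) simp
      then have "int_vec k" unfolding k_def by (simp add: torus_proj_eq_iff[symmetric])
      then show ?thesis by (simp add: f_def eq per inner_add_right)
    qed
    have edge: "path_integral torus \<eta> (simplex_path \<sigma>) =
        a \<bullet> (\<Gamma> \<sigma> 1 - \<Gamma> \<sigma> 0) + (f (simplex_path \<sigma> 1) - f (simplex_path \<sigma> 0))"
      if \<sigma>: "\<sigma> \<in> Poly_Mapping.keys c" for \<sigma>
    proof -
      have "f (simplex_path \<sigma> t) = F (\<Gamma> \<sigma> t) - a \<bullet> \<Gamma> \<sigma> t" if "t \<in> {0..1}" for t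
        using f[of "\<Gamma> \<sigma> t"] \<Gamma>(2)[OF \<sigma> that] by simp
      then show ?thesis
        using path_integral_torus[OF F path[OF \<sigma>] \<Gamma>(1)[OF \<sigma>] \<Gamma>(2)[OF \<sigma>]]
          by (simp add: inner_diff_right)
    qed
    have "pairing torus \<eta> h = (\<Sum>\<sigma>\<in>Poly_Mapping.keys c. Poly_Mapping.lookup c \<sigma> * (a \<bullet> (\<Gamma> \<sigma> 1 - \<Gamma> \<sigma>
      0)))
       + (\<Sum>\<sigma>\<in>Poly_Mapping.keys c. Poly_Mapping.lookup c \<sigma> * (f (simplex_path \<sigma> 1) - f
         (simplex_path \<sigma> 0)))"
      unfolding pairing_def c_def[symmetric] chain_integral_def sum.distrib[symmetric]
      by (intro sum.cong refl) (simp add: edge distrib_left)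
    then show "pairing torus \<eta> h = a \<bullet> v"
      by (simp add: cycle_endpoint_sum[OF c] v_def inner_sum_right)
  qed
qed

section \<open>Invariant measures on the torus\<close>

definition unit_uniform :: "real measure" where
  "unit_uniform = density lborel (\<lambda>x. ennreal (indicator {0..1} x))"

text \<open>A product over functions instead of vectors, so that one coordinate can be split off and
  integrated first.\<close>

definition cube_measure :: "('n::finite \<Rightarrow> real) measure" where
  "cube_measure = Pi\<^sub>M UNIV (\<lambda>_. unit_uniform)"

lemma sets_unit_uniform [measurable_cong]: "sets unit_uniform = sets borel"
  and space_unit_uniform: "space unit_uniform = UNIV"
  by (simp_all add: unit_uniform_def)

lemma emeasure_unit_uniform: "A \<in> sets borel \<Longrightarrow> emeasure unit_uniform A =
  emeasure lborel ({0..1} \<inter> A)"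
  unfolding unit_uniform_def
  by (subst emeasure_density) (auto simp: indicator_inter_arith ennreal_indicator simp flip:
    nn_integral_indicator)

lemma prob_space_unit_uniform: "prob_space unit_uniform"
  by (intro prob_spaceI) (simp add: space_unit_uniform emeasure_unit_uniform)

lemma prob_space_cube: "prob_space cube_measure"
  unfolding cube_measure_def by (rule prob_space_PiM[OF prob_space_unit_uniform])

lemma space_cube: "space cube_measure = UNIV"
  by (simp add: cube_measure_def space_PiM space_unit_uniform)

lemma measurable_cube_vec: "(\<lambda>\<omega>. \<chi> i. \<omega> i) \<in> borel_measurable cube_measure"
proof (rule borel_measurable_euclidean_space[THEN iffD2], rule ballI)
  fix b :: "real^'n" assume "b \<in> Basis"
  then obtain i where b: "b = axis i 1" by (auto simp: Basis_vec_def)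
  have "(\<lambda>\<omega>. \<omega> i) \<in> measurable cube_measure unit_uniform"
    unfolding cube_measure_def by (rule measurable_component_singleton) simp
  then have "(\<lambda>\<omega>. \<omega> i) \<in> borel_measurable cube_measure"
    using measurable_cong_sets[OF refl sets_unit_uniform] by blast
  then show "(\<lambda>\<omega>. (\<chi> i. \<omega> i) \<bullet> b) \<in> borel_measurable cube_measure" by (simp add: b inner_axis)
qed

definition torus_measure :: "real^'n \<Rightarrow> ((real^'n) set \<times> ((real^'n) set,
  real^'n) tvector) measure" where
  "torus_measure v = distr cube_measure (sigma (TM torus) {W. openin (TM_topology torus) W})
     (\<lambda>\<omega>. torus_point (\<chi> i. \<omega> i) v)"

lemma torus_point_measurable:
  fixes v :: "real^'n"
  shows "(\<lambda>y. torus_point y v) \<in> measurable borel (sigma (TM torus) {W. openin (TM_topology torus)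
    W})"
proof -
  have sp: "{W. openin (TM_topology torus) W} \<subseteq> Pow (TM (torus :: ((real^'n) set,
    real^'n) manifold))"
    using openin_subset by (fastforce simp: torus.topspace_TM[symmetric])
  show ?thesis
  proof (rule measurable_sigma_sets[OF _ sp])
    show "sets (sigma (TM torus) {W. openin (TM_topology torus) W}) =
      sigma_sets (TM (torus :: ((real^'n) set, real^'n) manifold)) {W. openin (TM_topology torus)
        W}"
      by (rule sets_measure_of[OF sp])
    show "(\<lambda>y. torus_point y v) \<in> space borel \<rightarrow> TM torus" by (simp add: torus_point_in)
    fix W :: "((real^'n) set \<times> ((real^'n) set, real^'n) tvector) set" assume "W \<in>
      {W. openin (TM_topology torus) W}"
    then have W: "openin (TM_topology torus) W" by simp
    have "open {z :: (real^'n) \<times> (real^'n). torus_point (fst z) (snd z) \<in> W}"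
      using openin_continuous_map_preimage[OF continuous_torus_point W] by simp
    then have "open ((\<lambda>y. (y, v)) -` {z. torus_point (fst z) (snd z) \<in> W})"
      by (rule open_vimage) (intro continuous_intros)
    then show "(\<lambda>y. torus_point y v) -` W \<inter> space borel \<in> sets borel" by (simp add: vimage_def)
  qed
qed

lemma torus_measure_measurable:
  "(\<lambda>\<omega>. torus_point (\<chi> i. \<omega> i) v) \<in> measurable cube_measure (sigma (TM torus) {W. openin
    (TM_topology torus) W})"
  by (rule measurable_compose[OF measurable_cube_vec torus_point_measurable])

lemma torus_measure_borel:
  fixes v :: "real^'n"
  shows "borel_probability (TM_topology torus) (torus_measure v)"
proof -
  have sp: "{W. openin (TM_topology torus) W} \<subseteq> Pow (TM (torus :: ((real^'n) set,
    real^'n) manifold))"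
    using openin_subset by (fastforce simp: torus.topspace_TM[symmetric])
  show ?thesis
    unfolding borel_probability_eq torus_measure_def torus.topspace_TM
    by (intro conjI prob_space.prob_space_distr[OF prob_space_cube torus_measure_measurable])
       (use sp in \<open>simp_all add: space_measure_of\<close>)
qed

lemma torus_function_continuous:
  fixes v :: "real^'n"
  assumes "continuous_map (TM_topology torus) euclideanreal f"
  shows "continuous_on UNIV (\<lambda>y :: real^'n. f (torus_point y v))"
proof -
  have "continuous_on UNIV (\<lambda>z :: (real^'n) \<times> (real^'n). f (torus_point (fst z) (snd z)))"
    using continuous_map_compose[OF continuous_torus_point assms] by (simp add: o_def)
  moreover have "continuous_on UNIV (\<lambda>y. (y, v))" by (intro continuous_intros)
  ultimately show ?thesis using continuous_on_compose2[of UNIV _ UNIV "\<lambda>y. (y, v)"] by fastforce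
qed

lemma torus_function_bounded:
  fixes v :: "real^'n"
  assumes "continuous_map (TM_topology torus) euclideanreal f"
  obtains B where "\<And>y. \<bar>f (torus_point y v)\<bar> \<le> B"
proof -
  have "compact ((\<lambda>y. f (torus_point y v)) ` cbox 0 1)"
    by (intro compact_continuous_image continuous_on_subset[OF torus_function_continuous[OF
      assms]]) auto
  from compact_imp_bounded[OF this] obtain B
    where B: "\<forall>z\<in>(\<lambda>y. f (torus_point y v)) ` cbox 0 1. norm z \<le> B" unfolding bounded_iff by blast
  have "\<bar>f (torus_point y v)\<bar> \<le> B" for y
  proof -
    obtain k where k: "int_vec k" "\<And>i. 0 \<le> (y + k) $ i" "\<And>i. (y + k) $ i < 1" using int_vec_reduce
      by blast
    then have "y + k \<in> cbox 0 1" by (auto simp: mem_box_cart less_imp_le)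
    then have "f (torus_point (y + k) v) \<in> (\<lambda>y. f (torus_point y v)) ` cbox 0 1" by blast
    from bspec[OF B this] show ?thesis by (simp add: torus_point_add[OF k(1)])
  qed
  then show ?thesis by (rule that)
qed

lemma cube_integrable:
  assumes "continuous_on UNIV f" "\<And>y. \<bar>f y\<bar> \<le> B"
  shows "integrable cube_measure (\<lambda>\<omega>. f (\<chi> i. \<omega> i) :: real)"
proof -
  interpret prob_space cube_measure by (rule prob_space_cube)
  show ?thesis
    using assms(2)
    by (intro integrable_const_bound[where B=B] measurable_compose[OF measurable_cube_vec]
        borel_measurable_continuous_onI[OF assms(1)]) auto
qed

lemma torus_measure_integral:
  fixes v :: "real^'n"
  assumes f: "continuous_map (TM_topology torus) euclideanreal f"
  shows "integrable (torus_measure v) f"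
    and "(\<integral>p. f p \<partial>torus_measure v) = (\<integral>\<omega>. f (torus_point (\<chi> i. \<omega> i) v) \<partial>cube_measure)"
proof -
  obtain B where B: "\<And>y. \<bar>f (torus_point y v)\<bar> \<le> B" using torus_function_bounded[OF f] by blast
  have f_meas: "f \<in> borel_measurable (sigma (TM torus) {W. openin (TM_topology torus) W})"
    using borel_probability_measurable[OF torus_measure_borel f] by (simp add: torus_measure_def)
  have "integrable cube_measure (\<lambda>\<omega>. f (torus_point (\<chi> i. \<omega> i) v))"
    using cube_integrable[OF torus_function_continuous[OF f] B] .
  then show "integrable (torus_measure v) f"
    unfolding torus_measure_def by (subst integrable_distr_eq[OF torus_measure_measurable f_meas])
  show "(\<integral>p. f p \<partial>torus_measure v) = (\<integral>\<omega>. f (torus_point (\<chi> i. \<omega> i) v) \<partial>cube_measure)"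
    unfolding torus_measure_def by (rule integral_distr[OF torus_measure_measurable f_meas])
qed

text \<open>With the other coordinates fixed, the integral over coordinate \<open>i\<close> is, by
  the fundamental theorem of calculus, the increment of \<open>F\<close> between opposite faces of
  the cube. This is the period \<open>a\<close>, whatever the other coordinates are.\<close>

lemma cube_integral_derivative:
  fixes F :: "real^'n \<Rightarrow> real"
  assumes F: "\<And>y. (F has_derivative E y) (at y)" and cont: "continuous_on UNIV (\<lambda>y. E y (axis i 1))"
    and bd: "\<And>y. \<bar>E y (axis i 1)\<bar> \<le> B" and per: "\<And>y. F (y + axis i 1) = F y + a"
  shows "(\<integral>\<omega>. E (\<chi> j. \<omega> j) (axis i 1) \<partial>cube_measure) = a"
proof -
  interpret product_sigma_finite "\<lambda>_ :: 'n. unit_uniform"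
    using prob_space_unit_uniform by (simp add: product_sigma_finite_def
      prob_space_imp_sigma_finite)
  let ?J = "UNIV - {i}"
  have ins: "insert i ?J = UNIV" by blast
  have int: "integrable (Pi\<^sub>M (insert i ?J) (\<lambda>_. unit_uniform)) (\<lambda>\<omega>. E (\<chi> j. \<omega> j) (axis i 1))"
    unfolding ins using cube_integrable[OF cont bd] by (simp add: cube_measure_def)
  have inner: "(\<integral>s. E (\<chi> j. (x(i := s)) j) (axis i 1) \<partial>unit_uniform) = a" for x :: "'n \<Rightarrow> real"
  proof -
    define X where "X s = (\<chi> j. (x(i := s)) j)" for s
    have X: "X s = X 0 + s *\<^sub>R axis i 1" for s by (simp add: X_def vec_eq_iff axis_def)
    have X': "X = (\<lambda>s. X 0 + s *\<^sub>R axis i 1)" by (rule ext) (rule X)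
    have X_cont: "continuous_on UNIV X"
      by (subst X') (intro continuous_intros)
    have E_cont: "continuous_on UNIV (\<lambda>s. E (X s) (axis i 1))"
      by (rule continuous_on_compose2[OF cont X_cont]) simp
    have "((\<lambda>s. F (X s)) has_real_derivative E (X s) (axis i 1)) (at s)" for s
    proof -
      have "(X has_derivative (\<lambda>h. h *\<^sub>R axis i 1)) (at s)"
        by (subst X') (auto intro!: derivative_eq_intros)
      from has_derivative_compose[OF this F]
      have "((\<lambda>s. F (X s)) has_derivative (\<lambda>h. E (X s) (h *\<^sub>R axis i 1))) (at s)" .
      then show ?thesis
        using linear_scale[OF has_derivative_linear[OF F]]
        by (simp add: has_field_derivative_def mult_commute_abs)
    qed
    then have "(\<integral>s. E (X s) (axis i 1) * indicator {0..1} s \<partial>lborel) = F (X 1) - F (X 0)"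
      using E_cont by (intro integral_FTC_Icc_real) (auto simp: continuous_on_eq_continuous_at)
    moreover have "(\<integral>s. E (X s) (axis i 1) \<partial>unit_uniform) =
      (\<integral>s. indicator {0..1} s *\<^sub>R E (X s) (axis i 1) \<partial>lborel)"
      unfolding unit_uniform_def
      by (intro integral_density) (auto intro: borel_measurable_continuous_onI[OF E_cont])
    moreover have "F (X 1) - F (X 0) = a" using per[of "X 0"] X[of 1] by simp
    ultimately have "(\<integral>s. E (X s) (axis i 1) \<partial>unit_uniform) = a" by (simp add: mult.commute)
    then show ?thesis unfolding X_def .
  qed
  interpret J: prob_space "Pi\<^sub>M ?J (\<lambda>_. unit_uniform)"
    by (rule prob_space_PiM[OF prob_space_unit_uniform])
  have "(\<integral>\<omega>. E (\<chi> j. \<omega> j) (axis i 1) \<partial>cube_measure) =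
     (\<integral>x. (\<integral>s. E (\<chi> j. (x(i := s)) j) (axis i 1) \<partial>unit_uniform) \<partial>Pi\<^sub>M ?J (\<lambda>_. unit_uniform))"
    unfolding cube_measure_def using product_integral_insert[OF _ _ int] unfolding ins by simp
  also have "\<dots> = a" unfolding inner by (simp add: J.prob_space)
  finally show ?thesis .
qed

text \<open>By linearity only the axis directions matter, and the mean of the form in direction
  \<open>i\<close> is its period there, the \<open>i\<close>-th entry of \<open>a\<close>.\<close>

lemma torus_measure_form:
  fixes v :: "real^'n"
  assumes \<eta>: "continuous_form torus \<eta>" and prim: "periodic_primitive \<eta> F a"
  shows "(\<integral>p. \<eta> p \<partial>torus_measure v) = a \<bullet> v"
proof -
  note \<eta>_cont = torus.continuous_form_continuous[OF \<eta>]
  have F: "\<And>y. (F has_derivative (\<lambda>w. \<eta> (torus_point y w))) (at y)"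
    and per: "\<And>y k. int_vec k \<Longrightarrow> F (y + k) = F y + a \<bullet> k"
    using prim by (auto simp: periodic_primitive_def)
  have lin: "linear (\<lambda>w. \<eta> (torus_point y w))" for y using has_derivative_linear[OF F] .
  have exp: "\<eta> (torus_point y v) = (\<Sum>i\<in>UNIV. v $ i * \<eta> (torus_point y (axis i 1)))" for y
  proof -
    have "v = (\<Sum>i\<in>UNIV. (v $ i) *\<^sub>R axis i 1)"
      by (simp add: vec_eq_iff axis_def if_distrib[of "\<lambda>x. _ * x"] cong: if_cong)
    then have "\<eta> (torus_point y v) = \<eta> (torus_point y (\<Sum>i\<in>UNIV. (v $ i) *\<^sub>R axis i 1))" by simp
    then show ?thesis by (simp add: linear_sum[OF lin] linear_scale[OF lin])
  qed
  have int: "integrable cube_measure (\<lambda>\<omega>. \<eta> (torus_point (\<chi> j. \<omega> j) (axis i 1)))" for i :: 'n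
    by (metis cube_integrable[OF torus_function_continuous[OF \<eta>_cont]] torus_function_bounded[OF
      \<eta>_cont])
  have comp: "(\<integral>\<omega>. \<eta> (torus_point (\<chi> j. \<omega> j) (axis i 1)) \<partial>cube_measure) = a $ i" for i :: 'n
  proof -
    obtain B where B: "\<And>y. \<bar>\<eta> (torus_point y (axis i 1 :: real^'n))\<bar> \<le> B"
      using torus_function_bounded[OF \<eta>_cont] by blast
    show ?thesis
      by (rule cube_integral_derivative[OF F torus_function_continuous[OF \<eta>_cont] B])
         (simp add: per int_vec_simps inner_axis)
  qed
  have "(\<integral>p. \<eta> p \<partial>torus_measure v) = (\<Sum>i\<in>UNIV. v $ i * a $ i)"
    unfolding torus_measure_integral(2)[OF \<eta>_cont] exp using int by (simp add: comp)
  then show ?thesis by (simp add: inner_vec_def mult.commute)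
qed

lemma cube_open_pos:
  fixes y0 :: "real^'n"
  assumes Q: "open Q" "y0 \<in> Q" and y0: "\<And>i. 0 \<le> y0 $ i" "\<And>i. y0 $ i < 1"
  shows "emeasure cube_measure {\<omega>. (\<chi> i. \<omega> i) \<in> Q} > 0"
proof -
  interpret product_sigma_finite "\<lambda>_ :: 'n. unit_uniform"
    using prob_space_unit_uniform by (simp add: product_sigma_finite_def
      prob_space_imp_sigma_finite)
  obtain \<epsilon> where \<epsilon>: "\<epsilon> > 0" "ball y0 \<epsilon> \<subseteq> Q" using Q open_contains_ball by blast
  \<comment> \<open>The Euclidean norm is at most the sum of the coordinate differences, so sides of
    this length keep the box within distance \<open>\<epsilon> / 2\<close> of \<open>y0\<close>. The
    box extends upwards only; since each coordinate of \<open>y0\<close> is below 1, it meets the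
    unit cube in a set of positive volume.\<close>
  define \<delta> where "\<delta> = \<epsilon> / (2 * real CARD('n))"
  have \<delta>: "\<delta> > 0" using \<epsilon>(1) by (simp add: \<delta>_def)
  define A where "A i = {y0 $ i .. y0 $ i + \<delta>}" for i
  have sub: "Pi\<^sub>E UNIV A \<subseteq> {\<omega>. (\<chi> i. \<omega> i) \<in> Q}"
  proof
    fix \<omega> assume \<omega>: "\<omega> \<in> Pi\<^sub>E UNIV A"
    have "norm ((\<chi> i. \<omega> i) - y0) \<le> (\<Sum>i\<in>UNIV. \<bar>((\<chi> i. \<omega> i) - y0) $ i\<bar>)" by (rule norm_le_l1_cart)
    also have "\<dots> \<le> (\<Sum>i\<in>(UNIV :: 'n set). \<delta>)"
    proof (rule sum_mono)
      fix i :: 'n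
      have "\<omega> i \<in> A i" using \<omega> by auto
      then show "\<bar>((\<chi> i. \<omega> i) - y0) $ i\<bar> \<le> \<delta>" by (auto simp: A_def)
    qed
    also have "\<dots> < \<epsilon>" using \<epsilon>(1) by (simp add: \<delta>_def)
    finally show "\<omega> \<in> {\<omega>. (\<chi> i. \<omega> i) \<in> Q}"
      using \<epsilon>(2) by (auto simp: dist_norm norm_minus_commute subset_iff)
  qed
  have A_pos: "emeasure unit_uniform (A i) > 0" for i
  proof -
    have "{y0 $ i .. min 1 (y0 $ i + \<delta>)} \<subseteq> {0..1} \<inter> A i" using y0(1)[of i] by (auto simp: A_def)
    then have "emeasure lborel {y0 $ i .. min 1 (y0 $ i + \<delta>)} \<le> emeasure unit_uniform (A i)"
      by (simp add: emeasure_unit_uniform A_def emeasure_mono)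
    moreover have "emeasure lborel {y0 $ i .. min 1 (y0 $ i + \<delta>)} > 0" using y0(2)[of i] \<delta> by simp
    ultimately show ?thesis by (rule order_less_le_trans[rotated])
  qed
  have "emeasure cube_measure (Pi\<^sub>E UNIV A) = (\<Prod>i\<in>UNIV. emeasure unit_uniform (A i))"
    unfolding cube_measure_def by (rule emeasure_PiM) (simp_all add: A_def sets_unit_uniform)
  also have "\<dots> > 0"
  proof -
    have "(\<Prod>i\<in>I. emeasure unit_uniform (A i)) > 0" if "finite I" for I :: "'n set"
      using that A_pos by (induction I rule: finite_induct) (simp_all add:
        ennreal_zero_less_mult_iff)
    then show ?thesis by simp
  qed
  finally have pos: "emeasure cube_measure (Pi\<^sub>E UNIV A) > 0" .
  have "(\<lambda>\<omega>. \<chi> i. \<omega> i) -` Q \<inter> space cube_measure \<in> sets cube_measure"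
    using measurable_sets[OF measurable_cube_vec, of Q] Q(1) by simp
  then have "{\<omega>. (\<chi> i. \<omega> i) \<in> Q} \<in> sets cube_measure" by (simp add: vimage_def space_cube)
  from emeasure_mono[OF sub this] pos show ?thesis by order
qed

text \<open>An integer translation moves \<open>y\<close> into the half-open unit cube without
  changing the point of the bundle, and near every point of that cube the uniform measure charges
  open sets.\<close>

lemma torus_measure_support:
  fixes y v :: "real^'n"
  shows "torus_point y v \<in> msupport (TM_topology torus) (torus_measure v)"
  unfolding msupport_def
proof (intro CollectI conjI allI impI)
  show "torus_point y v \<in> topspace (TM_topology torus)"
    by (simp add: torus.topspace_TM torus_point_in)
  fix W assume W: "openin (TM_topology torus) W \<and> torus_point y v \<in> W"
  define Q where "Q = {y. torus_point y v \<in> W}"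
  have "open {z :: (real^'n) \<times> (real^'n). torus_point (fst z) (snd z) \<in> W}"
    using openin_continuous_map_preimage[OF continuous_torus_point conjunct1[OF W]] by simp
  then have "open ((\<lambda>y. (y, v)) -` {z. torus_point (fst z) (snd z) \<in> W})"
    by (rule open_vimage) (intro continuous_intros)
  then have Q: "open Q" by (simp add: vimage_def Q_def)
  obtain k where k: "int_vec k" "\<And>i. 0 \<le> (y + k) $ i" "\<And>i. (y + k) $ i < 1" using int_vec_reduce
    by blast
  have "y + k \<in> Q" using W by (simp add: Q_def torus_point_add[OF k(1)])
  have "W \<in> sets (torus_measure v)" using W borel_probability_sets_openin[OF torus_measure_borel]
    by blast
  then have "emeasure (torus_measure v) W = emeasure cube_measure ((\<lambda>\<omega>. torus_point (\<chi> i. \<omega> i) v)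
    -` W \<inter> space cube_measure)"
    unfolding torus_measure_def by (intro emeasure_distr torus_measure_measurable) simp
  also have "(\<lambda>\<omega>. torus_point (\<chi> i. \<omega> i) v) -` W \<inter> space cube_measure = {\<omega>. (\<chi> i. \<omega> i) \<in> Q}"
    by (auto simp: Q_def space_cube)
  finally show "emeasure (torus_measure v) W > 0"
    using cube_open_pos[OF Q \<open>y + k \<in> Q\<close> k(2,3)] by simp
qed

section \<open>Integrable Lagrangians\<close>

lemma closed_imp_continuous_form: "closed_form M \<eta> \<Longrightarrow> continuous_form M \<eta>"
  by (simp add: closed_form_def smooth_imp_continuous_form)

text \<open>A form with constant coefficients; on the cover its primitive is \<open>D\<close>
  itself. Through these forms the rotation class fixes the mean of every linear function of the
  velocity.\<close>

lemma linear_velocity_form: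
  fixes D :: "real^'n \<Rightarrow> real"
  assumes D: "linear D"
  shows "closed_form torus (\<lambda>p. D (torus_velocity p))"
    and "periodic_primitive (\<lambda>p. D (torus_velocity p)) D (\<chi> i. D (axis i 1))"
proof -
  let ?\<eta> = "\<lambda>p. D (torus_velocity p)"
  have coord: "form_coord torus ?\<eta> c y w = D w" if "c \<in> atlas torus" "y \<in> snd c ` fst c" for c y w
    using form_coord_torus[OF that, of ?\<eta> w] by simp
  have lin: "linear (form_coord torus ?\<eta> c y)" if "c \<in> atlas torus" "y \<in> snd c ` fst c" for c y
  proof -
    have "form_coord torus ?\<eta> c y = D" by (rule ext) (rule coord[OF that])
    then show ?thesis using D by simp
  qed
  have smooth: "smooth_on (snd c ` fst c) (\<lambda>y. form_coord torus ?\<eta> c y w)" if c: "c \<in> atlas torus"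
    for c w
    unfolding smooth_on_def
  proof
    fix k show "Ck_on k (snd c ` fst c) (\<lambda>y. form_coord torus ?\<eta> c y w)"
      by (rule iffD1[OF Ck_on_cong_open[OF torus.chart_image_open[OF c]] Ck_on_const[of k _ "D w"]])
         (simp add: coord[OF c])
  qed
  have der: "frechet_derivative (\<lambda>z. form_coord torus ?\<eta> c z w) (at y) u = 0"
    if c: "c \<in> atlas torus" and y: "y \<in> snd c ` fst c" for c y w u
  proof -
    have "frechet_derivative (\<lambda>z. form_coord torus ?\<eta> c z w) (at y) =
      frechet_derivative (\<lambda>z. D w) (at y)"
      by (rule frechet_derivative_cong_open(1)[OF torus.chart_image_open[OF c] y]) (rule coord[OF
        c])
    then show ?thesis by (simp add: frechet_derivative_const)
  qed
  have sym: "frechet_derivative (\<lambda>z. form_coord torus ?\<eta> c z w) (at y) u =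
      frechet_derivative (\<lambda>z. form_coord torus ?\<eta> c z u) (at y) w"
    if "c \<in> atlas torus" "y \<in> snd c ` fst c" for c y w u
    by (simp only: der[OF that])
  show "closed_form torus ?\<eta>"
    unfolding closed_form_def smooth_form_def by (intro conjI ballI allI lin smooth sym)
  have repr: "(\<chi> i. D (axis i 1)) \<bullet> k = D k" for k
  proof -
    have "k = (\<Sum>i\<in>UNIV. (k $ i) *\<^sub>R axis i 1)"
      by (simp add: vec_eq_iff axis_def if_distrib[of "\<lambda>x. _ * x"] cong: if_cong)
    then have "D k = D (\<Sum>i\<in>UNIV. (k $ i) *\<^sub>R axis i 1)" by simp
    also have "\<dots> = (\<Sum>i\<in>UNIV. k $ i * D (axis i 1))"
      by (simp add: linear_sum[OF D] linear_scale[OF D])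
    finally show ?thesis by (simp add: inner_vec_def mult.commute)
  qed
  show "periodic_primitive ?\<eta> D (\<chi> i. D (axis i 1))"
    unfolding periodic_primitive_def using linear_imp_has_derivative[OF D] linear_add[OF D]
      by (simp add: repr)
qed

text \<open>An exact form has zero periods because its primitive already lives on the torus. This is
  what makes \<open>torus_measure\<close> closed.\<close>

lemma mdiff_torus_primitive:
  fixes f :: "(real^'n) set \<Rightarrow> real"
  assumes f: "Ck_fun 1 torus f"
  shows "periodic_primitive (mdiff torus f) (\<lambda>y. f (torus_proj y)) 0"
  unfolding periodic_primitive_def
proof (intro conjI allI impI)
  fix y :: "real^'n"
  let ?c = "torus_chart y"
  have y: "y \<in> snd ?c ` fst ?c" by simp
  have "(f \<circ> chart_inv ?c) differentiable (at y)"
    using f torus_chart_atlas y unfolding Ck_fun_def by (metis Ck_on.simps(2) One_nat_def)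
  then have "((f \<circ> chart_inv ?c) has_derivative frechet_derivative (f \<circ> chart_inv ?c) (at y)) (at
    y)"
    by (simp add: frechet_derivative_works[symmetric])
  then have "((\<lambda>y. f (torus_proj y)) has_derivative frechet_derivative (f \<circ> chart_inv ?c) (at y))
    (at y)"
    by (rule has_derivative_transform_within_open[of _ _ _ _ "ball y (1/2)"]) (simp_all add:
      torus_chart_inv)
  moreover have "frechet_derivative (f \<circ> chart_inv ?c) (at y) =
    (\<lambda>w. mdiff torus f (torus_point y w))"
    using torus.mdiff_form_coord[OF f torus_chart_atlas y] form_coord_torus[OF torus_chart_atlas y]
    by (intro ext) metis
  ultimately show "((\<lambda>y. f (torus_proj y)) has_derivative (\<lambda>w. mdiff torus f (torus_point y w)))
    (at y)" by simp
next
  fix y k :: "real^'n" assume "int_vec k"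
  then show "f (torus_proj (y + k)) = f (torus_proj y) + 0 \<bullet> k" by (simp add: torus_proj_add)
qed

lemma torus_measure_rotation:
  assumes g: "riemannian_metric torus g"
    and v: "\<And>\<eta> F a. periodic_primitive \<eta> F a \<Longrightarrow> pairing torus \<eta> h = a \<bullet> v"
  shows "torus_measure v \<in> rotation_fibre torus g h"
proof -
  have "(\<integral>p. mdiff torus f p \<partial>torus_measure v) = 0" if f: "Ck_fun 1 torus f" for f
    using torus_measure_form[OF torus.mdiff_continuous_form[OF f] mdiff_torus_primitive[OF f]]
      by simp
  moreover have "pairing torus \<eta> h = (\<integral>p. \<eta> p \<partial>torus_measure v)" if \<eta>: "closed_form torus \<eta>" for \<eta>
  proof -
    obtain F a where prim: "periodic_primitive \<eta> F a" using closed_form_periodic_primitive[OF \<eta>]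
      by blast
    from torus_measure_form[OF closed_imp_continuous_form[OF \<eta>] prim,
      of v] v[OF prim] show ?thesis by simp
  qed
  ultimately show ?thesis
    using torus_measure_borel[of v] torus_measure_integral(1)[OF torus.continuous_tnorm[OF g], of v]
    by (simp add: rotation_fibre_def closed_measures_def)
qed

text \<open>In a bundle chart the Lagrangian is (y, w) |-> l w, so regularity and positivity of the
  fibre Hessian are read off on the single fibre over \<open>torus_proj 0\<close>.\<close>

lemma tonelli_torus_C2:
  fixes l :: "real^'n \<Rightarrow> real"
  assumes L: "tonelli torus g (l \<circ> torus_velocity)"
  shows "l differentiable (at w)"
    and "(\<lambda>z. frechet_derivative l (at z) b) differentiable (at w)"
    and "b \<noteq> 0 \<Longrightarrow> frechet_derivative (\<lambda>z. frechet_derivative l (at z) b) (at w) b > 0"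
proof -
  let ?c = "torus_chart (0 :: real^'n)" and ?S = "ball (0 :: real^'n) (1/2) \<times> (UNIV :: (real^'n)
    set)"
  have S: "snd ?c ` fst ?c \<times> UNIV = ?S" by simp
  have "Ck_on 2 ?S (l \<circ> torus_velocity \<circ> chart_inv (tchart torus ?c))"
    using torus.Ck_fun_TM[OF _ torus_chart_atlas, of 2 "l \<circ> torus_velocity" 0] L
      by (simp add: tonelli_def)
  moreover have "(l \<circ> torus_velocity \<circ> chart_inv (tchart torus ?c)) z = l (snd z)" if "z \<in> ?S" for z
    using torus.chart_inv_tchart[OF torus_chart_atlas, of z 0] tparam_torus[OF torus_chart_atlas,
      of "fst z" 0 "snd z"] that
    by (auto simp: o_def)
  ultimately have C2: "Ck_on 2 ?S (\<lambda>z. l (snd z))"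
    using Ck_on_cong_open[of ?S "l \<circ> torus_velocity \<circ> chart_inv (tchart torus ?c)" "\<lambda>z. l (snd z)"
      2]
    by (simp add: open_Times)
  have slice: "(\<lambda>w. f (snd (0 :: real^'n, w))) differentiable (at w)"
    if "(\<lambda>z :: (real^'n) \<times> (real^'n). f (snd z)) differentiable (at (0, w))"
      for f :: "real^'n \<Rightarrow> real" and w
    by (rule differentiable_compose[where f="\<lambda>z. f (snd z)" and g="\<lambda>w. (0, w)"])
       (use that in \<open>auto intro!: derivative_eq_intros simp: differentiable_def\<close>)
  have diff_l: "l differentiable (at w)" for w
    using slice[of l w] C2 by (simp add: numeral_2_eq_2)
  then show "l differentiable (at w)" .
  have D: "frechet_derivative (\<lambda>z :: (real^'n) \<times> (real^'n). l (snd z)) (at z) (0, b) =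
    frechet_derivative l (at (snd z)) b" for z b
  proof -
    have "(l has_derivative frechet_derivative l (at (snd z))) (at (snd z))"
      using diff_l by (simp add: frechet_derivative_works[symmetric])
    from has_derivative_compose[OF has_derivative_snd[OF has_derivative_ident] this]
    have "((\<lambda>z :: (real^'n) \<times> (real^'n). l (snd z)) has_derivative (\<lambda>h. frechet_derivative l (at
      (snd z)) (snd h))) (at z)" .
    from frechet_derivative_at[OF this] show ?thesis by (metis snd_conv)
  qed
  show "(\<lambda>z. frechet_derivative l (at z) b) differentiable (at w)"
  proof -
    have "Ck_on 1 ?S (\<lambda>z. frechet_derivative (\<lambda>z. l (snd z)) (at z) (0, b))"
      using C2 by (simp add: numeral_2_eq_2)
    then have "(\<lambda>z :: (real^'n) \<times> (real^'n). frechet_derivative l (at (snd z)) b) differentiable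
      (at (0, w))"
      by (simp add: D)
    from slice[OF this] show ?thesis by simp
  qed
  assume "b \<noteq> 0"
  have x: "torus_proj 0 \<in> fst ?c" by simp
  have "fibre_hessian torus (l \<circ> torus_velocity) ?c (torus_proj 0) w b b > 0"
    using L torus_chart_atlas x \<open>b \<noteq> 0\<close> unfolding tonelli_def by blast
  moreover have "(\<lambda>y. (l \<circ> torus_velocity) (torus_proj 0, tvec torus ?c (torus_proj 0) y)) = l"
    by (rule ext) (simp add: tvec_torus torus_velocity_tvec torus_proj_in)
  ultimately show "frechet_derivative (\<lambda>z. frechet_derivative l (at z) b) (at w) b > 0"
    by (simp add: fibre_hessian_def)
qed

text \<open>Restricted to the line from \<open>v\<close> to \<open>w\<close>, the function has the
  fibre Hessian in the direction of the line as its second derivative, so it is convex in one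
  variable and lies above its tangent.\<close>

lemma tonelli_torus_tangent:
  fixes l :: "real^'n \<Rightarrow> real"
  assumes L: "tonelli torus g (l \<circ> torus_velocity)"
  shows "l v + frechet_derivative l (at v) (w - v) \<le> l w"
proof -
  define u where "u = w - v"
  have line: "((\<lambda>t. v + t *\<^sub>R u) has_derivative (\<lambda>s. s *\<^sub>R u)) (at t)" for t
    by (auto intro!: derivative_eq_intros)
  have comp: "((\<lambda>t. f (v + t *\<^sub>R u)) has_field_derivative frechet_derivative f (at (v +
    t *\<^sub>R u)) u) (at t)"
    if "f differentiable (at (v + t *\<^sub>R u))" for f :: "real^'n \<Rightarrow> real" and t
  proof -
    have f: "(f has_derivative frechet_derivative f (at (v + t *\<^sub>R u))) (at (v + t *\<^sub>R u))"
      using that by (simp add: frechet_derivative_works[symmetric])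
    from has_derivative_compose[OF line f]
    have "((\<lambda>t. f (v + t *\<^sub>R u)) has_derivative (\<lambda>s. frechet_derivative f (at (v +
      t *\<^sub>R u)) (s *\<^sub>R u))) (at t)" .
    then show ?thesis
      using linear_scale[OF has_derivative_linear[OF f]]
        by (simp add: has_field_derivative_def mult_commute_abs)
  qed
  have pos: "0 \<le> frechet_derivative (\<lambda>z. frechet_derivative l (at z) u) (at x) u" for x
  proof (cases "u = 0")
    case True
    have "linear (frechet_derivative (\<lambda>z. frechet_derivative l (at z) u) (at x))"
      by (rule linear_frechet_derivative[OF tonelli_torus_C2(2)[OF L]])
    from linear_0[OF this] show ?thesis by (simp add: True)
  next
    case False then show ?thesis using tonelli_torus_C2(3)[OF L] by (simp add: less_imp_le)
  qed
  have "convex_on UNIV (\<lambda>t. l (v + t *\<^sub>R u))"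
    by (rule f''_ge0_imp_convex[OF convex_UNIV comp[OF tonelli_torus_C2(1)[OF L]] comp[OF
      tonelli_torus_C2(2)[OF L]] pos])
  from convex_on_imp_above_tangent[OF this, of 0 1 "frechet_derivative l (at v) u"]
  have "l (v + 1 *\<^sub>R u) - l (v + 0 *\<^sub>R u) \<ge> frechet_derivative l (at v) u * (1 - 0)"
    using comp[OF tonelli_torus_C2(1)[OF L], of 0] by simp
  then show ?thesis by (simp add: u_def)
qed

text \<open>By convexity \<open>\<beta>(h) = l v\<close>, where \<open>v\<close> is the rotation vector of \<open>h\<close>, and the Lebesgue measure
  on the velocity \<open>v\<close>, which has full support, is minimizing.\<close>

theorem torus_mather_beta_eq_iff:
  fixes l :: "real^'n \<Rightarrow> real" and V :: "(real^'n) set \<Rightarrow> real"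
  assumes g: "riemannian_metric torus g" and L: "tonelli torus g (l \<circ> torus_velocity)"
    and V: "Ck_fun k torus V" "\<forall>x\<in>topspace torus_topology. V x \<le> 0" and h: "h \<in> H1 torus"
  shows "mather_beta torus g (add_potential (l \<circ> torus_velocity) V) h =
    mather_beta torus g (l \<circ> torus_velocity) h
     \<longleftrightarrow> (\<forall>x\<in>topspace torus_topology. V x = 0)"
proof -
  interpret R: closed_riemannian torus g
    by unfold_locales (rule closed_manifold_torus, rule g)
  let ?L = "l \<circ> torus_velocity"
  have V': "\<forall>x\<in>topspace (mtop torus). V x \<le> 0" using V(2) by simp
  obtain v where v: "\<And>\<eta> F a. periodic_primitive \<eta> F a \<Longrightarrow> pairing torus \<eta> h = a \<bullet> v"
    using torus_rotation_vector[OF h] by blast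
  define \<mu>0 where "\<mu>0 = torus_measure v"
  have L_cont: "continuous_map (TM_topology torus) euclideanreal ?L"
    by (rule R.tonelli_continuous[OF L])
  have \<mu>0: "\<mu>0 \<in> finite_action torus g ?L h"
    unfolding \<mu>0_def finite_action_def
    using torus_measure_rotation[OF g v] torus_measure_integral(1)[OF L_cont, of v] by simp
  have L_\<mu>0: "(\<integral>p. ?L p \<partial>\<mu>0) = l v"
    unfolding \<mu>0_def torus_measure_integral(2)[OF L_cont]
      by (simp add: prob_space.prob_space[OF prob_space_cube])
  \<comment> \<open>Integrate the tangent inequality at \<open>v\<close>. Its linear term is a
    closed form, so its integral depends only on the rotation class and can be computed on
    \<open>\<mu>0\<close>, where the velocity is constantly \<open>v\<close>.\<close>
  have lower: "l v \<le> (\<integral>p. ?L p \<partial>\<mu>)" if \<mu>: "\<mu> \<in> finite_action torus g ?L h" for \<mu>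
  proof -
    let ?D = "frechet_derivative l (at v)"
    have D: "linear ?D" by (rule linear_frechet_derivative[OF tonelli_torus_C2(1)[OF L]])
    let ?\<eta> = "\<lambda>p. ?D (torus_velocity p)"
    have cf: "continuous_form torus ?\<eta>"
      by (rule closed_imp_continuous_form[OF linear_velocity_form(1)[OF D]])
    note bp = R.finite_action_borel[OF \<mu>]
    interpret prob_space \<mu> using bp by (simp add: borel_probability_def)
    have space: "space \<mu> = TM torus" using bp by (simp add: borel_probability_def torus.topspace_TM)
    have "(\<integral>p. ?\<eta> p \<partial>\<mu>) = pairing torus ?\<eta> h"
      using \<mu> linear_velocity_form(1)[OF D] by (simp add: finite_action_def rotation_fibre_def)
    also have "\<dots> = (\<integral>p. ?\<eta> p \<partial>\<mu>0)"
      using \<mu>0 linear_velocity_form(1)[OF D] by (simp add: finite_action_def rotation_fibre_def)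
    also have "\<dots> = ?D v"
      unfolding \<mu>0_def torus_measure_integral(2)[OF torus.continuous_form_continuous[OF cf]]
      by (simp add: prob_space.prob_space[OF prob_space_cube])
    finally have rot: "(\<integral>p. ?\<eta> p \<partial>\<mu>) = ?D v" .
    obtain C where C: "\<And>p. p \<in> TM torus \<Longrightarrow> \<bar>?\<eta> p\<bar> \<le> C * tnorm g p"
      using R.continuous_form_bound[OF cf] by blast
    have int: "integrable \<mu> ?\<eta>"
    proof (rule Bochner_Integration.integrable_bound)
      show "integrable \<mu> (\<lambda>p. C * tnorm g p)"
        using \<mu> by (simp add: finite_action_def rotation_fibre_def closed_measures_def)
      show "?\<eta> \<in> borel_measurable \<mu>"
        by (rule borel_probability_measurable[OF bp torus.continuous_form_continuous[OF cf]])
      show "AE p in \<mu>. norm (?\<eta> p) \<le> norm (C * tnorm g p)"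
      proof (rule AE_I2)
        fix p assume "p \<in> space \<mu>"
        from C[OF this[unfolded space]] show "norm (?\<eta> p) \<le> norm (C * tnorm g p)" by simp
      qed
    qed
    have "(\<integral>p. l v - ?D v + ?\<eta> p \<partial>\<mu>) \<le> (\<integral>p. ?L p \<partial>\<mu>)"
    proof (rule integral_mono)
      show "integrable \<mu> (\<lambda>p. l v - ?D v + ?\<eta> p)" using int by simp
      show "integrable \<mu> ?L" by (rule R.finite_action_integrable[OF \<mu>])
      show "l v - ?D v + ?\<eta> p \<le> ?L p" for p
        using tonelli_torus_tangent[OF L, of v "torus_velocity p"] by (simp add: linear_diff[OF D])
    qed
    moreover have "(\<integral>p. l v - ?D v + ?\<eta> p \<partial>\<mu>) = l v" using int rot by (simp add: prob_space)
    ultimately show ?thesis by simp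
  qed
  have beta_L: "mather_beta torus g ?L h = l v"
  proof (rule antisym)
    show "mather_beta torus g ?L h \<le> l v" using R.mather_beta_le'[OF L \<mu>0] L_\<mu>0 by simp
    show "l v \<le> mather_beta torus g ?L h"
      unfolding mather_beta_def by (rule cINF_greatest) (use \<mu>0 in blast, rule lower)
  qed
  show ?thesis
  proof
    assume eq: "mather_beta torus g (add_potential ?L V) h = mather_beta torus g ?L h"
    \<comment> \<open>Since \<open>\<mu>0\<close> minimizes the action of \<open>?L\<close>,
      equality of the beta-values leaves no room for a negative integral of the potential.\<close>
    have "(\<integral>p. V (fst p) \<partial>\<mu>0) = 0"
      using R.mather_beta_le[OF L V(1) \<mu>0] R.integral_add_potential[OF V(1) \<mu>0] L_\<mu>0 beta_L eq
        R.integral_potential_le_0[OF R.finite_action_borel[OF \<mu>0] V'] by simp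
    then have zero: "V (fst p) = 0" if "p \<in> msupport (TM_topology torus) \<mu>0" for p
      using R.potential_zero_on_support[OF R.finite_action_borel[OF \<mu>0] V(1) V' _ that] by blast
    show "\<forall>x\<in>topspace torus_topology. V x = 0"
    proof
      fix x :: "(real^'n) set" assume "x \<in> topspace torus_topology"
      then obtain y where "x = torus_proj y" by (auto simp: topspace_torus)
      then show "V x = 0" using zero[OF torus_measure_support[of y v, folded \<mu>0_def]]
        by (simp add: torus_point_def)
    qed
  next
    assume zero: "\<forall>x\<in>topspace torus_topology. V x = 0"
    have eq: "(\<integral>p. add_potential ?L V p \<partial>\<mu>) = (\<integral>p. ?L p \<partial>\<mu>)" if "\<mu> \<in> finite_action torus g ?L h"
      for \<mu>
    proof (rule Bochner_Integration.integral_cong[OF refl])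
      fix p assume "p \<in> space \<mu>"
      then have "p \<in> TM torus"
        using R.finite_action_borel[OF that] by (simp add: borel_probability_def torus.topspace_TM)
      then have "fst p \<in> topspace torus_topology" by (auto simp: TM_def)
      then show "add_potential ?L V p = ?L p" using zero by (simp add: R.add_potential_eq)
    qed
    show "mather_beta torus g (add_potential ?L V) h = mather_beta torus g ?L h"
      unfolding mather_beta_def R.finite_action_add_potential[OF V(1)]
        by (rule INF_cong[OF refl eq])
  qed
qed

theorem theorem11:
  fixes M :: "('a, 'e::euclidean_space) manifold"
    and g :: "'a \<Rightarrow> ('a, 'e) tvector \<Rightarrow> ('a, 'e) tvector \<Rightarrow> real"
    and L :: "'a \<times> ('a, 'e) tvector \<Rightarrow> real"
    and V :: "'a \<Rightarrow> real"
    and g' :: "(real^'n) set \<Rightarrow> ((real^'n) set, real^'n) tvector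
                \<Rightarrow> ((real^'n) set, real^'n) tvector \<Rightarrow> real"
    and l :: "real^'n \<Rightarrow> real"
    and V' :: "(real^'n) set \<Rightarrow> real"
  shows
    "(closed_manifold M \<and> riemannian_metric M g \<and> tonelli M g L \<and> Ck_fun 2 M V \<and>
      (\<forall>x\<in>topspace (mtop M). V x \<le> 0) \<and> (\<exists>x\<in>topspace (mtop M). V x = 0) \<longrightarrow>
        (\<forall>h\<in>H1 M. mather_beta M g (add_potential L V) h \<le> mather_beta M g L h) \<and>
        (\<forall>h\<in>H1 M - {H1_zero M}.
           mather_beta M g (add_potential L V) h = mather_beta M g L h \<longleftrightarrow>
             mather_measures M g L h \<subseteq> mather_measures M g (add_potential L V) h \<and>
             mather_set M g L h \<subseteq> mather_set M g (add_potential L V) h \<and>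
             (\<forall>(x, v)\<in>mather_set M g L h. V x = 0))) \<and>
     (riemannian_metric torus g' \<and> tonelli torus g' (l \<circ> torus_velocity) \<and> Ck_fun 2 torus V' \<and>
      (\<forall>x\<in>topspace (mtop torus). V' x \<le> 0) \<and> (\<exists>x\<in>topspace (mtop torus). V' x = 0) \<longrightarrow>
        (\<forall>h\<in>H1 torus - {H1_zero torus}.
           mather_beta torus g' (add_potential (l \<circ> torus_velocity) V') h =
             mather_beta torus g' (l \<circ> torus_velocity) h \<longleftrightarrow>
           (\<forall>x\<in>topspace (mtop torus). V' x = 0)))"
proof (intro conjI impI)
  assume A: "closed_manifold M \<and> riemannian_metric M g \<and> tonelli M g L \<and> Ck_fun 2 M V \<and>
      (\<forall>x\<in>topspace (mtop M). V x \<le> 0) \<and> (\<exists>x\<in>topspace (mtop M). V x = 0)"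
  interpret closed_riemannian M g
    by unfold_locales (use A in \<open>simp_all add: closed_manifold_def\<close>)
  have L: "tonelli M g L" and V: "Ck_fun 2 M V" "\<forall>x\<in>topspace (mtop M). V x \<le> 0" using A by simp_all
  show "\<forall>h\<in>H1 M. mather_beta M g (add_potential L V) h \<le> mather_beta M g L h"
    by (rule ballI) (rule mather_beta_add_potential_le[OF L V])
  show "\<forall>h\<in>H1 M - {H1_zero M}.
       mather_beta M g (add_potential L V) h = mather_beta M g L h \<longleftrightarrow>
         mather_measures M g L h \<subseteq> mather_measures M g (add_potential L V) h \<and>
         mather_set M g L h \<subseteq> mather_set M g (add_potential L V) h \<and>
         (\<forall>(x, v)\<in>mather_set M g L h. V x = 0)"
    by (intro ballI mather_beta_add_potential_eq_iff[OF L V])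
next
  assume A: "riemannian_metric torus g' \<and> tonelli torus g' (l \<circ> torus_velocity) \<and>
    Ck_fun 2 torus V' \<and>
      (\<forall>x\<in>topspace (mtop torus). V' x \<le> 0) \<and> (\<exists>x\<in>topspace (mtop torus). V' x = 0)"
  then have "riemannian_metric torus g'" "tonelli torus g' (l \<circ> torus_velocity)" "Ck_fun 2 torus V'"
    "\<forall>x\<in>topspace torus_topology. V' x \<le> 0" by simp_all
  note * = torus_mather_beta_eq_iff[OF this]
  show "\<forall>h\<in>H1 torus - {H1_zero torus}.
       mather_beta torus g' (add_potential (l \<circ> torus_velocity) V') h =
         mather_beta torus g' (l \<circ> torus_velocity) h \<longleftrightarrow>
       (\<forall>x\<in>topspace (mtop torus). V' x = 0)"
    unfolding mtop_torus by (intro ballI *) blast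
qed

end
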